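(* Let $n\in\mathbb Z_{>0}$, $\tau\in\mathbb H$, $p\in E_\tau\setminus E_\tau[2]$. If $\widetilde Q_n(\widetilde B;\tau)$ is the monic Lamé spectral polynomial and $Q^{(1)}_{n,p}(T;\tau)$ is the spectral polynomial of the non-even family $\mathrm{GLE}^{(1)}_n(p,T,\tau)$, then $$Q^{(1)}_{n,p}(T;\tau)=\widetilde Q_n\bigl(T^2-n(n+1)\wp(p);\tau\bigr).$$
   Context: Notation: $E_\tau=\mathbb C/(\mathbb Z+\mathbb Z\tau)$; $\wp,\zeta$ are the Weierstrass functions. $\mathrm{GLE}^{(1)}_n(p,T,\tau)$ is $y''=q^{(1)}_n(z;p,T)y$ with $$q_n^{(1)}=n(n+1)\wp(z)+\tfrac34(\wp(z+p)+\wp(z-p))+T(\zeta(z+p)+\zeta(z-p)-2\zeta(z))-\tfrac{\wp''(p)}{4\wp'(p)}(\zeta(z+p)-\zeta(z-p))+B,$$ $B=T^2+\frac{\wp''(p)}{2\wp'(p)}\zeta(p)-\frac12(2n^2+2n-3)\wp(p)$. The equation $\Phi'''-4q^{(1)}_n\Phi'-2(q^{(1)}_n)'\Phi=0$ has, up to scalar, a unique nonzero solution elliptic in $z$; let $\Phi(z;T)$ be the one that is a monic polynomial of degree $2n$ in $T$ with coefficients elliptic in $z$. Then $Q^{(1)}_{n,p}(T;\tau):=q^{(1)}_n\Phi^2-\frac12\Phi\Phi''+\frac14(\Phi')^2$ is independent of $z$ and is a monic polynomial in $T$ of degree $4n+2$. For the Lamé equation $w''=\tilde q w$, $\tilde q=n(n+1)\wp(z)+\widetilde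 B$, let $\tilde\Phi(z;\widetilde B)$ be the elliptic solution of $\tilde\Phi'''-4\tilde q\tilde\Phi'-2\tilde q'\tilde\Phi=0$ that is monic of degree $n$ in $\widetilde B$; then $\widetilde Q_n(\widetilde B;\tau):=\tilde q\tilde\Phi^2-\frac12\tilde\Phi\tilde\Phi''+\frac14(\tilde\Phi')^2$ is the monic Lamé spectral polynomial, of degree $2n+1$. *)

theory Defs
  imports "HOL-Complex_Analysis.Complex_Analysis"
    "HOL-Computational_Algebra.Polynomial"
begin

definition period_lattice :: "complex \<Rightarrow> complex set" where
  "period_lattice \<tau> = {of_int a + of_int b * \<tau> | a b :: int. True}"

definition weierstrass_wp :: "complex \<Rightarrow> complex \<Rightarrow> complex" where
  "weierstrass_wp \<tau> z =
     1 / z\<^sup>2 + (\<Sum>\<^sub>\<infinity>\<omega>\<in>period_lattice \<tau> - {0}. 1 / (z - \<omega>)\<^sup>2 - 1 / \<omega>\<^sup>2)"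

definition weierstrass_zeta :: "complex \<Rightarrow> complex \<Rightarrow> complex" where
  "weierstrass_zeta \<tau> z =
     1 / z + (\<Sum>\<^sub>\<infinity>\<omega>\<in>period_lattice \<tau> - {0}. 1 / (z - \<omega>) + 1 / \<omega> + z / \<omega>\<^sup>2)"

text \<open>
  The library predicate \<^const>\<open>nicely_meromorphic_on\<close> fixes the value of the function at its
  poles (as 0) and at removable singularities (as the limit), so that elliptic functions
  are equal as HOL functions as soon as they are equal as meromorphic functions.
\<close>

definition elliptic :: "complex \<Rightarrow> (complex \<Rightarrow> complex) \<Rightarrow> bool" where
  "elliptic \<tau> f \<longleftrightarrow> f nicely_meromorphic_on UNIV \<and>
     (\<forall>\<omega>\<in>period_lattice \<tau>. \<forall>z. f (z + \<omega>) = f z)"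

text \<open>
  Below, \<open>q t z\<close> is the potential of a family of equations \<open>y'' = q y\<close> with
  spectral parameter \<open>t\<close>, and \<open>\<Phi> z\<close> is a polynomial in \<open>t\<close>, so that \<open>poly (\<Phi> z) t\<close>
  stands for \<open>\<Phi>(z; t)\<close>. Identities between functions meromorphic in \<open>z\<close> are required
  outside a set of points without accumulation point in the plane
  (quantifier \<open>\<forall>\<^sub>\<approx>\<close>), because values at poles are meaningless.
\<close>

definition monic_elliptic_solution ::
    "complex \<Rightarrow> (complex \<Rightarrow> complex \<Rightarrow> complex) \<Rightarrow> nat \<Rightarrow> (complex \<Rightarrow> complex poly) \<Rightarrow> bool" where
  "monic_elliptic_solution \<tau> q d \<Phi> \<longleftrightarrow>
     (\<forall>z. degree (\<Phi> z) = d \<and> lead_coeff (\<Phi> z) = 1) \<and>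
     (\<forall>i. elliptic \<tau> (\<lambda>z. coeff (\<Phi> z) i)) \<and>
     (\<forall>t. \<not> (\<forall>\<^sub>\<approx>z. poly (\<Phi> z) t = 0)) \<and>
     (\<forall>t. \<forall>\<^sub>\<approx>z.
        (deriv ^^ 3) (\<lambda>w. poly (\<Phi> w) t) z
          - 4 * q t z * deriv (\<lambda>w. poly (\<Phi> w) t) z
          - 2 * deriv (q t) z * poly (\<Phi> z) t = 0)"

definition spectral_solution ::
    "complex \<Rightarrow> (complex \<Rightarrow> complex \<Rightarrow> complex) \<Rightarrow> nat \<Rightarrow> complex \<Rightarrow> complex poly" where
  "spectral_solution \<tau> q d = (THE \<Phi>. monic_elliptic_solution \<tau> q d \<Phi>)"

definition spectral_poly ::
    "complex \<Rightarrow> (complex \<Rightarrow> complex \<Rightarrow> complex) \<Rightarrow> nat \<Rightarrow> complex poly" where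
  "spectral_poly \<tau> q d =
     (let \<Phi> = spectral_solution \<tau> q d in
      THE Q. \<forall>t. \<forall>\<^sub>\<approx>z.
        poly Q t =
          q t z * (poly (\<Phi> z) t)\<^sup>2
          - 1 / 2 * poly (\<Phi> z) t * (deriv ^^ 2) (\<lambda>w. poly (\<Phi> w) t) z
          + 1 / 4 * (deriv (\<lambda>w. poly (\<Phi> w) t) z)\<^sup>2)"

definition lame_potential :: "nat \<Rightarrow> complex \<Rightarrow> complex \<Rightarrow> complex \<Rightarrow> complex" where
  "lame_potential n \<tau> B z = of_nat (n * (n + 1)) * weierstrass_wp \<tau> z + B"

definition lame_spectral_poly :: "nat \<Rightarrow> complex \<Rightarrow> complex poly" where
  "lame_spectral_poly n \<tau> = spectral_poly \<tau> (lame_potential n \<tau>) n"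

definition gle_accessory :: "nat \<Rightarrow> complex \<Rightarrow> complex \<Rightarrow> complex \<Rightarrow> complex" where
  "gle_accessory n p \<tau> T =
     T\<^sup>2
     + (deriv ^^ 2) (weierstrass_wp \<tau>) p / (2 * deriv (weierstrass_wp \<tau>) p) * weierstrass_zeta \<tau> p
     - 1 / 2 * (2 * of_nat n ^ 2 + 2 * of_nat n - 3) * weierstrass_wp \<tau> p"

definition gle_potential :: "nat \<Rightarrow> complex \<Rightarrow> complex \<Rightarrow> complex \<Rightarrow> complex \<Rightarrow> complex" where
  "gle_potential n p \<tau> T z =
     of_nat (n * (n + 1)) * weierstrass_wp \<tau> z
     + 3 / 4 * (weierstrass_wp \<tau> (z + p) + weierstrass_wp \<tau> (z - p))
     + T * (weierstrass_zeta \<tau> (z + p) + weierstrass_zeta \<tau> (z - p) - 2 * weierstrass_zeta \<tau> z)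
     - (deriv ^^ 2) (weierstrass_wp \<tau>) p / (4 * deriv (weierstrass_wp \<tau>) p)
         * (weierstrass_zeta \<tau> (z + p) - weierstrass_zeta \<tau> (z - p))
     + gle_accessory n p \<tau> T"

definition gle_spectral_poly :: "nat \<Rightarrow> complex \<Rightarrow> complex \<Rightarrow> complex poly" where
  "gle_spectral_poly n p \<tau> = spectral_poly \<tau> (gle_potential n p \<tau>) (2 * n)"

end

theory Submission
  imports Defs "HOL-Computational_Algebra.Fundamental_Theorem_Algebra"
begin

text \<open>
  If \<open>w\<close> solves the Lame equation with parameter \<open>T\<^sup>2 - n(n+1)wp(p)\<close>, whose potential is
  \<open>g + T\<^sup>2\<close> with \<open>g = n(n+1)(wp(z) - wp(p))\<close>, then \<open>y = (w' - T w) / sqrt g\<close> satisfies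
  \<open>y'' = q y\<close> with \<open>q = g + (T + h/2)\<^sup>2 - h'/2\<close> and \<open>h = g'/g\<close>. The addition theorems for \<open>wp\<close> and
  \<open>\<zeta>\<close> identify \<open>q\<close> with the potential of the generalized Lame equation. The transformation preserves
  Wronskians up to sign, hence the spectral polynomial, which is a quarter of the squared Wronskian.
  On products of solutions it acts, up to sign, as \<open>\<Phi> = \<phi> - (\<phi>''/2 - T \<phi>') / g\<close>, which turns a monic polynomial
  of degree \<open>n\<close> in \<open>T\<^sup>2 - n(n+1)wp(p)\<close> into a monic polynomial of degree \<open>2n\<close> in \<open>T\<close>.

  The normalised solution is unique because every solution polynomial in \<open>T\<close> is a multiple
  \<open>P(T) F\<close> of one of minimal degree, and \<open>P\<close> is constant if the solution vanishes
  identically for no \<open>T\<close>.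
\<close>

section \<open>The period lattice\<close>

text \<open>With u = w' - T w the Lame equation becomes the first-order system w' = T w + u, u' = g
  w - T u. Eliminating w gives u'' - h u' - (g + T^2 + T h) u = 0, and u = sqrt g * y removes the
  first derivative; this is the origin of q. The system also yields u1 u2' - u1' u2 = -g (w1 w2' -
  w1' w2), hence the change of sign of the Wronskian. The poles fit: since wp'(p) is nonzero, g has
  simple zeros at p and -p, which create the double poles with coefficient 3/4, while at 0 the
  double poles of h^2/4 and h'/2 cancel and n(n+1) survives. Neither the square root nor y occurs in
  the proof: for products of solutions the transformation is rational in T, g, phi and the
  derivatives of phi, and its properties are algebraic identities. Both spectral polynomials are
  definite descriptions, so a solution with the exact normalisation has to be exhibited. For Lame it
  is a polynomial in wp given by a recursion; for the other family it is the transform of this one,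
  and it must be shown not to vanish identically for any T.\<close>

lemma infsum_holomorphic:
  fixes f :: "'a \<Rightarrow> complex \<Rightarrow> complex"
  assumes "open A" and holo: "\<And>x. x \<in> X \<Longrightarrow> f x holomorphic_on A"
    and bound: "\<And>x z. x \<in> X \<Longrightarrow> z \<in> A \<Longrightarrow> norm (f x z) \<le> M x" and M: "M summable_on X"
  shows "(\<lambda>z. \<Sum>\<^sub>\<infinity>x\<in>X. f x z) holomorphic_on A"
    and "z \<in> A \<Longrightarrow> ((\<lambda>x. (deriv ^^ m) (f x) z) has_sum (deriv ^^ m) (\<lambda>z. \<Sum>\<^sub>\<infinity>x\<in>X. f x z) z) X"
proof -
  let ?F = "finite_subsets_at_top X" and ?S = "\<lambda>z. \<Sum>\<^sub>\<infinity>x\<in>X. f x z"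
  have ulim: "uniform_limit A (\<lambda>Y z. \<Sum>x\<in>Y. f x z) ?S ?F"
    by (rule Weierstrass_m_test_general[OF bound M])
  have ev: "\<forall>\<^sub>F Y in ?F. finite Y \<and> Y \<subseteq> X"
    by (simp add: eventually_finite_subsets_at_top_weakI)
  have holo_sum: "\<forall>\<^sub>F Y in ?F. (\<lambda>z. \<Sum>x\<in>Y. f x z) holomorphic_on A"
    using ev by eventually_elim (auto intro!: holomorphic_on_sum holo)
  show "?S holomorphic_on A"
  proof -
    have "?S field_differentiable at z" if zA: "z \<in> A" for z
    proof -
      obtain r where r: "r > 0" "cball z r \<subseteq> A"
        using \<open>open A\<close> zA by (meson open_contains_cball)
      have "\<forall>\<^sub>F Y in ?F. continuous_on (cball z r) (\<lambda>z. \<Sum>x\<in>Y. f x z) \<and>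
              (\<lambda>z. \<Sum>x\<in>Y. f x z) holomorphic_on ball z r"
        using holo_sum
      proof eventually_elim
        case (elim Y)
        thus ?case
          using r ball_subset_cball[of z r]
          by (meson holomorphic_on_imp_continuous_on holomorphic_on_subset order_trans)
      qed
      from holomorphic_uniform_limit[OF this uniform_limit_on_subset[OF ulim r(2)]]
      have "?S holomorphic_on ball z r" by auto
      thus ?thesis
        using r by (meson centre_in_ball holomorphic_on_imp_differentiable_at open_ball)
    qed
    thus ?thesis by (simp add: field_differentiable_at_within holomorphic_on_def)
  qed
  assume z: "z \<in> A"
  \<comment> \<open>Derivatives of a locally uniform limit of holomorphic functions converge to
    those of the limit, so the series can be differentiated termwise to every order. The
    \<open>has_sum\<close> form keeps the terms available for reindexing.\<close>
  have "((\<lambda>Y. (deriv ^^ m) (\<lambda>z. \<Sum>x\<in>Y. f x z) z) \<longlongrightarrow> (deriv ^^ m) ?S z) ?F"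
    by (rule higher_deriv_complex_uniform_limit[OF ulim holo_sum _ \<open>open A\<close> z]) auto
  moreover have "\<forall>\<^sub>F Y in ?F. (deriv ^^ m) (\<lambda>z. \<Sum>x\<in>Y. f x z) z = (\<Sum>x\<in>Y. (deriv ^^ m) (f x) z)"
    using ev
  proof eventually_elim
    case (elim Y)
    hence "finite Y" "Y \<subseteq> X" by auto
    thus ?case
    proof (induction Y rule: finite_induct)
      case empty
      show ?case by (simp del: funpow.simps)
    next
      case (insert y Y)
      have "(deriv ^^ m) (\<lambda>z. f y z + (\<Sum>x\<in>Y. f x z)) z
          = (deriv ^^ m) (f y) z + (deriv ^^ m) (\<lambda>z. \<Sum>x\<in>Y. f x z) z"
        by (rule higher_deriv_add[OF _ _ \<open>open A\<close> z])
           (use insert in \<open>auto intro!: holomorphic_on_sum holo\<close>)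
      thus ?case using insert by simp
    qed
  qed
  ultimately show "((\<lambda>x. (deriv ^^ m) (f x) z) has_sum (deriv ^^ m) ?S z) X"
    unfolding has_sum_def using tendsto_cong by fast
qed

text \<open>The exponent is half of the 3 in the lattice sum, which is bounded by a product of two
  such series, one for each integer coordinate. The shift by 1 keeps the bound valid when a
  coordinate is 0.\<close>

lemma summable_on_int_powr:
  "(\<lambda>a::int. (1 + \<bar>real_of_int a\<bar>) powr (- 3 / 2)) summable_on UNIV"
proof -
  let ?g = "\<lambda>a::int. (1 + \<bar>real_of_int a\<bar>) powr (- 3 / 2)"
  have "summable (\<lambda>n. real n powr (- 3 / 2))"
    by (subst summable_real_powr_iff) auto
  hence "summable (\<lambda>n. real (Suc n) powr (- 3 / 2))"
    by (subst summable_Suc_iff)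
  hence nat: "(\<lambda>n. (1 + real n) powr (- 3 / 2)) summable_on UNIV"
    by (subst summable_on_UNIV_nonneg_real_iff) auto
  have "?g summable_on range int"
    by (subst summable_on_reindex) (use nat in \<open>auto simp: o_def\<close>)
  moreover have "?g summable_on range (\<lambda>n. - int n)"
    by (subst summable_on_reindex) (use nat in \<open>auto simp: o_def inj_on_def\<close>)
  ultimately have "?g summable_on (range int \<union> range (\<lambda>n. - int n))"
    by (rule summable_on_union)
  also have "range int \<union> range (\<lambda>n. - int n) = UNIV"
  proof -
    have "x \<in> range int \<union> range (\<lambda>n. - int n)" for x
      by (cases x rule: int_cases2) auto
    thus ?thesis by blast
  qed
  finally show ?thesis .
qed

lemma connected_compl_sparse: "X sparse_in UNIV \<Longrightarrow> connected (- X :: complex set)"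
  using sparse_imp_connected[of "UNIV :: complex set" X] connected_UNIV by (simp add: Compl_eq_Diff_UNIV)

locale complex_lattice =
  fixes \<tau> :: complex
  assumes Im_pos: "Im \<tau> > 0"
begin

abbreviation "\<Lambda> \<equiv> period_lattice \<tau>"
abbreviation "wp \<equiv> weierstrass_wp \<tau>"
abbreviation "\<zeta> \<equiv> weierstrass_zeta \<tau>"

text \<open>The coordinate b is read off from the imaginary part, and a then follows from the
  triangle inequality. Both the discreteness of the lattice and the convergence of its series rest
  on this comparison.\<close>

lemma lattice_bound:
  obtains K where "K > 0"
    "\<And>a b :: int. \<bar>real_of_int a\<bar> \<le> K * norm (of_int a + of_int b * \<tau>)"
    "\<And>a b :: int. \<bar>real_of_int b\<bar> \<le> K * norm (of_int a + of_int b * \<tau>)"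
proof
  \<comment> \<open>The summands are those of |b| <= |w| / Im tau and |a| <= |w| + |b| |tau|, so one
    constant serves both bounds.\<close>
  define K where "K = (1 + norm \<tau>) / Im \<tau> + 1"
  have K: "K * x = x / Im \<tau> + norm \<tau> * x / Im \<tau> + x" for x
    by (simp add: K_def ring_distribs add_divide_distrib)
  show "K > 0"
    unfolding K_def using Im_pos by (intro add_nonneg_pos divide_nonneg_pos) auto
  fix a b :: int
  let ?w = "of_int a + of_int b * \<tau>"
  have "Im ?w = of_int b * Im \<tau>" by simp
  hence "\<bar>of_int b\<bar> * Im \<tau> \<le> norm ?w"
    using abs_Im_le_cmod[of ?w] Im_pos by (simp add: abs_mult)
  hence b: "\<bar>of_int b\<bar> \<le> norm ?w / Im \<tau>"
    using Im_pos by (simp add: field_simps)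
  show "\<bar>of_int b\<bar> \<le> K * norm ?w"
    unfolding K using Im_pos by (intro order_trans[OF b]) simp
  have "norm (of_int a :: complex) \<le> norm ?w + norm (of_int b * \<tau>)"
    by (metis add_diff_cancel_right' norm_triangle_ineq4)
  also have "norm (of_int b * \<tau>) \<le> norm ?w / Im \<tau> * norm \<tau>"
    unfolding norm_mult norm_of_int using b by (intro mult_right_mono) auto
  finally show "\<bar>of_int a\<bar> \<le> K * norm ?w"
    unfolding K norm_of_int using divide_nonneg_pos[OF norm_ge_zero Im_pos, of ?w]
    by (simp add: mult.commute)
qed

lemma lattice_add: "x \<in> \<Lambda> \<Longrightarrow> y \<in> \<Lambda> \<Longrightarrow> x + y \<in> \<Lambda>"
proof -
  assume "x \<in> \<Lambda>" "y \<in> \<Lambda>"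
  then obtain a b c d where "x = of_int a + of_int b * \<tau>" "y = of_int c + of_int d * \<tau>"
    unfolding period_lattice_def by blast
  hence "x + y = of_int (a + c) + of_int (b + d) * \<tau>"
    by (simp add: algebra_simps)
  thus ?thesis unfolding period_lattice_def by blast
qed

lemma lattice_minus: "x \<in> \<Lambda> \<Longrightarrow> - x \<in> \<Lambda>"
proof -
  assume "x \<in> \<Lambda>"
  then obtain a b where "x = of_int a + of_int b * \<tau>"
    unfolding period_lattice_def by blast
  hence "- x = of_int (- a) + of_int (- b) * \<tau>" by simp
  thus ?thesis unfolding period_lattice_def by blast
qed

lemma lattice_0 [simp]: "0 \<in> \<Lambda>"
proof -
  have "0 = of_int 0 + of_int 0 * \<tau>" by simp
  thus ?thesis unfolding period_lattice_def by blast
qed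

lemma lattice_minus_iff [simp]: "- x \<in> \<Lambda> \<longleftrightarrow> x \<in> \<Lambda>"
  using lattice_minus[of x] lattice_minus[of "-x"] by auto

lemma lattice_diff: "x \<in> \<Lambda> \<Longrightarrow> y \<in> \<Lambda> \<Longrightarrow> x - y \<in> \<Lambda>"
  using lattice_add[of x "-y"] by simp

lemma lattice_add_iff: "w \<in> \<Lambda> \<Longrightarrow> z + w \<in> \<Lambda> \<longleftrightarrow> z \<in> \<Lambda>"
  using lattice_add[of z w] lattice_diff[of "z + w" w] by auto

lemma lattice_norm_bound:
  obtains c where "c > 0" "\<And>w. w \<in> \<Lambda> - {0} \<Longrightarrow> c \<le> norm w"
proof -
  obtain K where K: "K > 0"
    "\<And>a b :: int. \<bar>real_of_int a\<bar> \<le> K * norm (of_int a + of_int b * \<tau>)"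
    "\<And>a b :: int. \<bar>real_of_int b\<bar> \<le> K * norm (of_int a + of_int b * \<tau>)"
    using lattice_bound by blast
  show ?thesis
  proof (rule that[of "1 / K"])
    fix w assume w: "w \<in> \<Lambda> - {0}"
    then obtain a b where ab: "w = of_int a + of_int b * \<tau>"
      unfolding period_lattice_def by blast
    have "a \<noteq> 0 \<or> b \<noteq> 0" using w ab by auto
    hence "\<bar>real_of_int a\<bar> \<ge> 1 \<or> \<bar>real_of_int b\<bar> \<ge> 1" by auto
    hence "1 \<le> K * norm w" using K(2)[of a b] K(3)[of b a] unfolding ab by linarith
    thus "1 / K \<le> norm w" using K(1) by (simp add: field_simps)
  qed (use K in auto)
qed

text \<open>Distinct lattice points have a minimal distance. Arbitrary subsets are allowed because
  the lattice is used with 0 or another single point deleted.\<close>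

lemma closed_subset_lattice: "X \<subseteq> \<Lambda> \<Longrightarrow> closed X"
proof -
  assume X: "X \<subseteq> \<Lambda>"
  obtain c where c: "c > 0" "\<And>w. w \<in> \<Lambda> - {0} \<Longrightarrow> c \<le> norm w"
    using lattice_norm_bound by blast
  show ?thesis
  proof (rule discrete_imp_closed[OF c(1)], intro ballI impI)
    fix x y assume "x \<in> X" "y \<in> X" "dist y x < c"
    thus "y = x" using c(2)[of "y - x"] lattice_diff[of y x] X by (force simp: dist_norm)
  qed
qed

lemma lattice_sparse: "\<Lambda> sparse_in UNIV"
proof -
  have "\<not> y islimpt \<Lambda>" for y
  proof
    assume y: "y islimpt \<Lambda>"
    hence "y islimpt (\<Lambda> - {y})"
      using islimpt_punctured by blast
    thus False using closed_subset_lattice[of "\<Lambda> - {y}"] closed_limpt by blast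
  qed
  thus ?thesis by (subst sparse_in_open) auto
qed

text \<open>By \<open>lattice_bound\<close>, (1 + |a|) (1 + |b|) <= (2 K |w|)^2; the power 3/2 of
  this bounds |w|^-3 by a product of a function of a and a function of b.\<close>

lemma lattice_summable: "(\<lambda>w. 1 / norm w ^ 3) summable_on (\<Lambda> - {0})"
proof -
  obtain K where K: "K > 0"
    "\<And>a b :: int. \<bar>real_of_int a\<bar> \<le> K * norm (of_int a + of_int b * \<tau>)"
    "\<And>a b :: int. \<bar>real_of_int b\<bar> \<le> K * norm (of_int a + of_int b * \<tau>)"
    using lattice_bound by blast
  let ?h = "\<lambda>(a, b). of_int a + of_int b * \<tau>"
  let ?u = "\<lambda>a::int. (1 + \<bar>real_of_int a\<bar>) powr (- 3 / 2)"
  let ?S = "UNIV - {(0::int, 0::int)}"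
  have zero: "a = 0 \<and> b = 0" if "of_int a + of_int b * \<tau> = 0" for a b :: int
    using K(2)[of a b] K(3)[of b a] unfolding that by simp
  have inj: "inj ?h"
  proof (rule injI, clarify)
    fix a b c d :: int
    assume "of_int a + of_int b * \<tau> = of_int c + of_int d * \<tau>"
    hence "of_int (a - c) + of_int (b - d) * \<tau> = 0" by (simp add: algebra_simps)
    from zero[OF this] show "a = c \<and> b = d" by simp
  qed
  have img: "\<Lambda> - {0} = ?h ` ?S"
    using zero unfolding period_lattice_def by (auto simp: image_iff) 
  have "(\<lambda>(a, b). ?u a * ?u b) summable_on (UNIV \<times> UNIV)"
  proof (rule summable_on_SigmaI)
    show "((\<lambda>b. case (a, b) of (a, b) \<Rightarrow> ?u a * ?u b) has_sum ?u a * infsum ?u UNIV) UNIV" for a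
      using has_sum_cmult_right[OF has_sum_infsum[OF summable_on_int_powr]] by simp
    show "(\<lambda>a. ?u a * infsum ?u UNIV) summable_on UNIV"
      by (intro summable_on_cmult_left summable_on_int_powr)
  qed auto
  hence "(\<lambda>(a, b). ?u a * ?u b) summable_on ?S"
    by (rule summable_on_subset_banach) auto
  hence "(\<lambda>x. (2 * K) ^ 3 * (case x of (a, b) \<Rightarrow> ?u a * ?u b)) summable_on ?S"
    by (rule summable_on_cmult_right)
  hence "((\<lambda>w. 1 / norm w ^ 3) \<circ> ?h) summable_on ?S"
  proof (rule summable_on_comparison_test)
    fix x assume "x \<in> ?S"
    then obtain a b where x: "x = (a, b)" and nz: "a \<noteq> 0 \<or> b \<noteq> 0" by (cases x) auto
    let ?w = "of_int a + of_int b * \<tau>"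
    have w: "norm ?w > 0" using zero[of a b] nz by auto
    \<comment> \<open>This absorbs the summand 1 in 1 + |a| and in 1 + |b|.\<close>
    have one: "1 \<le> K * norm ?w" using K(2)[of a b] K(3)[of b a] nz by linarith
    define A B where "A = 1 + \<bar>real_of_int a\<bar>" and "B = 1 + \<bar>real_of_int b\<bar>"
    have AB: "0 < A" "0 < B" "A \<le> 2 * K * norm ?w" "B \<le> 2 * K * norm ?w"
      using one K(2)[of a b] K(3)[of b a] unfolding A_def B_def by linarith+
    have "A powr (3/2) * B powr (3/2) \<le> (2 * K * norm ?w) powr (3/2) * (2 * K * norm ?w) powr (3/2)"
      using AB by (intro mult_mono powr_mono2) auto
    also have "\<dots> = (2 * K) ^ 3 * norm ?w ^ 3"
      using K(1) w by (simp add: power_mult_distrib flip: powr_add)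
    finally have "1 / norm ?w ^ 3 \<le> (2 * K) ^ 3 * (1 / (A powr (3/2) * B powr (3/2)))"
      using w AB by (simp add: field_simps)
    also have "1 / (A powr (3/2) * B powr (3/2)) = ?u a * ?u b"
      unfolding A_def[symmetric] B_def[symmetric]
      by (simp add: powr_minus field_simps)
    finally show "((\<lambda>w. 1 / norm w ^ 3) \<circ> ?h) x \<le> (2 * K) ^ 3 * (case x of (a, b) \<Rightarrow> ?u a * ?u b)"
      by (simp add: x)
  qed (auto simp: o_def)
  thus ?thesis
    unfolding img by (subst summable_on_reindex) (use inj in \<open>auto intro: inj_on_subset\<close>)
qed

end

section \<open>The Weierstrass functions\<close>

context complex_lattice begin

definition zeta_tail :: "complex set \<Rightarrow> complex \<Rightarrow> complex" where
  "zeta_tail X z = (\<Sum>\<^sub>\<infinity>w\<in>X. 1 / (z - w) + 1 / w + z / w\<^sup>2)"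

text \<open>Each term equals z^2 / (w^2 (z - w)), which is O(|w|^-3) uniformly near a point off X,
  so the M-test applies. This is the only series that is estimated: \<open>wp\<close> and its
  derivatives are reached by differentiating it.\<close>

lemma
  assumes X: "X \<subseteq> \<Lambda> - {0}"
  shows zeta_tail_holomorphic: "zeta_tail X holomorphic_on - X"
    and zeta_tail_has_sum: "z \<notin> X \<Longrightarrow>
      ((\<lambda>w. (deriv ^^ m) (\<lambda>z. 1 / (z - w) + 1 / w + z / w\<^sup>2) z) has_sum (deriv ^^ m) (zeta_tail X) z) X"
proof -
  have "\<exists>A. open A \<and> z \<in> A \<and> zeta_tail X holomorphic_on A \<and>
      ((\<lambda>w. (deriv ^^ m) (\<lambda>z. 1 / (z - w) + 1 / w + z / w\<^sup>2) z) has_sum (deriv ^^ m) (zeta_tail X) z) X"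
    if z: "z \<notin> X" for z m
  proof -
    have "open (- X)"
      using closed_subset_lattice[of X] X by auto
    then obtain d where d: "d > 0" "ball z d \<subseteq> - X"
      using z openE by blast
    \<comment> \<open>Halving the radius keeps all points of X at distance at least d / 2 from
      A.\<close>
    define A where "A = ball z (d / 2)"
    define R where "R = norm z + d"
    define f :: "complex \<Rightarrow> complex \<Rightarrow> complex" where "f = (\<lambda>w z. 1 / (z - w) + 1 / w + z / w\<^sup>2)"
    have R: "R > 0" using d by (simp add: R_def add_nonneg_pos)
    have sum: "(\<lambda>w. R\<^sup>2 * (1 + 2 * R / d) * (1 / norm w ^ 3)) summable_on X"
      by (intro summable_on_cmult_right summable_on_subset_banach[OF lattice_summable X])
    have bound: "norm (f w u) \<le> R\<^sup>2 * (1 + 2 * R / d) * (1 / norm w ^ 3)" if w: "w \<in> X" and u: "u \<in> A" for w u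
    proof -
      have nu: "norm u \<le> R"
        using u norm_triangle_ineq2[of u z] d by (simp add: A_def R_def dist_norm norm_minus_commute)
      have "w \<notin> ball z d" using w d by auto
      hence dw: "norm (u - w) \<ge> d / 2"
        using u dist_triangle[of z w u] by (simp add: A_def dist_norm norm_minus_commute)
      \<comment> \<open>Together with |u| <= R this bounds |w| by a multiple of |u - w|, which
        replaces the factor 1 / |u - w| by 1 / |w|.\<close>
      hence "2 * R / d * norm (u - w) \<ge> R" using d R by (simp add: field_simps)
      moreover have "norm w \<le> norm (u - w) + norm u"
        using norm_triangle_ineq4[of u "u - w"] by simp
      ultimately have nw: "norm w \<le> (1 + 2 * R / d) * norm (u - w)"
        using nu by (simp add: algebra_simps)
      have nz: "w \<noteq> 0" "u - w \<noteq> 0" using w X dw d by auto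
      have "f w u = u\<^sup>2 / (w\<^sup>2 * (u - w))"
        using nz unfolding f_def by (simp add: divide_simps) (simp add: algebra_simps power2_eq_square)
      hence "norm (f w u) = (norm u)\<^sup>2 * (1 / (norm w)\<^sup>2) * (1 / norm (u - w))"
        by (simp add: norm_divide norm_mult norm_power)
      also have "\<dots> \<le> R\<^sup>2 * (1 / (norm w)\<^sup>2) * ((1 + 2 * R / d) / norm w)"
        using nu nw nz R d by (intro mult_mono power_mono) (auto simp: field_simps)
      also have "\<dots> = R\<^sup>2 * (1 + 2 * R / d) * (1 / norm w ^ 3)"
        by (simp add: power3_eq_cube power2_eq_square)
      finally show ?thesis .
    qed
    have holo: "f w holomorphic_on A" if w: "w \<in> X" for w
    proof -
      have "A \<subseteq> ball z d" using d by (auto simp: A_def)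
      hence "w \<notin> A" using w d by blast
      thus ?thesis unfolding f_def using w X by (auto intro!: holomorphic_intros)
    qed
    have zA: "open A" "z \<in> A" using d by (auto simp: A_def)
    have eq: "zeta_tail X = (\<lambda>z. infsum (\<lambda>w. f w z) X)"
      by (simp add: zeta_tail_def f_def fun_eq_iff)
    show ?thesis
      using infsum_holomorphic(1)[OF zA(1) holo bound sum]
        infsum_holomorphic(2)[OF zA(1) holo bound sum zA(2), where m = m] zA
      unfolding eq[symmetric] by (intro exI[of _ A]) (simp add: f_def)
  qed
  note * = this
  show "zeta_tail X holomorphic_on - X"
  proof -
    have "zeta_tail X field_differentiable at z" if "z \<notin> X" for z
      using *[OF that] holomorphic_on_imp_differentiable_at by blast
    thus ?thesis by (simp add: holomorphic_on_def field_differentiable_at_within)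
  qed
  show "((\<lambda>w. (deriv ^^ m) (\<lambda>z. 1 / (z - w) + 1 / w + z / w\<^sup>2) z) has_sum (deriv ^^ m) (zeta_tail X) z) X"
    if "z \<notin> X" using *[OF that] by blast
qed

lemma deriv_zeta_term:
  fixes z w :: complex
  assumes "z \<noteq> w" "w \<noteq> 0"
  shows "deriv (\<lambda>z. 1 / (z - w) + 1 / w + z / w\<^sup>2) z = - (1 / (z - w)\<^sup>2 - 1 / w\<^sup>2)"
proof (rule DERIV_imp_deriv)
  show "((\<lambda>z. 1 / (z - w) + 1 / w + z / w\<^sup>2) has_field_derivative - (1 / (z - w)\<^sup>2 - 1 / w\<^sup>2)) (at z)"
    using assms by (auto intro!: derivative_eq_intros simp: power2_eq_square)
qed

lemma deriv2_zeta_term: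
  fixes z w :: complex
  assumes "z \<noteq> w" "w \<noteq> 0"
  shows "(deriv ^^ 2) (\<lambda>z. 1 / (z - w) + 1 / w + z / w\<^sup>2) z = 2 / (z - w) ^ 3"
proof -
  have "eventually (\<lambda>x. x \<in> - {w}) (nhds z)"
    using assms by (intro eventually_nhds_in_open) auto
  hence "eventually (\<lambda>x. deriv (\<lambda>z. 1 / (z - w) + 1 / w + z / w\<^sup>2) x = - (1 / (x - w)\<^sup>2 - 1 / w\<^sup>2)) (nhds z)"
    by eventually_elim (rule deriv_zeta_term, use assms in auto)
  hence "deriv (deriv (\<lambda>z. 1 / (z - w) + 1 / w + z / w\<^sup>2)) z = deriv (\<lambda>x. - (1 / (x - w)\<^sup>2 - 1 / w\<^sup>2)) z"
    by (intro deriv_cong_ev) auto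
  also have "\<dots> = 2 / (z - w) ^ 3"
  proof (rule DERIV_imp_deriv)
    show "((\<lambda>x. - (1 / (x - w)\<^sup>2 - 1 / w\<^sup>2)) has_field_derivative 2 / (z - w) ^ 3) (at z)"
    proof -
      obtain u where u: "z = u + w" "u \<noteq> 0"
        using assms(1) by (metis diff_add_cancel eq_iff_diff_eq_0)
      show ?thesis unfolding u(1) using u(2) assms(2)
        by (auto intro!: derivative_eq_intros simp: field_simps power2_eq_square power3_eq_cube)
    qed
  qed
  finally show ?thesis by (simp add: numeral_2_eq_2)
qed

text \<open>The regular part of \<open>\<zeta>\<close> at 0: only the pole at 0 is split off, the
  other lattice poles remain. \<open>wp_reg\<close> plays the same role for
  \<open>wp\<close>.\<close>

definition zeta_reg :: "complex \<Rightarrow> complex" where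
  "zeta_reg = zeta_tail (\<Lambda> - {0})"

definition wp_reg :: "complex \<Rightarrow> complex" where
  "wp_reg z = - deriv zeta_reg z"

lemma open_compl_lattice: "open (- \<Lambda>)" "open (- (\<Lambda> - {0}))"
  using closed_subset_lattice[of \<Lambda>] closed_subset_lattice[of "\<Lambda> - {0}"]
  by (blast intro: open_Compl)+

lemma zeta_reg_holomorphic: "zeta_reg holomorphic_on - (\<Lambda> - {0})"
  unfolding zeta_reg_def by (rule zeta_tail_holomorphic) auto

lemma wp_reg_holomorphic: "wp_reg holomorphic_on - (\<Lambda> - {0})"
  unfolding wp_reg_def[abs_def]
  by (intro holomorphic_on_minus holomorphic_deriv zeta_reg_holomorphic open_compl_lattice)

lemma zeta_eq: "\<zeta> z = 1 / z + zeta_reg z"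
  by (simp add: weierstrass_zeta_def zeta_reg_def zeta_tail_def)

lemma wp_reg_has_sum:
  assumes "z \<notin> \<Lambda> - {0}"
  shows "((\<lambda>w. 1 / (z - w)\<^sup>2 - 1 / w\<^sup>2) has_sum wp_reg z) (\<Lambda> - {0})"
proof -
  have "((\<lambda>w. - deriv (\<lambda>z. 1 / (z - w) + 1 / w + z / w\<^sup>2) z) has_sum wp_reg z) (\<Lambda> - {0})"
    using zeta_tail_has_sum[OF order_refl assms, of 1]
    by (auto simp: wp_reg_def zeta_reg_def intro: has_sum_uminusI)
  also have "?this \<longleftrightarrow> ?thesis"
    using assms by (intro has_sum_cong) (subst deriv_zeta_term, auto)
  finally show ?thesis .
qed

lemma wp_eq: "z \<notin> \<Lambda> - {0} \<Longrightarrow> wp z = 1 / z\<^sup>2 + wp_reg z"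
  using infsumI[OF wp_reg_has_sum] by (simp add: weierstrass_wp_def)

lemma wp_reg_0: "wp_reg 0 = 0"
proof -
  have "((\<lambda>w. 0) has_sum wp_reg 0) (\<Lambda> - {0})"
    using wp_reg_has_sum[of 0] by (simp cong: has_sum_cong)
  thus ?thesis using infsumI by fastforce
qed

text \<open>The reindexing w -> -w compares the defining sums themselves, so lattice points need no
  exception.\<close>

lemma wp_even: "wp (- z) = wp z"
proof -
  have "infsum (\<lambda>w. 1 / (- z - w)\<^sup>2 - 1 / w\<^sup>2) (\<Lambda> - {0}) = infsum (\<lambda>w. 1 / (z - w)\<^sup>2 - 1 / w\<^sup>2) (\<Lambda> - {0})"
  proof (rule infsum_reindex_bij_witness[of _ uminus uminus])
    fix w
    have "(z + w)\<^sup>2 = (- z - w)\<^sup>2" by (simp add: power2_eq_square algebra_simps)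
    thus "1 / (z - (- w))\<^sup>2 - 1 / (- w)\<^sup>2 = 1 / (- z - w)\<^sup>2 - 1 / w\<^sup>2" by simp
  qed auto
  thus ?thesis by (simp add: weierstrass_wp_def)
qed

lemma zeta_odd: "\<zeta> (- z) = - \<zeta> z"
proof -
  have "infsum (\<lambda>w. 1 / (- z - w) + 1 / w + - z / w\<^sup>2) (\<Lambda> - {0})
      = infsum (\<lambda>w. - (1 / (z - w) + 1 / w + z / w\<^sup>2)) (\<Lambda> - {0})"
  proof (rule infsum_reindex_bij_witness[of _ uminus uminus])
    fix w
    have "1 / (- z - w) = - (1 / (z + w))"
      by (metis add_uminus_conv_diff minus_add_distrib minus_divide_right)
    thus "- (1 / (z - (- w)) + 1 / (- w) + z / (- w)\<^sup>2) = 1 / (- z - w) + 1 / w + - z / w\<^sup>2" by simp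
  qed auto
  thus ?thesis unfolding weierstrass_zeta_def infsum_uminus by simp
qed

lemma wp_reg_even: "z \<notin> \<Lambda> - {0} \<Longrightarrow> wp_reg (- z) = wp_reg z"
  using wp_eq[of z] wp_eq[of "- z"] wp_even[of z] by auto

lemma wp_holomorphic: "wp holomorphic_on - \<Lambda>"
proof -
  have "(\<lambda>z. 1 / z\<^sup>2 + wp_reg z) holomorphic_on - \<Lambda>"
    by (intro holomorphic_intros holomorphic_on_subset[OF wp_reg_holomorphic]) auto
  thus ?thesis by (rule holomorphic_transform) (subst wp_eq, auto)
qed

lemma zeta_has_field_derivative:
  assumes "z \<notin> \<Lambda>"
  shows "(\<zeta> has_field_derivative - wp z) (at z)"
proof -
  have "z \<noteq> 0" using assms lattice_0 by blast
  have "(zeta_reg has_field_derivative - wp_reg z) (at z)"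
    unfolding wp_reg_def minus_minus using assms
    by (intro holomorphic_derivI[OF zeta_reg_holomorphic open_compl_lattice(2)]) auto
  hence "((\<lambda>z. 1 / z + zeta_reg z) has_field_derivative - wp z) (at z)"
    using \<open>z \<noteq> 0\<close> assms by (auto intro!: derivative_eq_intros simp: wp_eq power2_eq_square)
  thus ?thesis by (simp add: zeta_eq[abs_def])
qed

text \<open>Differentiation kills the correction terms 1 / w^2, and the sum runs over the whole
  lattice. In this form periodicity is a mere reindexing.\<close>

lemma deriv_wp_has_sum:
  assumes "z \<notin> \<Lambda>"
  shows "((\<lambda>w. - 2 / (z - w) ^ 3) has_sum deriv wp z) \<Lambda>"
proof -
  have nz: "z \<noteq> 0" using assms lattice_0 by blast
  have "((\<lambda>w. - ((deriv ^^ 2) (\<lambda>z. 1 / (z - w) + 1 / w + z / w\<^sup>2) z)) has_sum - ((deriv ^^ 2) zeta_reg z)) (\<Lambda> - {0})"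
    unfolding zeta_reg_def using assms by (intro has_sum_uminusI zeta_tail_has_sum) auto
  also have "?this \<longleftrightarrow> ((\<lambda>w. - 2 / (z - w) ^ 3) has_sum - ((deriv ^^ 2) zeta_reg z)) (\<Lambda> - {0})"
    using assms by (intro has_sum_cong) (subst deriv2_zeta_term, auto)
  finally have "((\<lambda>w. - 2 / (z - w) ^ 3) has_sum (- 2 / (z - 0) ^ 3 + (- ((deriv ^^ 2) zeta_reg z)))) (insert 0 (\<Lambda> - {0}))"
    by (intro has_sum_insert) auto
  also have "insert 0 (\<Lambda> - {0}) = \<Lambda>" by auto
  also have "- 2 / (z - 0) ^ 3 + (- ((deriv ^^ 2) zeta_reg z)) = deriv wp z"
  proof -
    have "eventually (\<lambda>x. x \<in> - \<Lambda>) (nhds z)"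
      using assms by (intro eventually_nhds_in_open open_compl_lattice) auto
    hence "eventually (\<lambda>x. wp x = 1 / x\<^sup>2 - deriv zeta_reg x) (nhds z)"
      by eventually_elim (subst wp_eq, auto simp: wp_reg_def)
    hence "deriv wp z = deriv (\<lambda>x. 1 / x\<^sup>2 - deriv zeta_reg x) z"
      by (intro deriv_cong_ev) auto
    also have "\<dots> = - 2 / z ^ 3 - deriv (deriv zeta_reg) z"
    proof (rule DERIV_imp_deriv)
      have "(deriv zeta_reg has_field_derivative deriv (deriv zeta_reg) z) (at z)"
        using assms by (intro holomorphic_derivI[OF holomorphic_deriv[OF zeta_reg_holomorphic]] open_compl_lattice(2)) auto
      thus "((\<lambda>x. 1 / x\<^sup>2 - deriv zeta_reg x) has_field_derivative - 2 / z ^ 3 - deriv (deriv zeta_reg) z) (at z)"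
        using nz by (auto intro!: derivative_eq_intros simp: field_simps power2_eq_square power3_eq_cube)
    qed
    finally show ?thesis by (simp add: numeral_2_eq_2)
  qed
  finally show ?thesis .
qed

lemma deriv_wp_periodic:
  assumes "z \<notin> \<Lambda>" "w \<in> \<Lambda>"
  shows "deriv wp (z + w) = deriv wp z"
proof -
  have zw: "z + w \<notin> \<Lambda>" using assms lattice_add_iff by blast
  have "((\<lambda>v. - 2 / (z + w - v) ^ 3) has_sum deriv wp (z + w)) \<Lambda>"
    by (rule deriv_wp_has_sum[OF zw])
  also have "?this \<longleftrightarrow> ((\<lambda>v. - 2 / (z - v) ^ 3) has_sum deriv wp (z + w)) \<Lambda>"
    using assms(2)
    by (intro has_sum_reindex_bij_witness[of _ "\<lambda>v. v + w" "\<lambda>v. v - w"])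
       (auto simp: lattice_add lattice_diff algebra_simps)
  finally show ?thesis
    using deriv_wp_has_sum[OF assms(1)] has_sum_unique by blast
qed

lemma wp_has_field_derivative: "z \<notin> \<Lambda> \<Longrightarrow> (wp has_field_derivative deriv wp z) (at z)"
  by (rule holomorphic_derivI[OF wp_holomorphic open_compl_lattice(1)]) auto

text \<open>The difference of both sides has derivative 0 on a connected set, so it is constant. At
  -w/2, which must not be a pole, evenness shows that the constant is 0.\<close>

lemma wp_shift_half_lattice:
  assumes w: "w \<in> \<Lambda>" "w / 2 \<notin> \<Lambda>" and z: "z \<notin> \<Lambda>"
  shows "wp (z + w) = wp z"
proof -
  have "((\<lambda>z. wp (z + w) - wp z) has_field_derivative 0) (at z)" if "z \<in> - \<Lambda>" for z
  proof -
    have "(wp has_field_derivative deriv wp (z + w)) (at (z + w))"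
      using that w lattice_add_iff by (intro wp_has_field_derivative) auto
    moreover have "(wp has_field_derivative deriv wp z) (at z)"
      using that by (intro wp_has_field_derivative) auto
    ultimately show ?thesis
      using deriv_wp_periodic[of z w] that w
      by (auto intro!: derivative_eq_intros simp: DERIV_shift)
  qed
  hence "(\<lambda>z. wp (z + w) - wp z) constant_on - \<Lambda>"
    by (rule has_field_derivative_0_imp_constant_on)
       (auto intro: connected_compl_sparse lattice_sparse open_compl_lattice)
  then obtain c where c: "\<And>z. z \<notin> \<Lambda> \<Longrightarrow> wp (z + w) - wp z = c"
    unfolding constant_on_def by auto
  have "- (w / 2) \<notin> \<Lambda>" using w by (simp add: lattice_minus_iff del: minus_divide_left)
  from c[OF this] have "c = 0" using wp_even[of "w / 2"] by (simp add: field_simps)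
  with c[OF z] show ?thesis by simp
qed

text \<open>For a general period w, the point w/2 may be a pole. The periods form a group, however,
  so the generators 1 and tau suffice, and their halves are not lattice points.\<close>

lemma wp_periodic:
  assumes w: "w \<in> \<Lambda>" and z: "z \<notin> \<Lambda>"
  shows "wp (z + w) = wp z"
proof -
  define P where "P = (\<lambda>w. w \<in> \<Lambda> \<and> (\<forall>z. z \<notin> \<Lambda> \<longrightarrow> wp (z + w) = wp z))"
  have half: "of_int a / 2 + of_int b / 2 * \<tau> \<notin> \<Lambda>" if "odd a \<or> odd b" for a b
  proof
    assume "of_int a / 2 + of_int b / 2 * \<tau> \<in> \<Lambda>"
    then obtain c d where eq: "of_int a / 2 + of_int b / 2 * \<tau> = of_int c + of_int d * \<tau>"
      unfolding period_lattice_def by blast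
    have "of_int b / 2 * Im \<tau> = of_int d * Im \<tau>"
      using arg_cong[OF eq, of Im] by simp
    hence "real_of_int b = of_int (2 * d)" using Im_pos by simp
    hence b: "b = 2 * d" by linarith
    have "complex_of_int a = of_int (2 * c)" using eq b by simp
    hence "a = 2 * c" using of_int_eq_iff by blast
    with b that show False by auto
  qed
  have add: "P (x + y)" if "P x" "P y" for x y
  proof -
    have "wp (z + x + y) = wp z" if "z \<notin> \<Lambda>" for z
      using \<open>P x\<close> \<open>P y\<close> that lattice_add_iff[of x z] unfolding P_def by auto
    thus ?thesis using that lattice_add unfolding P_def by (simp add: add_ac)
  qed
  have minus: "P (- x)" if "P x" for x
  proof -
    have "wp (z - x) = wp z" if "z \<notin> \<Lambda>" for z
      using \<open>P x\<close> that lattice_add_iff[of "-x" z] unfolding P_def by force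
    thus ?thesis using that lattice_minus unfolding P_def by simp
  qed
  have P0: "P 0" by (simp add: P_def)
  have mult_nat: "P (of_nat n * x)" if "P x" for n x
    by (induction n) (use that add P0 in \<open>auto simp: algebra_simps\<close>)
  have mult: "P (of_int a * x)" if "P x" for a x
    by (cases a rule: int_cases2) (use mult_nat[OF that] minus in \<open>auto\<close>)
  have "1 \<in> \<Lambda>" "\<tau> \<in> \<Lambda>"
    using exI[of "\<lambda>a. \<exists>b. 1 = of_int a + of_int b * \<tau>" 1] exI[of "\<lambda>b. 1 = of_int 1 + of_int b * \<tau>" 0]
      exI[of "\<lambda>a. \<exists>b. \<tau> = of_int a + of_int b * \<tau>" 0] exI[of "\<lambda>b. \<tau> = of_int 0 + of_int b * \<tau>" 1]
    unfolding period_lattice_def by auto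
  moreover have "1 / 2 \<notin> \<Lambda>" "\<tau> / 2 \<notin> \<Lambda>"
    using half[of 1 0] half[of 0 1] by auto
  ultimately have P1: "P 1" and P\<tau>: "P \<tau>"
    unfolding P_def using wp_shift_half_lattice by blast+
  obtain a b where "w = of_int a + of_int b * \<tau>"
    using w unfolding period_lattice_def by blast
  hence "P w" using add[OF mult[OF P1, of a] mult[OF P\<tau>, of b]] by simp
  thus ?thesis using z unfolding P_def by blast
qed

end

section \<open>Elliptic functions and the differential equation\<close>

lemma even_imp_deriv_0:
  fixes f :: "complex \<Rightarrow> complex"
  assumes f: "f analytic_on {0}" and even: "eventually (\<lambda>z. f (- z) = f z) (nhds 0)"
  shows "deriv f 0 = 0"
proof -
  have D: "(f has_field_derivative deriv f 0) (at (- 0))"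
    using f by (simp add: analytic_derivI)
  have "((\<lambda>z. f (- z)) has_field_derivative deriv f 0 * (- 1)) (at 0)"
    by (rule DERIV_chain2[of f "deriv f 0" uminus, OF D]) (auto intro!: derivative_eq_intros)
  hence "(f has_field_derivative - deriv f 0) (at 0)"
    using DERIV_cong_ev[OF refl even refl] by simp
  moreover have "(f has_field_derivative deriv f 0) (at 0)" using D by simp
  ultimately have "- deriv f 0 = deriv f 0" by (rule DERIV_unique)
  thus ?thesis by simp
qed

text \<open>The divided difference has a removable singularity at a. Being built from the values of
  f, it gives a factorisation valid at every z, not only near a.\<close>

lemma analytic_factor:
  fixes f :: "complex \<Rightarrow> complex"
  assumes "f analytic_on {a}"
  obtains g where "g analytic_on {a}" "\<And>z. f z = f a + (z - a) * g z" "g a = deriv f a"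
proof -
  define g where "g = (\<lambda>z. if z = a then deriv f a else (f z - f a) / (z - a))"
  obtain A where A: "open A" "a \<in> A" "f holomorphic_on A"
    using assms analytic_at by blast
  have "g holomorphic_on A"
    unfolding g_def by (rule pole_lemma[OF A(3)]) (use A in \<open>simp add: interior_open\<close>)
  hence "g analytic_on {a}" using A analytic_at by blast
  thus ?thesis by (rule that) (auto simp: g_def)
qed

text \<open>This supplies the double zeros that cancel the double poles of \<open>wp\<close>; the
  second derivative identifies the cofactor at a.\<close>

lemma analytic_factor2:
  fixes f :: "complex \<Rightarrow> complex"
  assumes "f analytic_on {a}" "deriv f a = 0"
  obtains g where "g analytic_on {a}" "\<And>z. f z = f a + (z - a)\<^sup>2 * g z"
    "deriv (deriv f) a = 2 * g a"
proof -
  obtain g where g: "g analytic_on {a}" "\<And>z. f z = f a + (z - a) * g z" "g a = deriv f a"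
    using analytic_factor[OF assms(1)] by blast
  obtain h where h: "h analytic_on {a}" "\<And>z. g z = g a + (z - a) * h z"
    using analytic_factor[OF g(1)] by blast
  have eq: "f z = f a + (z - a)\<^sup>2 * h z" for z
    using g(2)[of z] h(2)[of z] g(3) assms(2) by (simp add: power2_eq_square)
  obtain A where A: "open A" "a \<in> A" "h holomorphic_on A"
    using h(1) analytic_at by blast
  have D: "(f has_field_derivative 2 * (z - a) * h z + (z - a)\<^sup>2 * deriv h z) (at z)" if "z \<in> A" for z
  proof -
    have "((\<lambda>z. f a + (z - a)\<^sup>2 * h z) has_field_derivative 2 * (z - a) * h z + (z - a)\<^sup>2 * deriv h z) (at z)"
      by (rule derivative_eq_intros holomorphic_derivI[OF A(3,1) that] refl | simp)+
    thus ?thesis by (simp flip: eq)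
  qed
  have "eventually (\<lambda>z. z \<in> A) (nhds a)" using A by (intro eventually_nhds_in_open)
  hence "eventually (\<lambda>z. deriv f z = 2 * (z - a) * h z + (z - a)\<^sup>2 * deriv h z) (nhds a)"
    by eventually_elim (rule DERIV_imp_deriv[OF D])
  hence "deriv (deriv f) a = deriv (\<lambda>z. 2 * (z - a) * h z + (z - a)\<^sup>2 * deriv h z) a"
    by (intro deriv_cong_ev) auto
  also have "\<dots> = 2 * h a"
  proof (rule DERIV_imp_deriv)
    have D2: "(deriv h has_field_derivative deriv (deriv h) a) (at a)"
      by (rule holomorphic_derivI[OF holomorphic_deriv[OF A(3,1)] A(1,2)])
    show "((\<lambda>z. 2 * (z - a) * h z + (z - a)\<^sup>2 * deriv h z) has_field_derivative 2 * h a) (at a)"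
      by (rule derivative_eq_intros holomorphic_derivI[OF A(3,1,2)] D2 refl | simp)+
  qed
  finally show ?thesis using that[OF h(1) eq] by blast
qed

lemma analytic_eq_const_at:
  fixes g :: "complex \<Rightarrow> complex"
  assumes "eventually (\<lambda>x. g x = c) (at z)" "g analytic_on {z}"
  shows "g z = c"
proof -
  have "(g \<longlongrightarrow> g z) (at z)"
    using assms(2) analytic_at_imp_isCont isCont_def by blast
  moreover have "(g \<longlongrightarrow> c) (at z)"
    using assms(1) by (simp add: tendsto_eventually)
  ultimately show ?thesis using LIM_unique by blast
qed

text \<open>The local extensions may differ from point to point as functions;
  \<open>remove_sings\<close> glues them, since its value is the limit of f and does not depend on
  g.\<close>

lemma remove_sings_analytic:
  fixes f :: "complex \<Rightarrow> complex"
  assumes "\<And>x. \<exists>g. g analytic_on {x} \<and> eventually (\<lambda>y. f y = g y) (at x)"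
  shows "remove_sings f analytic_on UNIV"
    and "eventually (\<lambda>y. f y = remove_sings f y) (at x)"
proof -
  have "remove_sings f analytic_on {x} \<and> eventually (\<lambda>y. f y = remove_sings f y) (at x)" for x
  proof -
    obtain g where g: "g analytic_on {x}" "eventually (\<lambda>y. f y = g y) (at x)"
      using assms by blast
    obtain A where A: "open A" "x \<in> A" "g holomorphic_on A"
      using g(1) analytic_at by blast
    obtain B where B: "open B" "x \<in> B" "\<And>y. y \<in> B \<Longrightarrow> y \<noteq> x \<Longrightarrow> f y = g y"
      using g(2) unfolding eventually_at_topological by blast
    have eq: "remove_sings f y = g y" if y: "y \<in> A \<inter> B" for y
    proof -
      have "eventually (\<lambda>z. f z = g z) (at y)"
      proof (cases "y = x")
        case True
        thus ?thesis using g by simp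
      next
        case False
        have "eventually (\<lambda>z. z \<in> B - {x}) (at y)"
          using y B False by (intro eventually_at_in_open') auto
        thus ?thesis by eventually_elim (use B in auto)
      qed
      hence "remove_sings f y = remove_sings g y" by (intro remove_sings_cong) auto
      also have "\<dots> = g y"
        using y A analytic_at by (intro remove_sings_at_analytic) blast
      finally show ?thesis .
    qed
    have "g holomorphic_on A \<inter> B" using A by (auto intro: holomorphic_on_subset)
    hence "remove_sings f holomorphic_on A \<inter> B"
      by (rule holomorphic_transform) (use eq in auto)
    hence "remove_sings f analytic_on {x}"
      using A B analytic_at[of "remove_sings f" x] by (metis IntI open_Int)
    moreover have "eventually (\<lambda>y. y \<in> A \<inter> B - {x}) (at x)"
      using A B by (intro eventually_at_in_open) auto
    hence "eventually (\<lambda>y. f y = remove_sings f y) (at x)"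
      by eventually_elim (use B eq in auto)
    ultimately show ?thesis by blast
  qed
  thus "remove_sings f analytic_on UNIV" "eventually (\<lambda>y. f y = remove_sings f y) (at x)"
    using analytic_on_analytic_at by blast+
qed

context complex_lattice begin

section \<open>Liouville's theorem for elliptic functions\<close>

lemma lattice_reduce: "\<exists>w\<in>\<Lambda>. norm (z + w) \<le> 1 + norm \<tau>"
proof -
  define y where "y = Im z / Im \<tau>"
  define x where "x = Re (z - of_real y * \<tau>)"
  have z: "z = of_real x + of_real y * \<tau>"
    using Im_pos by (intro complex_eqI) (auto simp: x_def y_def)
  define w where "w = - (of_int \<lfloor>x\<rfloor> + of_int \<lfloor>y\<rfloor> * \<tau>)"
  have "w \<in> \<Lambda>" unfolding w_def lattice_minus_iff unfolding period_lattice_def by blast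
  moreover have "z + w = of_real (frac x) + of_real (frac y) * \<tau>"
    unfolding z w_def frac_def by (simp add: algebra_simps)
  hence "norm (z + w) \<le> \<bar>frac x\<bar> + \<bar>frac y\<bar> * norm \<tau>"
    by (metis norm_mult norm_of_real norm_triangle_ineq)
  hence "norm (z + w) \<le> 1 + norm \<tau>"
    using frac_lt_1[of x] frac_lt_1[of y] frac_ge_0[of x] frac_ge_0[of y]
      mult_right_mono[of "\<bar>frac y\<bar>" 1 "norm \<tau>"] by simp
  ultimately show ?thesis by blast
qed

text \<open>The pole set of an elliptic function is described by finitely many representatives, so
  that local conditions need checking only there.\<close>

definition lattice_hull :: "complex set \<Rightarrow> complex set" where
  "lattice_hull S = {s + w | s w. s \<in> S \<and> w \<in> \<Lambda>}"

lemma in_lattice_hull: "z \<in> lattice_hull S \<longleftrightarrow> (\<exists>s\<in>S. z - s \<in> \<Lambda>)"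
proof
  assume "\<exists>s\<in>S. z - s \<in> \<Lambda>"
  then obtain s where "s \<in> S" "z - s \<in> \<Lambda>" by blast
  moreover have "z = s + (z - s)" by simp
  ultimately show "z \<in> lattice_hull S" unfolding lattice_hull_def by blast
qed (force simp: lattice_hull_def)

lemma lattice_hull_sparse: "finite S \<Longrightarrow> lattice_hull S sparse_in UNIV"
proof -
  assume "finite S"
  have "lattice_hull S = (\<Union>s\<in>S. (+) s ` \<Lambda>)" by (auto simp: lattice_hull_def)
  thus ?thesis
    using \<open>finite S\<close> sparse_in_UN_finite[of S "\<lambda>s. (+) s ` \<Lambda>" UNIV] sparse_in_translate_UNIV[OF lattice_sparse]
    by simp
qed

lemma open_compl_lattice_hull: "finite S \<Longrightarrow> open (- lattice_hull S)"
  using lattice_hull_sparse sparse_in_UNIV_imp_closed by blast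

text \<open>An elliptic function with removable singularities extends to a bounded entire function,
  and Liouville's theorem applies. The second-order equation and the addition formula for
  \<open>wp\<close> are obtained by cancelling poles and citing this lemma.\<close>

lemma elliptic_constant:
  assumes S: "finite S" and holo: "f holomorphic_on - lattice_hull S"
    and per: "\<And>z w. z \<notin> lattice_hull S \<Longrightarrow> w \<in> \<Lambda> \<Longrightarrow> f (z + w) = f z"
    and loc: "\<And>s. s \<in> S \<Longrightarrow> \<exists>g. g analytic_on {s} \<and> eventually (\<lambda>z. f z = g z) (at s)"
  shows "\<exists>c. \<forall>z. z \<notin> lattice_hull S \<longrightarrow> f z = c"
proof -
  have op: "open (- lattice_hull S)" using S open_compl_lattice_hull by blast
  have ev: "eventually (\<lambda>x. x \<notin> lattice_hull S) (at z)" for z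
    using lattice_hull_sparse[OF S] sparse_in_eventually_iff[OF open_UNIV] by blast
  have loc': "\<exists>g. g analytic_on {z} \<and> eventually (\<lambda>x. f x = g x) (at z)" for z
  proof (cases "z \<in> lattice_hull S")
    case False
    thus ?thesis using holo op analytic_at[of f z] by (intro exI[of _ f]) auto
  next
    case True
    \<comment> \<open>Periodicity transports the extension at the representative s to its translate
      z.\<close>
    then obtain s w where z: "z = s + w" "s \<in> S" "w \<in> \<Lambda>" unfolding lattice_hull_def by blast
    obtain g where g: "g analytic_on {s}" "eventually (\<lambda>z. f z = g z) (at s)"
      using loc z by blast
    have "(\<lambda>x. g (x - w)) analytic_on {z}"
      using g(1) z by (intro analytic_on_compose_gen[of "\<lambda>x. x - w" _ g "{s}", unfolded o_def] analytic_intros) auto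
    moreover have "eventually (\<lambda>x. f (x + w) = f x) (at s)"
      using ev by eventually_elim (use per z in auto)
    with g(2) have "eventually (\<lambda>x. f (x + w) = g (x + w - w)) (at s)"
      by eventually_elim simp
    hence "eventually (\<lambda>x. f x = g (x - w)) (at z)"
      unfolding z(1) at_to_0[of "s + w"] at_to_0[of s] eventually_filtermap by (simp add: algebra_simps)
    ultimately show ?thesis by blast
  qed
  define F where "F = remove_sings f"
  have F: "F analytic_on UNIV" "\<And>z. eventually (\<lambda>x. f x = F x) (at z)"
    unfolding F_def using remove_sings_analytic[OF loc'] by auto
  have Fper: "F (z + w) = F z" if "w \<in> \<Lambda>" for z w
  proof -
    have "eventually (\<lambda>x. f (x + w) = f x) (at z)"
      using ev by eventually_elim (use per that in auto)
    hence "eventually (\<lambda>x. f (z + w + x) = f (z + x)) (at 0)"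
      unfolding at_to_0[of z] eventually_filtermap by (simp add: add_ac)
    thus ?thesis unfolding F_def remove_sings_shift_0[of f "z + w"] remove_sings_shift_0[of f z]
      by (intro remove_sings_cong) auto
  qed
  \<comment> \<open>By periodicity all values of F are already taken on a disc containing a
    fundamental parallelogram.\<close>
  have "compact (F ` cball 0 (1 + norm \<tau>))"
    using F(1) by (intro compact_continuous_image holomorphic_on_imp_continuous_on)
      (auto intro: analytic_imp_holomorphic analytic_on_subset)
  moreover have "range F \<subseteq> F ` cball 0 (1 + norm \<tau>)"
  proof clarify
    fix z
    obtain w where "w \<in> \<Lambda>" "norm (z + w) \<le> 1 + norm \<tau>" using lattice_reduce by blast
    thus "F z \<in> F ` cball 0 (1 + norm \<tau>)" using Fper[of w z] by (metis imageI mem_cball_0)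
  qed
  ultimately have "bounded (range F)" using bounded_subset compact_imp_bounded by blast
  then obtain c where c: "\<And>z. F z = c"
    using Liouville_theorem[of F] F(1) analytic_imp_holomorphic constant_on_def
    by (metis UNIV_I)
  have "f z = c" if "z \<notin> lattice_hull S" for z
  proof -
    have "eventually (\<lambda>x. f x = c) (at z)" using F(2)[of z] c by simp
    moreover have "f analytic_on {z}" using that holo op analytic_at[of f z] by auto
    ultimately show ?thesis by (rule analytic_eq_const_at)
  qed
  thus ?thesis by blast
qed

lemma lattice_hull_0 [simp]: "lattice_hull {0} = \<Lambda>"
  by (auto simp: lattice_hull_def)

lemma eventually_not_lattice: "eventually (\<lambda>z. z \<notin> \<Lambda>) (at x)"
  using lattice_sparse sparse_in_eventually_iff[OF open_UNIV] by blast

lemma wp_analytic: "z \<notin> \<Lambda> \<Longrightarrow> wp analytic_on {z}"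
  using analytic_at[of wp z] wp_holomorphic open_compl_lattice(1) by blast

lemma wp_reg_analytic: "z \<notin> \<Lambda> - {0} \<Longrightarrow> wp_reg analytic_on {z}"
  using analytic_at[of wp_reg z] wp_reg_holomorphic open_compl_lattice(2) by blast

lemma wp_shift_eq:
  assumes "w \<in> \<Lambda>" "z \<notin> \<Lambda>"
  shows "wp z = 1 / (z - w)\<^sup>2 + wp_reg (z - w)"
proof -
  have "z - w \<notin> \<Lambda>" using assms lattice_add_iff[of w "z - w"] by auto
  thus ?thesis using wp_periodic[OF assms(1), of "z - w"] wp_eq[of "z - w"] by auto
qed

lemma wp_meromorphic: "wp meromorphic_on A"
proof -
  have "wp meromorphic_on {z}" for z
  proof (cases "z \<in> \<Lambda>")
    case False
    thus ?thesis by (intro analytic_on_imp_meromorphic_on wp_analytic)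
  next
    case True
    have "(\<lambda>x. wp_reg (x - z)) analytic_on {z}"
      by (intro analytic_on_compose_gen[of "\<lambda>x. x - z" _ wp_reg "{0}", unfolded o_def] analytic_intros wp_reg_analytic) auto
    hence "(\<lambda>x. 1 / (x - z)\<^sup>2 + wp_reg (x - z)) meromorphic_on {z}"
      by (intro meromorphic_intros analytic_on_imp_meromorphic_on[of "\<lambda>x. wp_reg (x - z)"]) 
    moreover have "eventually (\<lambda>x. wp x = 1 / (x - z)\<^sup>2 + wp_reg (x - z)) (at z)"
      using eventually_not_lattice by eventually_elim (use True wp_shift_eq in auto)
    ultimately show ?thesis using meromorphic_on_cong[of "{z}"] by fastforce
  qed
  thus ?thesis using meromorphic_on_meromorphic_at by blast
qed

lemma wp_pole_0: "is_pole wp 0"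
proof -
  have "is_pole (\<lambda>z. 1 / (z - 0)\<^sup>2) (0::complex)"
    by (rule is_pole_inverse_power) auto
  hence "filterlim (\<lambda>z. wp_reg z + 1 / z\<^sup>2) at_infinity (at 0)"
    unfolding is_pole_def
    using analytic_at_imp_isCont[OF wp_reg_analytic[of 0]]
    by (intro tendsto_add_filterlim_at_infinity[of _ "wp_reg 0"]) (auto simp: isCont_def)
  moreover have "eventually (\<lambda>z. wp_reg z + 1 / z\<^sup>2 = wp z) (at 0)"
    using eventually_not_lattice by eventually_elim (subst wp_eq, auto)
  ultimately show ?thesis
    unfolding is_pole_def using filterlim_cong[OF refl refl] by fast
qed

text \<open>A meromorphic function is constant or omits any given value off a sparse set, and the
  pole at 0 excludes the first alternative.\<close>

lemma wp_avoid: "\<forall>\<^sub>\<approx>z. wp z \<noteq> c"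
proof -
  have "(\<forall>\<^sub>\<approx>z. wp z = c) \<or> (\<forall>\<^sub>\<approx>z. wp z \<noteq> c)"
    by (rule meromorphic_imp_constant_or_avoid) (auto intro: wp_meromorphic)
  moreover have "\<not> (\<forall>\<^sub>\<approx>z. wp z = c)"
  proof
    assume "\<forall>\<^sub>\<approx>z. wp z = c"
    hence "eventually (\<lambda>z. wp z = c) (at 0)"
      by (rule eventually_cosparse_imp_eventually_at) auto
    hence "is_pole (\<lambda>_::complex. c) 0" using wp_pole_0 is_pole_cong by fastforce
    thus False by simp
  qed
  ultimately show ?thesis by blast
qed

section \<open>The differential equations of \<open>wp\<close>\<close>

lemma deriv_wp_holomorphic: "deriv wp holomorphic_on - \<Lambda>"
  by (intro holomorphic_deriv wp_holomorphic open_compl_lattice)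

lemma deriv2_wp_holomorphic: "deriv (deriv wp) holomorphic_on - \<Lambda>"
  by (intro holomorphic_deriv deriv_wp_holomorphic open_compl_lattice)

lemma deriv_wp_has_field_derivative:
  "z \<notin> \<Lambda> \<Longrightarrow> (deriv wp has_field_derivative deriv (deriv wp) z) (at z)"
  by (rule holomorphic_derivI[OF deriv_wp_holomorphic open_compl_lattice(1)]) auto

lemma deriv2_wp_periodic:
  assumes "z \<notin> \<Lambda>" "w \<in> \<Lambda>"
  shows "deriv (deriv wp) (z + w) = deriv (deriv wp) z"
proof -
  have "eventually (\<lambda>x. x \<in> - \<Lambda>) (nhds z)"
    using assms by (intro eventually_nhds_in_open open_compl_lattice) auto
  hence "eventually (\<lambda>x. deriv wp (x + w) = deriv wp x) (nhds z)"
    by eventually_elim (use assms deriv_wp_periodic in auto)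
  hence "deriv (\<lambda>x. deriv wp (x + w)) z = deriv (deriv wp) z"
    by (intro deriv_cong_ev) auto
  moreover have "deriv (\<lambda>x. deriv wp (x + w)) z = deriv (deriv wp) (z + w)"
    using deriv_wp_has_field_derivative[of "z + w"] assms lattice_add_iff[of w z]
    by (intro DERIV_imp_deriv) (simp add: DERIV_shift)
  ultimately show ?thesis by simp
qed

text \<open>\<open>wp_reg\<close> is even and vanishes at 0. Thus wp = 1/z^2 + O(z^2); the missing
  constant term is what makes the poles cancel below.\<close>

lemma wp_near_0:
  obtains k where "k analytic_on {0}" "\<And>z. wp_reg z = z\<^sup>2 * k z"
proof -
  have "eventually (\<lambda>z. z \<in> - (\<Lambda> - {0})) (nhds 0)"
    by (intro eventually_nhds_in_open open_compl_lattice) auto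
  hence "eventually (\<lambda>z. wp_reg (- z) = wp_reg z) (nhds 0)"
    by eventually_elim (use wp_reg_even in auto)
  hence "deriv wp_reg 0 = 0"
    by (intro even_imp_deriv_0 wp_reg_analytic) auto
  from analytic_factor2[OF wp_reg_analytic this] obtain k
    where "k analytic_on {0}" "\<And>z. wp_reg z = wp_reg 0 + (z - 0)\<^sup>2 * k z" by auto
  thus ?thesis using that wp_reg_0 by auto
qed

text \<open>The second-order equation is proved before the first-order one: its poles cancel after
  squaring the expansion at 0, without a cubic expansion, and integrating it yields the
  other.\<close>

lemma wp_second_order: "\<exists>a. \<forall>z. z \<notin> \<Lambda> \<longrightarrow> deriv (deriv wp) z = 6 * (wp z)\<^sup>2 - a"
proof -
  obtain k where k: "k analytic_on {0}" "\<And>z. wp_reg z = z\<^sup>2 * k z" using wp_near_0 by blast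
  let ?f = "\<lambda>z. deriv (deriv wp) z - 6 * (wp z)\<^sup>2"
  have "\<exists>g. g analytic_on {0} \<and> eventually (\<lambda>z. ?f z = g z) (at 0)"
  proof (intro exI conjI)
    \<comment> \<open>The cross term of 6 (1/z^2 + z^2 k)^2 is 12 k; the terms 6/z^4 of both
      summands cancel.\<close>
    let ?g = "\<lambda>z. deriv (deriv wp_reg) z - 12 * k z - 6 * (wp_reg z)\<^sup>2"
    show "?g analytic_on {0}" by (intro analytic_intros k wp_reg_analytic) auto
    have D: "deriv wp z = - 2 / z ^ 3 + deriv wp_reg z" if z: "z \<notin> \<Lambda>" for z
    proof -
      have "z \<noteq> 0" using z by auto
      have "eventually (\<lambda>x. x \<in> - \<Lambda>) (nhds z)"
        using z by (intro eventually_nhds_in_open open_compl_lattice) auto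
      hence "eventually (\<lambda>x. wp x = 1 / x\<^sup>2 + wp_reg x) (nhds z)"
        by eventually_elim (auto simp: wp_eq)
      hence "deriv wp z = deriv (\<lambda>x. 1 / x\<^sup>2 + wp_reg x) z" by (intro deriv_cong_ev) auto
      also have "(wp_reg has_field_derivative deriv wp_reg z) (at z)"
        using z by (intro analytic_derivI wp_reg_analytic) auto
      hence "deriv (\<lambda>x. 1 / x\<^sup>2 + wp_reg x) z = - 2 / z ^ 3 + deriv wp_reg z"
        using \<open>z \<noteq> 0\<close>
        by (intro DERIV_imp_deriv)
           (auto intro!: derivative_eq_intros simp: field_simps power2_eq_square power3_eq_cube)
      finally show ?thesis .
    qed
    have D2: "deriv (deriv wp) z = 6 / z ^ 4 + deriv (deriv wp_reg) z" if z: "z \<notin> \<Lambda>" for z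
    proof -
      have "z \<noteq> 0" using z by auto
      have "eventually (\<lambda>x. x \<in> - \<Lambda>) (nhds z)"
        using z by (intro eventually_nhds_in_open open_compl_lattice) auto
      hence "eventually (\<lambda>x. deriv wp x = - 2 / x ^ 3 + deriv wp_reg x) (nhds z)"
        by eventually_elim (auto simp: D)
      hence "deriv (deriv wp) z = deriv (\<lambda>x. - 2 / x ^ 3 + deriv wp_reg x) z" by (intro deriv_cong_ev) auto
      also have "(deriv wp_reg has_field_derivative deriv (deriv wp_reg) z) (at z)"
        using z by (intro analytic_derivI analytic_deriv wp_reg_analytic) auto
      hence "deriv (\<lambda>x. - 2 / x ^ 3 + deriv wp_reg x) z = 6 / z ^ 4 + deriv (deriv wp_reg) z"
        using \<open>z \<noteq> 0\<close>
        by (intro DERIV_imp_deriv)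
           (auto intro!: derivative_eq_intros simp: field_simps power2_eq_square power3_eq_cube power4_eq_xxxx)
      finally show ?thesis .
    qed
    show "eventually (\<lambda>z. ?f z = ?g z) (at 0)"
      using eventually_not_lattice
    proof eventually_elim
      case (elim z)
      hence "z \<noteq> 0" by auto
      have "(wp z)\<^sup>2 = 1 / z ^ 4 + 2 * k z + (wp_reg z)\<^sup>2"
        using elim \<open>z \<noteq> 0\<close> by (simp add: wp_eq k(2) power2_eq_square power4_eq_xxxx field_simps)
      thus ?case using D2[OF elim] by simp
    qed
  qed
  hence "\<exists>c. \<forall>z. z \<notin> lattice_hull {0} \<longrightarrow> ?f z = c"
    by (intro elliptic_constant)
       (auto intro!: holomorphic_intros wp_holomorphic deriv2_wp_holomorphic simp: wp_periodic deriv2_wp_periodic)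
  then obtain c where "\<And>z. z \<notin> \<Lambda> \<Longrightarrow> ?f z = c" by auto
  hence "deriv (deriv wp) z = 6 * (wp z)\<^sup>2 - (- c)" if "z \<notin> \<Lambda>" for z
    using that by (auto simp: algebra_simps)
  thus ?thesis by blast
qed

text \<open>In the usual notation, \<open>wp_a = g\<^sub>2 / 2\<close> and \<open>wp_b = g\<^sub>3\<close>.\<close>

definition wp_a :: complex where
  "wp_a = (SOME a. \<forall>z. z \<notin> \<Lambda> \<longrightarrow> deriv (deriv wp) z = 6 * (wp z)\<^sup>2 - a)"

lemma deriv2_wp: "z \<notin> \<Lambda> \<Longrightarrow> deriv (deriv wp) z = 6 * (wp z)\<^sup>2 - wp_a"
  using someI_ex[OF wp_second_order] unfolding wp_a_def by blast

text \<open>The derivative of the difference of both sides is 2 wp' (6 wp^2 - a - wp''), which is 0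
  by the second-order equation.\<close>

lemma wp_first_order: "\<exists>b. \<forall>z. z \<notin> \<Lambda> \<longrightarrow> (deriv wp z)\<^sup>2 = 4 * wp z ^ 3 - 2 * wp_a * wp z - b"
proof -
  let ?f = "\<lambda>z. 4 * wp z ^ 3 - 2 * wp_a * wp z - (deriv wp z)\<^sup>2"
  have "?f constant_on - \<Lambda>"
  proof (rule has_field_derivative_0_imp_constant_on)
    fix z assume "z \<in> - \<Lambda>"
    hence z: "z \<notin> \<Lambda>" by simp
    show "(?f has_field_derivative 0) (at z)"
      by (rule derivative_eq_intros wp_has_field_derivative[OF z] deriv_wp_has_field_derivative[OF z] refl)+
         (simp add: deriv2_wp[OF z] algebra_simps power2_eq_square)
  qed (auto intro: connected_compl_sparse lattice_sparse open_compl_lattice)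
  then obtain b where "\<And>z. z \<notin> \<Lambda> \<Longrightarrow> ?f z = b" unfolding constant_on_def by auto
  hence "(deriv wp z)\<^sup>2 = 4 * wp z ^ 3 - 2 * wp_a * wp z - b" if "z \<notin> \<Lambda>" for z
    using that by (metis add_diff_cancel_left' diff_add_cancel)
  thus ?thesis by blast
qed

definition wp_b :: complex where
  "wp_b = (SOME b. \<forall>z. z \<notin> \<Lambda> \<longrightarrow> (deriv wp z)\<^sup>2 = 4 * wp z ^ 3 - 2 * wp_a * wp z - b)"

lemma deriv_wp_squared: "z \<notin> \<Lambda> \<Longrightarrow> (deriv wp z)\<^sup>2 = 4 * wp z ^ 3 - 2 * wp_a * wp z - wp_b"
  using someI_ex[OF wp_first_order] unfolding wp_b_def by blast

end

section \<open>Addition theorems\<close>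

context complex_lattice begin

lemma not_half_period:
  assumes "2 * p \<notin> \<Lambda>"
  shows "p \<notin> \<Lambda>" "- p \<notin> \<Lambda>" "- p \<notin> lattice_hull {0, p}"
proof -
  show p: "p \<notin> \<Lambda>" using assms lattice_add[of p p] by (metis mult_2)
  thus "- p \<notin> \<Lambda>" by simp
  have "- p - p = - (2 * p)" by simp
  hence "- p - p \<notin> \<Lambda>" using assms by (metis lattice_minus_iff)
  thus "- p \<notin> lattice_hull {0, p}"
    using p by (auto simp: in_lattice_hull)
qed

lemma deriv_wp_odd:
  assumes "z \<notin> \<Lambda>"
  shows "deriv wp (- z) = - deriv wp z"
proof -
  have "(wp has_field_derivative deriv wp (- z)) (at (- z))"
    using assms by (intro wp_has_field_derivative) auto
  hence "((\<lambda>z. wp (- z)) has_field_derivative deriv wp (- z) * (- 1)) (at z)"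
    by (rule DERIV_chain2[of wp _ uminus]) (auto intro!: derivative_eq_intros)
  hence "(wp has_field_derivative - deriv wp (- z)) (at z)" by (simp add: wp_even)
  thus ?thesis using DERIV_unique[OF _ wp_has_field_derivative[OF assms]] by force
qed

lemma wp_shift_analytic: "z + c \<notin> \<Lambda> \<Longrightarrow> (\<lambda>x. wp (x + c)) analytic_on {z}"
  by (intro analytic_on_compose_gen[of "\<lambda>x. x + c" _ wp "{z + c}", unfolded o_def] analytic_intros wp_analytic) auto

lemma wp_reg_shift_analytic: "z - c \<notin> \<Lambda> - {0} \<Longrightarrow> (\<lambda>x. wp_reg (x - c)) analytic_on {z}"
  by (intro analytic_on_compose_gen[of "\<lambda>x. x - c" _ wp_reg "{z - c}", unfolded o_def] analytic_intros wp_reg_analytic) auto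

text \<open>
  If \<open>wp' p = 0\<close>, then \<open>wp (z - p) * (wp z - wp p) - wp p * wp z\<close> has no poles, hence is constant;
  the value at \<open>- p\<close> shows that \<open>wp (z - p)\<close> would be constant.
\<close>

lemma deriv_wp_nonzero:
  assumes p: "2 * p \<notin> \<Lambda>"
  shows "deriv wp p \<noteq> 0"
proof
  assume Y': "deriv wp p = 0"
  note pf = not_half_period[OF p]
  define Y where "Y = wp p"
  define f where "f = (\<lambda>z. wp (z - p) * (wp z - Y) - Y * wp z)"
  have sub: "\<Lambda> \<subseteq> lattice_hull {0, p}" by (auto simp: in_lattice_hull)
  have mem: "z - p \<notin> \<Lambda>" if "z \<notin> lattice_hull {0, p}" for z
    using that by (auto simp: in_lattice_hull)
  obtain k where k: "k analytic_on {0}" "\<And>z. wp_reg z = z\<^sup>2 * k z" using wp_near_0 by blast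
  have "\<exists>c. \<forall>z. z \<notin> lattice_hull {0, p} \<longrightarrow> f z = c"
  proof (rule elliptic_constant)
    have "(\<lambda>z. wp (z - p)) holomorphic_on - lattice_hull {0, p}"
      by (rule holomorphic_on_compose_gen[OF _ wp_holomorphic, of "\<lambda>z. z - p", unfolded o_def])
         (use mem in \<open>auto intro!: holomorphic_intros\<close>)
    thus "f holomorphic_on - lattice_hull {0, p}"
      unfolding f_def using sub by (intro holomorphic_intros holomorphic_on_subset[OF wp_holomorphic]) auto
  next
    fix z w assume z: "z \<notin> lattice_hull {0, p}" and w: "w \<in> \<Lambda>"
    have "wp (z - p + w) = wp (z - p)" "wp (z + w) = wp z"
      using z sub mem[OF z] w by (auto intro!: wp_periodic)
    thus "f (z + w) = f z" by (simp add: f_def algebra_simps)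
  next
    fix s assume "s \<in> {0, p}"
    hence "s = 0 \<or> s = p" by auto
    thus "\<exists>g. g analytic_on {s} \<and> eventually (\<lambda>z. f z = g z) (at s)"
    proof
      assume s: "s = 0"
      have an: "(\<lambda>z. wp (z - p)) analytic_on {0}"
        using wp_shift_analytic[of 0 "-p"] pf by simp
      have "((\<lambda>z. wp (z - p)) has_field_derivative deriv wp (0 - p)) (at 0)"
        using wp_has_field_derivative[of "0 - p"] pf DERIV_shift[of wp "deriv wp (- p)" 0 "- p"] by simp
      hence "deriv (\<lambda>z. wp (z - p)) 0 = 0"
        using DERIV_imp_deriv Y' deriv_wp_odd[of p] pf by fastforce
      from analytic_factor2[OF an this] obtain v
        where v: "v analytic_on {0}" "\<And>z. wp (z - p) = wp (0 - p) + (z - 0)\<^sup>2 * v z" by auto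
      have v2: "wp (z - p) = Y + z\<^sup>2 * v z" for z using v(2)[of z] wp_even by (simp add: Y_def)
      \<comment> \<open>Inserting wp(z - p) = Y + z^2 v, the summand -Y wp removes the pole coming
        from Y, and z^2 removes the pole multiplied by v.\<close>
      let ?g = "\<lambda>z. - Y\<^sup>2 + v z * (1 + z\<^sup>2 * (z\<^sup>2 * k z - Y))"
      have "?g analytic_on {0}" by (intro analytic_intros v k)
      moreover have "eventually (\<lambda>z. f z = ?g z) (at 0)"
        using eventually_not_lattice
      proof eventually_elim
        case (elim z)
        hence "z \<noteq> 0" by auto
        have X: "wp z = 1 / z\<^sup>2 + z\<^sup>2 * k z" using elim k(2) by (simp add: wp_eq)
        show ?case
          unfolding f_def v2 X using \<open>z \<noteq> 0\<close> by (simp add: field_simps power2_eq_square)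
      qed
      ultimately show ?thesis unfolding s by blast
    next
      assume s: "s = p"
      obtain l where l: "l analytic_on {p}" "\<And>z. wp z = wp p + (z - p)\<^sup>2 * l z"
        using analytic_factor2[OF wp_analytic Y'] pf by blast
      let ?g = "\<lambda>z. l z + wp_reg (z - p) * (wp z - Y) - Y * wp z"
      have "?g analytic_on {p}"
        using pf by (intro analytic_intros l wp_analytic wp_reg_shift_analytic) auto
      moreover have "eventually (\<lambda>z. z - p \<notin> \<Lambda>) (at p)"
        using eventually_not_lattice[of 0] unfolding at_to_0[of p] eventually_filtermap by simp
      hence "eventually (\<lambda>z. f z = ?g z) (at p)"
      proof eventually_elim
        case (elim z)
        hence "z - p \<noteq> 0" by auto
        have X: "wp z - Y = (z - p)\<^sup>2 * l z" using l(2)[of z] by (simp add: Y_def)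
        have "wp (z - p) = 1 / (z - p)\<^sup>2 + wp_reg (z - p)" using elim by (simp add: wp_eq)
        hence "f z = (1 / (z - p)\<^sup>2 + wp_reg (z - p)) * (wp z - Y) - Y * wp z" by (simp add: f_def)
        also have "\<dots> = ?g z" using \<open>z - p \<noteq> 0\<close> X by (simp add: ring_distribs)
        finally show ?case .
      qed
      ultimately show ?thesis unfolding s by blast
    qed
  qed auto
  then obtain c where c: "\<And>z. z \<notin> lattice_hull {0, p} \<Longrightarrow> f z = c" by blast
  \<comment> \<open>The first product vanishes because wp(-p) = Y, and -p is not among the excluded
    points, so the constant can be read off here.\<close>
  have "f (- p) = - Y\<^sup>2" by (simp add: f_def wp_even Y_def power2_eq_square)
  hence "c = - Y\<^sup>2" using c pf by auto
  have ev: "eventually (\<lambda>z. z \<notin> lattice_hull {0, p}) (at p)"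
    using lattice_hull_sparse[of "{0, p}"] sparse_in_eventually_iff[OF open_UNIV] by blast
  have "eventually (\<lambda>z. wp z \<noteq> Y) (at p)" 
    by (rule eventually_cosparse_imp_eventually_at[OF wp_avoid]) auto
  with ev have "eventually (\<lambda>z. wp (z - p) = Y) (at p)"
  proof eventually_elim
    case (elim z)
    have "f z = - Y\<^sup>2" using c[OF elim(1)] \<open>c = - Y\<^sup>2\<close> by simp
    \<comment> \<open>f + Y^2 factors in exactly this way.\<close>
    hence "(wp (z - p) - Y) * (wp z - Y) = 0" by (simp add: f_def algebra_simps power2_eq_square)
    thus ?case using elim by auto
  qed
  hence "eventually (\<lambda>z. wp z = Y) (at 0)"
    unfolding at_to_0[of p] eventually_filtermap by simp
  moreover have "eventually (\<lambda>z. wp z \<noteq> Y) (at 0)"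
    by (rule eventually_cosparse_imp_eventually_at[OF wp_avoid]) auto
  ultimately have "eventually (\<lambda>z. False) (at (0::complex))" by eventually_elim simp
  thus False by simp
qed

text \<open>The factor (wp z - wp p)^2 cancels the double poles at p and -p. A quadratic polynomial
  in wp z removes the poles left at 0, so the difference is constant, and its value is found at z =
  p.\<close>

lemma wp_addition_polynomial:
  assumes p: "2 * p \<notin> \<Lambda>" and z: "z \<notin> \<Lambda>" "z + p \<notin> \<Lambda>" "z - p \<notin> \<Lambda>"
  shows "(wp (z + p) + wp (z - p)) * (wp z - wp p)\<^sup>2 =
    2 * wp z * wp p * (wp z + wp p) - wp_a * (wp z + wp p) - wp_b"
proof -
  note pf = not_half_period[OF p]
  define Y where "Y = wp p"
  define s where "s = (\<lambda>z. wp (z + p) + wp (z - p))"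
  \<comment> \<open>This is the coefficient of 1/z^2 at 0: with s = 2 Y + z^2 v it equals v(0) - 4
    Y^2, where v(0) = wp''(p) = 6 Y^2 - a.\<close>
  define b where "b = 2 * Y\<^sup>2 - wp_a"
  define f where "f = (\<lambda>z. s z * (wp z - Y)\<^sup>2 - 2 * Y * (wp z)\<^sup>2 - b * wp z)"
  define H where "H = lattice_hull {0, p, - p}"
  have H: "z \<notin> H \<longleftrightarrow> z \<notin> \<Lambda> \<and> z + p \<notin> \<Lambda> \<and> z - p \<notin> \<Lambda>" for z
    unfolding H_def in_lattice_hull by auto
  obtain k where k: "k analytic_on {0}" "\<And>z. wp_reg z = z\<^sup>2 * k z" using wp_near_0 by blast
  have s_even: "s (- z) = s z" for z
  proof -
    have "- z + p = - (z - p)" "- z - p = - (z + p)" by simp_all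
    thus ?thesis unfolding s_def by (simp only: wp_even add.commute)
  qed
  have f_even: "f (- z) = f z" for z by (simp add: f_def s_even wp_even)
  \<comment> \<open>The double pole of wp(z - p) meets the square of a zero whose slope is wp'(p),
    hence the limit wp'(p)^2. The other shifted term is finite at p because 2p is no period, and it
    is multiplied by 0.\<close>
  have loc_p: "\<exists>g. g analytic_on {p} \<and> eventually (\<lambda>z. f z = g z) (at p) \<and>
                  g p = (deriv wp p)\<^sup>2 - 2 * Y ^ 3 - b * Y"
  proof -
    obtain l where l: "l analytic_on {p}" "\<And>z. wp z = wp p + (z - p) * l z" "l p = deriv wp p"
      using analytic_factor[OF wp_analytic] pf by blast
    let ?g = "\<lambda>z. wp (z + p) * (wp z - Y)\<^sup>2 + (l z)\<^sup>2 + wp_reg (z - p) * (wp z - Y)\<^sup>2 - 2 * Y * (wp z)\<^sup>2 - b * wp z"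
    have "?g analytic_on {p}"
      using pf p by (intro analytic_intros l wp_analytic wp_reg_shift_analytic wp_shift_analytic) auto
    moreover have "eventually (\<lambda>z. z - p \<notin> \<Lambda>) (at p)"
      using eventually_not_lattice[of 0] unfolding at_to_0[of p] eventually_filtermap by simp
    hence "eventually (\<lambda>z. f z = ?g z) (at p)"
    proof eventually_elim
      case (elim z)
      hence "z - p \<noteq> 0" by auto
      have X: "wp z - Y = (z - p) * l z" using l(2)[of z] by (simp add: Y_def)
      have "1 / (z - p)\<^sup>2 * (wp z - Y)\<^sup>2 = (l z)\<^sup>2"
        unfolding X using \<open>z - p \<noteq> 0\<close> by (simp add: power_mult_distrib)
      moreover have "wp (z - p) = 1 / (z - p)\<^sup>2 + wp_reg (z - p)" using elim by (simp add: wp_eq)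
      ultimately have "s z * (wp z - Y)\<^sup>2 = wp (z + p) * (wp z - Y)\<^sup>2 + (l z)\<^sup>2 + wp_reg (z - p) * (wp z - Y)\<^sup>2"
        unfolding s_def by (simp only: ring_distribs add.assoc)
      thus ?case by (simp add: f_def)
    qed
    ultimately show ?thesis
      by (intro exI[of _ ?g]) (simp add: l(3) Y_def power2_eq_square power3_eq_cube)
  qed
  then obtain gp where gp: "gp analytic_on {p}" "eventually (\<lambda>z. f z = gp z) (at p)"
    "gp p = (deriv wp p)\<^sup>2 - 2 * Y ^ 3 - b * Y" by blast
  have "\<exists>c. \<forall>z. z \<notin> H \<longrightarrow> f z = c"
    unfolding H_def
  proof (rule elliptic_constant; (unfold H_def[symmetric])?)
    have "(\<lambda>z. wp (z - p)) holomorphic_on - H"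
      by (rule holomorphic_on_compose_gen[OF _ wp_holomorphic, of "\<lambda>z. z - p", unfolded o_def])
         (use H in \<open>auto intro!: holomorphic_intros\<close>)
    moreover have "(\<lambda>z. wp (z + p)) holomorphic_on - H"
      by (rule holomorphic_on_compose_gen[OF _ wp_holomorphic, of "\<lambda>z. z + p", unfolded o_def])
         (use H in \<open>auto intro!: holomorphic_intros\<close>)
    moreover have "wp holomorphic_on - H"
      using H by (intro holomorphic_on_subset[OF wp_holomorphic]) auto
    ultimately show "f holomorphic_on - H"
      unfolding f_def s_def by (intro holomorphic_intros)
  next
    fix z w assume z: "z \<notin> H" and w: "w \<in> \<Lambda>"
    have "wp (z - p + w) = wp (z - p)" "wp (z + p + w) = wp (z + p)" "wp (z + w) = wp z"
      using z H w by (auto intro!: wp_periodic)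
    thus "f (z + w) = f z" by (simp add: f_def s_def algebra_simps)
  next
    fix x assume "x \<in> {0, p, - p}"
    then consider "x = 0" | "x = p" | "x = - p" by auto
    thus "\<exists>g. g analytic_on {x} \<and> eventually (\<lambda>z. f z = g z) (at x)"
    proof cases
      case 2
      thus ?thesis using gp by blast
    next
      case 3
      \<comment> \<open>f is even, so the extension at p is reflected to -p.\<close>
      have "(\<lambda>z. gp (- z)) analytic_on {- p}"
        using gp(1) by (intro analytic_on_compose_gen[of uminus _ gp "{p}", unfolded o_def] analytic_intros) auto
      moreover have "eventually (\<lambda>z. f z = gp (- z)) (at (- p))"
      proof -
        obtain d where d: "d > 0" "\<And>x. x \<noteq> p \<Longrightarrow> dist x p < d \<Longrightarrow> f x = gp x"
          using gp(2) unfolding eventually_at by auto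
        have "f x = gp (- x)" if "x \<noteq> - p" "dist x (- p) < d" for x
          using d(2)[of "- x"] that minus_equation_iff[of x p] f_even[of x] dist_minus[of x "- p"] by auto
        thus ?thesis unfolding eventually_at using d(1) by auto
      qed
      ultimately show ?thesis using 3 by blast
    next
      case 1
      have an: "s analytic_on {0}"
        unfolding s_def using wp_shift_analytic[of 0 "-p"] wp_shift_analytic[of 0 p] pf
        by (auto intro!: analytic_intros)
      have "deriv s 0 = 0"
        by (rule even_imp_deriv_0[OF an]) (simp add: s_even)
      then obtain v where v: "v analytic_on {0}" "\<And>z. s z = s 0 + (z - 0)\<^sup>2 * v z" "deriv (deriv s) 0 = 2 * v 0"
        using analytic_factor2[OF an] by blast
      have op: "open {z. z + p \<notin> \<Lambda> \<and> z - p \<notin> \<Lambda>}"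
      proof -
        have "{z. z + p \<notin> \<Lambda> \<and> z - p \<notin> \<Lambda>} = (\<lambda>z. z + p) -` (- \<Lambda>) \<inter> (\<lambda>z. z - p) -` (- \<Lambda>)" by auto
        thus ?thesis
          using open_compl_lattice(1) by (auto intro!: continuous_open_vimage continuous_intros)
      qed
      have D1: "(s has_field_derivative deriv wp (z + p) + deriv wp (z - p)) (at z)"
        and D2: "((\<lambda>z. deriv wp (z + p) + deriv wp (z - p)) has_field_derivative
          deriv (deriv wp) (z + p) + deriv (deriv wp) (z - p)) (at z)"
        if "z + p \<notin> \<Lambda> \<and> z - p \<notin> \<Lambda>" for z
        unfolding s_def using that DERIV_shift[of _ _ z p] DERIV_shift[of _ _ z "- p"]
        by (auto intro!: derivative_intros wp_has_field_derivative deriv_wp_has_field_derivative)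
      have "eventually (\<lambda>z. z \<in> {z. z + p \<notin> \<Lambda> \<and> z - p \<notin> \<Lambda>}) (nhds 0)"
        using pf by (intro eventually_nhds_in_open op) auto
      hence "eventually (\<lambda>z. deriv s z = deriv wp (z + p) + deriv wp (z - p)) (nhds 0)"
        by eventually_elim (rule DERIV_imp_deriv[OF D1], auto)
      hence "deriv (deriv s) 0 = deriv (\<lambda>z. deriv wp (z + p) + deriv wp (z - p)) 0"
        by (intro deriv_cong_ev) auto
      also have "\<dots> = deriv (deriv wp) p + deriv (deriv wp) (- p)"
        using D2[of 0] pf by (intro DERIV_imp_deriv) auto
      also have "\<dots> = 2 * (6 * Y\<^sup>2 - wp_a)" using pf by (simp add: deriv2_wp wp_even Y_def)
      finally have v0: "v 0 = 6 * Y\<^sup>2 - wp_a"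
        using v(3) by (metis mult_left_cancel zero_neq_numeral)
      \<comment> \<open>Evenness allows a second splitting v = v(0) + z^2 u, so that v / z^2 has the
        explicit singular part v(0) / z^2.\<close>
      have "eventually (\<lambda>z. v (- z) = v z) (nhds 0)"
      proof (rule always_eventually, rule allI)
        fix z show "v (- z) = v z"
          using s_even[of z] v(2)[of z] v(2)[of "- z"] by (cases "z = 0") auto
      qed
      from even_imp_deriv_0[OF v(1) this] have "deriv v 0 = 0" .
      then obtain u where u: "u analytic_on {0}" "\<And>z. v z = v 0 + (z - 0)\<^sup>2 * u z"
        using analytic_factor2[OF v(1)] by blast
      have s0: "s 0 = 2 * Y" by (simp add: s_def wp_even Y_def)
      let ?m = "\<lambda>z. z\<^sup>2 * k z - Y"
      \<comment> \<open>This is what remains of f when wp = U + (M + Y) with U = 1/z^2 is inserted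
        and the multiples of U cancel.\<close>
      let ?g = "\<lambda>z. 2 * Y ^ 3 + u z + v z * (2 * ?m z + z\<^sup>2 * (?m z)\<^sup>2) - v 0 * (z\<^sup>2 * k z)"
      have "?g analytic_on {0}" by (intro analytic_intros u v k)
      moreover have "eventually (\<lambda>z. f z = ?g z) (at 0)"
        using eventually_not_lattice
      proof eventually_elim
        case (elim z)
        hence "z \<noteq> 0" by auto
        define U where "U = 1 / z\<^sup>2"
        define M where "M = ?m z"
        have ZU: "z\<^sup>2 * U = 1" using \<open>z \<noteq> 0\<close> by (simp add: U_def)
        have X: "wp z = U + (M + Y)" using elim k(2) by (simp add: wp_eq U_def M_def)
        have sz: "s z = 2 * Y + z\<^sup>2 * v z" using v(2)[of z] s0 by simp
        have "s z * (wp z - Y)\<^sup>2 = 2 * Y * (wp z - Y)\<^sup>2 + v z * (z\<^sup>2 * (U + M)\<^sup>2)"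
          unfolding sz by (simp add: X algebra_simps)
        also have "z\<^sup>2 * (U + M)\<^sup>2 = (z\<^sup>2 * U) * U + 2 * (z\<^sup>2 * U) * M + z\<^sup>2 * M\<^sup>2"
          by (simp add: algebra_simps power2_eq_square)
        also have "\<dots> = U + 2 * M + z\<^sup>2 * M\<^sup>2" by (simp add: ZU)
        also have "v z * \<dots> = v z * U + v z * (2 * M + z\<^sup>2 * M\<^sup>2)" by (simp add: algebra_simps)
        also have "v z * U = v 0 * U + u z * (z\<^sup>2 * U)" using u(2)[of z] by (simp add: algebra_simps)
        finally have "s z * (wp z - Y)\<^sup>2 = 2 * Y * (wp z - Y)\<^sup>2 + v 0 * U + u z + v z * (2 * M + z\<^sup>2 * M\<^sup>2)"
          by (simp add: ZU)
        note sX = this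
        have bv: "b = v 0 - 4 * Y\<^sup>2" by (simp add: b_def v0)
        have kM: "z\<^sup>2 * k z = M + Y" by (simp add: M_def)
        show ?case
          unfolding f_def M_def[symmetric] sX kM bv unfolding X
          by (simp add: algebra_simps power2_eq_square power3_eq_cube)
      qed
      ultimately show ?thesis unfolding 1 by blast
    qed
  qed auto
  then obtain c where c: "\<And>z. z \<notin> H \<Longrightarrow> f z = c" by blast
  have "H sparse_in UNIV" unfolding H_def by (rule lattice_hull_sparse) auto
  hence "eventually (\<lambda>z. z \<notin> H) (at p)"
    using sparse_in_eventually_iff[OF open_UNIV] by blast
  hence "eventually (\<lambda>z. gp z = c) (at p)"
    using gp(2) by eventually_elim (use c in auto)
  hence "c = (deriv wp p)\<^sup>2 - 2 * Y ^ 3 - b * Y"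
    using gp(1,3) analytic_eq_const_at by metis
  also have "\<dots> = 2 * Y ^ 3 - 2 * wp_a * Y - wp_b - b * Y"
    using deriv_wp_squared[of p] pf by (simp add: Y_def)
  finally have "f z = 2 * Y ^ 3 - 2 * wp_a * Y - wp_b - b * Y" using c[of z] H[of z] z by simp
  thus ?thesis
    unfolding f_def b_def s_def Y_def[symmetric] by (simp add: algebra_simps power2_eq_square power3_eq_cube)
qed

section \<open>Points at which the addition formulas apply in both variables\<close>

lemma half_lattice_sparse: "{z. 2 * z \<in> \<Lambda>} sparse_in UNIV"
proof -
  obtain c where c: "c > 0" "\<And>w. w \<in> \<Lambda> - {0} \<Longrightarrow> c \<le> norm w"
    using lattice_norm_bound by blast
  have closed: "closed X" if X: "X \<subseteq> {z. 2 * z \<in> \<Lambda>}" for X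
  proof (rule discrete_imp_closed[of "c / 2"], use c in simp, intro ballI impI)
    fix x y assume xy: "x \<in> X" "y \<in> X" "dist y x < c / 2"
    have "2 * y - 2 * x \<in> \<Lambda>" using xy X by (intro lattice_diff) auto
    moreover have "norm (2 * y - 2 * x) < c"
    proof -
      have "norm (2 * y - 2 * x) = 2 * norm (y - x)"
        by (metis norm_mult norm_numeral right_diff_distrib)
      thus ?thesis using xy by (simp add: dist_norm)
    qed
    ultimately show "y = x" using c(2)[of "2 * y - 2 * x"] by force
  qed
  have "\<not> y islimpt {z. 2 * z \<in> \<Lambda>}" for y
  proof
    assume "y islimpt {z. 2 * z \<in> \<Lambda>}"
    hence "y islimpt ({z. 2 * z \<in> \<Lambda>} - {y})"
      using islimpt_punctured by blast
    thus False using closed[of "{z. 2 * z \<in> \<Lambda>} - {y}"] closed_limpt by blast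
  qed
  thus ?thesis by (subst sparse_in_open) auto
qed

text \<open>
  Half periods are excluded so that \<open>z\<close> and \<open>p\<close> can exchange their roles in the addition formulas.
\<close>

definition regular_set :: "complex \<Rightarrow> complex set" where
  "regular_set p = {z. 2 * z \<notin> \<Lambda> \<and> wp z \<noteq> wp p}"

lemma regular_set_cosparse: "\<forall>\<^sub>\<approx>z. z \<in> regular_set p"
proof -
  have "\<forall>\<^sub>\<approx>z. 2 * z \<notin> \<Lambda>"
    using half_lattice_sparse by (simp add: eventually_cosparse)
  with wp_avoid show ?thesis
    by eventually_elim (simp add: regular_set_def)
qed

lemma regular_set_sparse: "(- regular_set p) sparse_in UNIV"
  using regular_set_cosparse[of p] by (simp add: eventually_cosparse Compl_eq)

lemma open_regular_set: "open (regular_set p)"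
  using sparse_in_UNIV_imp_closed[OF regular_set_sparse] by (simp add: closed_def)

lemma connected_regular_set: "connected (regular_set p)"
  using connected_compl_sparse[OF regular_set_sparse] by simp

lemma regular_set_minus: "- z \<in> regular_set p \<longleftrightarrow> z \<in> regular_set p"
  by (simp add: regular_set_def wp_even)

text \<open>If z + p or z - p were a period, then wp z would equal wp p by periodicity and
  evenness.\<close>

lemma regular_set_notin:
  assumes p: "2 * p \<notin> \<Lambda>" and z: "z \<in> regular_set p"
  shows "z \<notin> \<Lambda>" "z + p \<notin> \<Lambda>" "z - p \<notin> \<Lambda>" "wp z \<noteq> wp p"
proof -
  show "z \<notin> \<Lambda>" using z not_half_period(1) by (auto simp: regular_set_def)
  show "wp z \<noteq> wp p" using z by (simp add: regular_set_def)
  have pf: "p \<notin> \<Lambda>" "- p \<notin> \<Lambda>" using not_half_period[OF p] by auto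
  show "z + p \<notin> \<Lambda>"
    using wp_periodic[of "z + p" "- p"] pf wp_even[of p] \<open>wp z \<noteq> wp p\<close> by auto
  show "z - p \<notin> \<Lambda>"
    using wp_periodic[of "z - p" p] pf \<open>wp z \<noteq> wp p\<close> by auto
qed

text \<open>The constants a and b are eliminated in favour of wp'(z)^2 and wp'(p)^2, which gives a
  form symmetric in z and p.\<close>

lemma wp_addition:
  assumes p: "2 * p \<notin> \<Lambda>" and z: "z \<in> regular_set p"
  shows "wp (z + p) + wp (z - p) =
    - 2 * (wp z + wp p) + ((deriv wp z)\<^sup>2 + (deriv wp p)\<^sup>2) / (2 * (wp z - wp p)\<^sup>2)"
proof -
  note zf = regular_set_notin[OF p z]
  have pf: "p \<notin> \<Lambda>" using not_half_period[OF p] by auto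
  define X Y where "X = wp z" and "Y = wp p"
  have nz: "(X - Y)\<^sup>2 \<noteq> 0" using zf by (simp add: X_def Y_def)
  have "(wp (z + p) + wp (z - p)) * (X - Y)\<^sup>2 = 2 * X * Y * (X + Y) - wp_a * (X + Y) - wp_b"
    using wp_addition_polynomial[OF p zf(1-3)] by (simp add: X_def Y_def)
  also have "\<dots> = - 2 * (X + Y) * (X - Y)\<^sup>2 + ((4 * X ^ 3 - 2 * wp_a * X - wp_b) + (4 * Y ^ 3 - 2 * wp_a * Y - wp_b)) / 2"
    by (simp add: field_simps power2_eq_square power3_eq_cube)
  also have "\<dots> = (- 2 * (X + Y) + ((deriv wp z)\<^sup>2 + (deriv wp p)\<^sup>2) / (2 * (X - Y)\<^sup>2)) * (X - Y)\<^sup>2"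
    unfolding deriv_wp_squared[OF zf(1)] deriv_wp_squared[OF pf] X_def[symmetric] Y_def[symmetric]
    using nz by (simp add: distrib_right[of _ _ "(X - Y)\<^sup>2"])
  finally show ?thesis using nz unfolding X_def Y_def by simp
qed

text \<open>By \<open>wp_addition\<close> the difference of both sides has derivative 0. It is
  therefore constant on the connected symmetric set \<open>regular_set p\<close>, and being odd it
  is 0.\<close>

lemma zeta_addition:
  assumes p: "2 * p \<notin> \<Lambda>" and z: "z \<in> regular_set p"
  shows "\<zeta> (z + p) + \<zeta> (z - p) - 2 * \<zeta> z = deriv wp z / (wp z - wp p)"
proof -
  have pf: "p \<notin> \<Lambda>" using not_half_period[OF p] by auto
  let ?f = "\<lambda>z. \<zeta> (z + p) + \<zeta> (z - p) - 2 * \<zeta> z - deriv wp z / (wp z - wp p)"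
  have "?f constant_on regular_set p"
  proof (rule has_field_derivative_0_imp_constant_on)
    fix z assume z: "z \<in> regular_set p"
    note zf = regular_set_notin[OF p z]
    have D: "((\<lambda>z. \<zeta> (z + p)) has_field_derivative - wp (z + p)) (at z)"
      "((\<lambda>z. \<zeta> (z - p)) has_field_derivative - wp (z - p)) (at z)"
      using zeta_has_field_derivative[of "z + p"] zeta_has_field_derivative[of "z - p"] zf
        DERIV_shift[of \<zeta> _ z p] DERIV_shift[of \<zeta> _ z "- p"] by auto
    define X Y where "X = wp z" and "Y = wp p"
    have nz: "X - Y \<noteq> 0" using zf by (simp add: X_def Y_def)
    have "(?f has_field_derivative - wp (z + p) + - wp (z - p) - 2 * (- wp z) -
       (deriv (deriv wp) z * (wp z - wp p) - deriv wp z * (deriv wp z - 0)) / ((wp z - wp p) * (wp z - wp p))) (at z)"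
      by (rule derivative_intros D zeta_has_field_derivative wp_has_field_derivative deriv_wp_has_field_derivative
            DERIV_cmult zf | use zf in simp)+
    also have "- wp (z + p) + - wp (z - p) - 2 * (- wp z) -
       (deriv (deriv wp) z * (wp z - wp p) - deriv wp z * (deriv wp z - 0)) / ((wp z - wp p) * (wp z - wp p))
       = 2 * X - (wp (z + p) + wp (z - p)) - (6 * X\<^sup>2 - wp_a) / (X - Y) + (deriv wp z)\<^sup>2 / (X - Y)\<^sup>2"
      using nz unfolding deriv2_wp[OF zf(1)] X_def[symmetric] Y_def[symmetric]
      by (simp add: diff_divide_distrib power2_eq_square)
    also have "\<dots> = (4 * X + 2 * Y) - (6 * X\<^sup>2 - wp_a) / (X - Y) + ((deriv wp z)\<^sup>2 - (deriv wp p)\<^sup>2) / (2 * (X - Y)\<^sup>2)"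
      unfolding wp_addition[OF p z] X_def[symmetric] Y_def[symmetric]
      by (simp add: add_divide_distrib diff_divide_distrib)
    also have "(deriv wp z)\<^sup>2 - (deriv wp p)\<^sup>2 = (X - Y) * (4 * (X\<^sup>2 + X * Y + Y\<^sup>2) - 2 * wp_a)"
      unfolding deriv_wp_squared[OF zf(1)] deriv_wp_squared[OF pf] X_def[symmetric] Y_def[symmetric]
      by (simp add: algebra_simps power2_eq_square power3_eq_cube)
    also have "(X - Y) * (4 * (X\<^sup>2 + X * Y + Y\<^sup>2) - 2 * wp_a) / (2 * (X - Y)\<^sup>2)
       = (2 * (X\<^sup>2 + X * Y + Y\<^sup>2) - wp_a) / (X - Y)"
      by (subst frac_eq_eq) (use nz in \<open>simp, simp\<close>, simp add: algebra_simps power2_eq_square)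
    also have "(4 * X + 2 * Y) - (6 * X\<^sup>2 - wp_a) / (X - Y) + (2 * (X\<^sup>2 + X * Y + Y\<^sup>2) - wp_a) / (X - Y) = 0"
      using nz by (simp add: divide_simps) (simp add: algebra_simps power2_eq_square)
    finally show "(?f has_field_derivative 0) (at z)" .
  qed (rule connected_regular_set open_regular_set)+
  then obtain c where c: "\<And>z. z \<in> regular_set p \<Longrightarrow> ?f z = c"
    unfolding constant_on_def by auto
  have "?f (- z) = - ?f z"
  proof -
    have "- z + p = - (z - p)" "- z - p = - (z + p)" by simp_all
    hence "\<zeta> (- z + p) = - \<zeta> (z - p)" "\<zeta> (- z - p) = - \<zeta> (z + p)"
      by (simp_all only: zeta_odd)
    thus ?thesis
      using regular_set_notin[OF p z] by (simp add: zeta_odd wp_even deriv_wp_odd)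
  qed
  hence "c = - c" using c[OF z] c[of "- z"] z regular_set_minus by metis
  hence "c = 0" by simp
  thus ?thesis using c[OF z] by simp
qed

text \<open>The zeta-addition formula is needed twice: as stated it turns the coefficient of T into
  h, and with z and p exchanged it evaluates the antisymmetric combination. The term with
  \<open>\<zeta> p\<close> arising there cancels against the one in
  \<open>gle_accessory\<close>.\<close>

lemma gle_potential_eq:
  fixes n :: nat and T :: complex
  assumes p: "2 * p \<notin> \<Lambda>" and z: "z \<in> regular_set p"
  defines "h \<equiv> deriv wp z / (wp z - wp p)"
  shows "gle_potential n p \<tau> T z = of_nat (n * (n + 1)) * (wp z - wp p) + (T + h / 2)\<^sup>2
    - (deriv (deriv wp) z / (wp z - wp p) - h\<^sup>2) / 2"
proof -
  note zf = regular_set_notin[OF p z]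
  have pf: "p \<notin> \<Lambda>" using not_half_period[OF p] by auto
  have pz: "p \<in> regular_set z" and z2: "2 * z \<notin> \<Lambda>"
    using p z by (auto simp: regular_set_def)
  define X Y X1 Y1 where "X = wp z" and "Y = wp p" and "X1 = deriv wp z" and "Y1 = deriv wp p"
  have nz: "X - Y \<noteq> 0" using zf by (simp add: X_def Y_def)
  have Y1: "Y1 \<noteq> 0" using deriv_wp_nonzero[OF p] by (simp add: Y1_def)
  have "\<zeta> (p - z) = - \<zeta> (z - p)" using zeta_odd[of "z - p"] by simp
  \<comment> \<open>The exchange of z and p is legitimate since 2z is not a period.\<close>
  hence "\<zeta> (z + p) - \<zeta> (z - p) - 2 * \<zeta> p = Y1 / (Y - X)"
    using zeta_addition[OF z2 pz] by (simp add: X_def Y_def Y1_def add.commute)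
  also have "\<dots> = - Y1 / (X - Y)"
    by (metis minus_diff_eq minus_divide_divide minus_minus)
  finally have Z2: "\<zeta> (z + p) - \<zeta> (z - p) = 2 * \<zeta> p - Y1 / (X - Y)"
    by (simp add: algebra_simps)
  have Z1: "\<zeta> (z + p) + \<zeta> (z - p) - 2 * \<zeta> z = h"
    using zeta_addition[OF p z] by (simp add: h_def)
  have W: "wp (z + p) + wp (z - p) = - 2 * (X + Y) + (X1\<^sup>2 + Y1\<^sup>2) / (2 * (X - Y)\<^sup>2)"
    using wp_addition[OF p z] by (simp add: X_def Y_def X1_def Y1_def)
  have X2: "deriv (deriv wp) z = 6 * X\<^sup>2 - wp_a" and Y2: "deriv (deriv wp) p = 6 * Y\<^sup>2 - wp_a"
    using deriv2_wp zf pf by (auto simp: X_def Y_def)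
  have h2: "h\<^sup>2 = X1\<^sup>2 / (X - Y)\<^sup>2" by (simp add: h_def X_def Y_def X1_def power_divide)
  have sq: "X1\<^sup>2 - Y1\<^sup>2 = (X - Y) * (4 * (X\<^sup>2 + X * Y + Y\<^sup>2) - 2 * wp_a)"
    unfolding X1_def Y1_def deriv_wp_squared[OF zf(1)] deriv_wp_squared[OF pf] X_def[symmetric] Y_def[symmetric]
    by (simp add: algebra_simps power2_eq_square power3_eq_cube)
  define A where "A = (6 * Y\<^sup>2 - wp_a) / (4 * Y1)"
  have A1: "(deriv ^^ 2) wp p / (4 * Y1) = A" and A2: "(deriv ^^ 2) wp p / (2 * Y1) = 2 * A"
    unfolding A_def using Y1 by (simp_all add: numeral_2_eq_2 Y2 nonzero_divide_eq_eq)
  have AY: "A * (Y1 / (X - Y)) = (6 * Y\<^sup>2 - wp_a) / (4 * (X - Y))"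
    using Y1 by (simp add: A_def)
  \<comment> \<open>This is the part independent of T and n; the summand 3/2 Y is what is left of
    the accessory parameter after n(n+1) Y is split off.\<close>
  have key: "3 / 4 * (wp (z + p) + wp (z - p)) + (6 * Y\<^sup>2 - wp_a) / (4 * (X - Y)) + 3 / 2 * Y =
    h\<^sup>2 / 4 - ((6 * X\<^sup>2 - wp_a) / (X - Y) - h\<^sup>2) / 2"
  proof -
    \<comment> \<open>After substitution X1^2 and Y1^2 enter only through their difference, which is
      divisible by X - Y.\<close>
    have "3 / 4 * (wp (z + p) + wp (z - p)) + (6 * Y\<^sup>2 - wp_a) / (4 * (X - Y)) + 3 / 2 * Y
       - (h\<^sup>2 / 4 - ((6 * X\<^sup>2 - wp_a) / (X - Y) - h\<^sup>2) / 2)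
      = - 3 / 2 * X + (6 * Y\<^sup>2 - wp_a + 2 * (6 * X\<^sup>2 - wp_a)) / (4 * (X - Y)) - 3 / 8 * ((X1\<^sup>2 - Y1\<^sup>2) / (X - Y)\<^sup>2)"
      unfolding W h2 using nz by (simp add: divide_simps) (simp add: algebra_simps)
    also have "(X1\<^sup>2 - Y1\<^sup>2) / (X - Y)\<^sup>2 = (4 * (X\<^sup>2 + X * Y + Y\<^sup>2) - 2 * wp_a) / (X - Y)"
      unfolding sq using nz by (simp add: power2_eq_square)
    also have "- 3 / 2 * X + (6 * Y\<^sup>2 - wp_a + 2 * (6 * X\<^sup>2 - wp_a)) / (4 * (X - Y)) -
       3 / 8 * ((4 * (X\<^sup>2 + X * Y + Y\<^sup>2) - 2 * wp_a) / (X - Y)) = 0"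
      using nz by (simp add: divide_simps) (simp add: algebra_simps power2_eq_square)
    finally show ?thesis by simp
  qed
  have "gle_potential n p \<tau> T z = of_nat (n * (n + 1)) * X + 3 / 4 * (wp (z + p) + wp (z - p)) + T * h
      - A * (\<zeta> (z + p) - \<zeta> (z - p)) + (T\<^sup>2 + 2 * A * \<zeta> p - 1 / 2 * (2 * of_nat n ^ 2 + 2 * of_nat n - 3) * Y)"
    unfolding gle_potential_def gle_accessory_def Z1 X_def[symmetric] Y_def[symmetric] Y1_def[symmetric]
    by (simp add: A1 A2)
  also have "\<dots> = of_nat (n * (n + 1)) * X + T * h + T\<^sup>2 - of_nat (n * (n + 1)) * Y +
      (3 / 4 * (wp (z + p) + wp (z - p)) + A * (Y1 / (X - Y)) + 3 / 2 * Y)"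
    unfolding Z2 by (simp add: algebra_simps power2_eq_square)
  also have "\<dots> = of_nat (n * (n + 1)) * (X - Y) + T * h + T\<^sup>2 + h\<^sup>2 / 4 - ((6 * X\<^sup>2 - wp_a) / (X - Y) - h\<^sup>2) / 2"
    unfolding AY key by (simp add: algebra_simps)
  finally show ?thesis
    unfolding X_def[symmetric] Y_def[symmetric] X2 by (simp add: field_simps power2_eq_square)
qed

end

section \<open>Polynomial solutions of the symmetric square equation\<close>

text \<open>A sparse exceptional set is closed, so identities valid off such a set hold on
  neighbourhoods and may be differentiated.\<close>

lemma eventually_cosparse_nhds:
  fixes P :: "complex \<Rightarrow> bool"
  assumes "\<forall>\<^sub>\<approx>z. P z"
  shows "\<forall>\<^sub>\<approx>z. P z \<and> eventually P (nhds z)"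
proof -
  have "closed {z. \<not> P z}"
    using assms sparse_in_UNIV_imp_closed by (auto simp: eventually_cosparse)
  hence op: "open {z. P z}" by (simp add: closed_def Compl_eq)
  show ?thesis
    using assms
  proof eventually_elim
    case (elim z)
    thus ?case using eventually_nhds_in_open[OF op, of z] by simp
  qed
qed

lemma cosparse_imp_ex: "\<forall>\<^sub>\<approx>z::complex. P z \<Longrightarrow> \<exists>z. P z"
  using eventually_happens[of P "cosparse UNIV"] by auto

text \<open>The value at each point is the limit, or 0 at a pole. \<open>remove_sings\<close>
  follows the same convention and depends only on nearby values.\<close>

lemma nicely_meromorphic_eqI:
  assumes "f nicely_meromorphic_on UNIV" "g nicely_meromorphic_on UNIV" "\<forall>\<^sub>\<approx>z. f z = g z"
  shows "f = g"
proof
  fix z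
  have *: "remove_sings h z = h z" if "h nicely_meromorphic_on UNIV" for h
  proof -
    have "(is_pole h z \<and> h z = 0) \<or> h \<midarrow>z\<rightarrow> h z"
      using that unfolding nicely_meromorphic_on_def by blast
    thus ?thesis by auto
  qed
  have "remove_sings f z = remove_sings g z"
    by (rule remove_sings_cong[OF eventually_cosparse_imp_eventually_at[OF assms(3)]]) auto
  thus "f z = g z" using * assms by simp
qed

lemma meromorphic_deriv_0_imp_constant:
  assumes f: "f meromorphic_on UNIV" and d: "\<forall>\<^sub>\<approx>z. deriv f z = 0"
  shows "\<exists>c. \<forall>\<^sub>\<approx>z. f z = c"
proof -
  have ev: "\<forall>\<^sub>\<approx>z. f analytic_on {z} \<and> deriv f z = 0"
    using meromorphic_on_imp_analytic_cosparse[OF f] d by eventually_elim auto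
  define D where "D = {z. f analytic_on {z} \<and> deriv f z = 0}"
  have sparse: "(- D) sparse_in UNIV"
    using ev unfolding eventually_cosparse D_def Collect_neg_eq .
  have "open D" "connected D"
    using sparse_in_UNIV_imp_closed[OF sparse] connected_compl_sparse[OF sparse] by (auto simp: closed_def)
  moreover have "(f has_field_derivative 0) (at z)" if "z \<in> D" for z
    using that analytic_derivI[of f z] by (simp add: D_def)
  ultimately have "f constant_on D" by (intro has_field_derivative_0_imp_constant_on)
  then obtain c where "\<And>z. z \<in> D \<Longrightarrow> f z = c" unfolding constant_on_def by auto
  thus ?thesis using ev by (intro exI[of _ c]) (auto simp: D_def elim: eventually_mono)
qed

lemma higher_deriv_linear_combination:
  fixes f :: "'i \<Rightarrow> complex \<Rightarrow> complex"
  assumes "\<And>i. i \<in> I \<Longrightarrow> f i analytic_on {z}"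
  shows "(deriv ^^ m) (\<lambda>w. \<Sum>i\<in>I. f i w * c i) z = (\<Sum>i\<in>I. (deriv ^^ m) (f i) z * c i)"
  using assms
proof (induction I rule: infinite_finite_induct)
  case (insert x I)
  have "(\<lambda>w. \<Sum>i\<in>I. f i w * c i) analytic_on {z}" "(\<lambda>w. f x w * c x) analytic_on {z}"
    using insert.prems by (auto intro!: analytic_intros)
  moreover have "(deriv ^^ m) (\<lambda>w. f x w * c x) z = (deriv ^^ m) (f x) z * c x"
    using higher_deriv_cmult'[of "f x" z m "c x"] insert.prems by (simp add: mult.commute)
  ultimately show ?case
    using insert by (simp add: higher_deriv_add_at)
qed simp_all

lemma poly_eq_sum:
  fixes p :: "'a::comm_semiring_1 poly"
  assumes "\<And>i. i \<ge> d \<Longrightarrow> coeff p i = 0"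
  shows "poly p t = (\<Sum>i<d. coeff p i * t ^ i)"
proof -
  have "p = (\<Sum>i<d. monom (coeff p i) i)"
  proof (rule poly_eqI)
    fix j
    show "coeff p j = coeff (\<Sum>i<d. monom (coeff p i) i) j"
      using assms[of j] by (auto simp: coeff_sum)
  qed
  thus ?thesis by (metis (no_types, lifting) poly_monom poly_sum sum.cong)
qed

lemma coeff_mult_degree_le:
  assumes "degree p \<le> a" "degree q \<le> b"
  shows "coeff (p * q) (a + b) = coeff p a * coeff q b"
proof (cases "degree p = a \<and> degree q = b")
  case True
  thus ?thesis using coeff_mult_degree_sum[of p q] by auto
next
  case False
  hence "degree (p * q) < a + b" "degree p < a \<or> degree q < b"
    using assms degree_mult_le[of p q] by auto
  thus ?thesis by (auto simp: coeff_eq_0)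
qed

text \<open>The symmetric square of y'' = Q y: it annihilates products of two solutions.\<close>

definition sym_square_op :: "(complex \<Rightarrow> complex) \<Rightarrow> (complex \<Rightarrow> complex) \<Rightarrow> complex \<Rightarrow> complex" where
  "sym_square_op Q f z = (deriv ^^ 3) f z - 4 * Q z * deriv f z - 2 * deriv Q z * f z"

text \<open>Its z-derivative is -1/2 f times \<open>sym_square_op Q f\<close>, so it is constant
  along solutions.\<close>

definition first_integral :: "(complex \<Rightarrow> complex) \<Rightarrow> (complex \<Rightarrow> complex) \<Rightarrow> complex \<Rightarrow> complex" where
  "first_integral Q f z = Q z * (f z)\<^sup>2 - 1 / 2 * f z * (deriv ^^ 2) f z + 1 / 4 * (deriv f z)\<^sup>2"

lemma eventually_cong_deriv:
  assumes "\<forall>\<^sub>\<approx>z::complex. f z = g z"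
  shows "\<forall>\<^sub>\<approx>z. \<forall>m. (deriv ^^ m) f z = (deriv ^^ m) g z"
  using eventually_cosparse_nhds[OF assms] by eventually_elim (auto intro: higher_deriv_cong_ev)

lemma sym_square_op_cong:
  assumes "\<forall>\<^sub>\<approx>z. f z = g z"
  shows "\<forall>\<^sub>\<approx>z. sym_square_op Q f z = sym_square_op Q g z \<and> first_integral Q f z = first_integral Q g z"
  using eventually_cong_deriv[OF assms]
proof eventually_elim
  case (elim z)
  have "f z = g z" using elim[rule_format, of 0] by simp
  moreover have "deriv f z = deriv g z" using elim[rule_format, of 1] by simp
  ultimately show ?case using elim by (simp add: sym_square_op_def first_integral_def)
qed

text \<open>Common frame for both families: e is the degree of the potential in its parameter, 1 for
  Lame and 2 for the generalized equation. That the top coefficient is 1, independently of z,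
  isolates the leading coefficient of a solution.\<close>

locale monic_potential =
  fixes S :: "complex set" and e :: nat and u :: "nat \<Rightarrow> complex \<Rightarrow> complex"
    and q :: "complex \<Rightarrow> complex \<Rightarrow> complex"
  assumes open_S: "open S" and cosparse_S: "\<forall>\<^sub>\<approx>z. z \<in> S" and e_pos: "e > 0"
    and holo_u: "\<And>j. j < e \<Longrightarrow> u j holomorphic_on S"
    and q_eq: "\<And>z t. z \<in> S \<Longrightarrow> q t z = t ^ e + (\<Sum>j<e. u j z * t ^ j)"
begin

lemma deriv_q:
  assumes "z \<in> S"
  shows "deriv (q t) z = (\<Sum>j<e. deriv (u j) z * t ^ j)"
proof -
  have "eventually (\<lambda>z. z \<in> S) (nhds z)"
    using open_S assms by (intro eventually_nhds_in_open)
  hence "eventually (\<lambda>z. q t z = t ^ e + (\<Sum>j<e. u j z * t ^ j)) (nhds z)"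
    by eventually_elim (rule q_eq)
  hence "deriv (q t) z = deriv (\<lambda>z. t ^ e + (\<Sum>j<e. u j z * t ^ j)) z"
    by (intro deriv_cong_ev) auto
  also have "((\<lambda>z. t ^ e + (\<Sum>j<e. u j z * t ^ j)) has_field_derivative 0 + (\<Sum>j<e. deriv (u j) z * t ^ j)) (at z)"
    by (intro DERIV_add DERIV_const DERIV_sum DERIV_cmult_right holomorphic_derivI[OF holo_u open_S assms]) auto
  hence "deriv (\<lambda>z. t ^ e + (\<Sum>j<e. u j z * t ^ j)) z = (\<Sum>j<e. deriv (u j) z * t ^ j)"
    using DERIV_imp_deriv by force
  finally show ?thesis .
qed

text \<open>Here d is a strict bound for the degree, so that d = 0 means the zero polynomial and
  inductions can start there.\<close>

definition poly_solution :: "nat \<Rightarrow> (complex \<Rightarrow> complex poly) \<Rightarrow> bool" where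
  "poly_solution d \<Phi> \<longleftrightarrow> (\<forall>\<^sub>\<approx>z. \<forall>i\<ge>d. coeff (\<Phi> z) i = 0) \<and>
     (\<forall>i. (\<lambda>z. coeff (\<Phi> z) i) meromorphic_on UNIV) \<and>
     (\<forall>t. \<forall>\<^sub>\<approx>z. sym_square_op (q t) (\<lambda>w. poly (\<Phi> w) t) z = 0)"

text \<open>Since only finitely many coefficients matter, one sparse exceptional set serves all t
  simultaneously.\<close>

lemma poly_solution_deriv:
  assumes "poly_solution d \<Phi>"
  shows "\<forall>\<^sub>\<approx>z. \<forall>t. (\<lambda>w. poly (\<Phi> w) t) analytic_on {z} \<and>
    (\<forall>m. (deriv ^^ m) (\<lambda>w. poly (\<Phi> w) t) z = (\<Sum>i<d. (deriv ^^ m) (\<lambda>w. coeff (\<Phi> w) i) z * t ^ i))"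
proof -
  have "\<forall>\<^sub>\<approx>z. \<forall>i\<ge>d. coeff (\<Phi> z) i = 0" using assms by (simp add: poly_solution_def)
  from eventually_cosparse_nhds[OF this]
  have 1: "\<forall>\<^sub>\<approx>z. eventually (\<lambda>w. \<forall>i\<ge>d. coeff (\<Phi> w) i = 0) (nhds z)"
    by eventually_elim simp
  have 2: "\<forall>\<^sub>\<approx>z. \<forall>i\<in>{..<d}. (\<lambda>w. coeff (\<Phi> w) i) analytic_on {z}"
    by (intro eventually_ball_finite ballI meromorphic_on_imp_analytic_cosparse)
       (use assms in \<open>auto simp: poly_solution_def\<close>)
  show ?thesis
    using 1 2
  proof eventually_elim
    case (elim z)
    show ?case
    proof (rule allI)
      fix t
      have ev: "eventually (\<lambda>w. poly (\<Phi> w) t = (\<Sum>i<d. coeff (\<Phi> w) i * t ^ i)) (nhds z)"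
        using elim(1) by eventually_elim (intro poly_eq_sum, auto)
      have "(\<lambda>w. \<Sum>i<d. coeff (\<Phi> w) i * t ^ i) analytic_on {z}"
        using elim(2) by (auto intro!: analytic_intros)
      hence "(\<lambda>w. poly (\<Phi> w) t) analytic_on {z}"
        using analytic_at_cong[OF ev refl] by simp
      moreover have "(deriv ^^ m) (\<lambda>w. poly (\<Phi> w) t) z = (\<Sum>i<d. (deriv ^^ m) (\<lambda>w. coeff (\<Phi> w) i) z * t ^ i)" for m
        unfolding higher_deriv_cong_ev[OF ev refl, of m]
        by (rule higher_deriv_linear_combination) (use elim(2) in auto)
      ultimately show "(\<lambda>w. poly (\<Phi> w) t) analytic_on {z} \<and> (\<forall>m. (deriv ^^ m) (\<lambda>w. poly (\<Phi> w) t) z = (\<Sum>i<d. (deriv ^^ m) (\<lambda>w. coeff (\<Phi> w) i) z * t ^ i))"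
        by blast
    qed
  qed
qed

text \<open>
  In the equation, the highest power of \<open>t\<close> only occurs in \<open>- 4 * q * \<Phi>'\<close>, so the top
  coefficient of a polynomial solution is constant.
\<close>

lemma poly_solution_top_const:
  assumes sol: "poly_solution (Suc d) \<Phi>"
  shows "\<exists>c. \<forall>\<^sub>\<approx>z. coeff (\<Phi> z) d = c"
proof (rule meromorphic_deriv_0_imp_constant)
  show "(\<lambda>z. coeff (\<Phi> z) d) meromorphic_on UNIV" using sol by (simp add: poly_solution_def)
  \<comment> \<open>Each t has its own exceptional set, and only finitely many of them are combined.
    The d + e + 1 values chosen suffice, because the left-hand side is a polynomial R in t of degree
    at most d + e.\<close>
  have "\<forall>\<^sub>\<approx>z. \<forall>t\<in>of_nat ` {..d + e}. sym_square_op (q t) (\<lambda>w. poly (\<Phi> w) t) z = 0"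
    by (intro eventually_ball_finite) (use sol in \<open>auto simp: poly_solution_def\<close>)
  with poly_solution_deriv[OF sol] cosparse_S
  show "\<forall>\<^sub>\<approx>z. deriv (\<lambda>z. coeff (\<Phi> z) d) z = 0"
  proof eventually_elim
    case (elim z)
    define D where "D = (\<lambda>m. \<Sum>i<Suc d. monom ((deriv ^^ m) (\<lambda>w. coeff (\<Phi> w) i) z) i)"
    define U where "U = monom 1 e + (\<Sum>j<e. monom (u j z) j)"
    define V where "V = (\<Sum>j<e. monom (deriv (u j) z) j)"
    define R where "R = D 3 - smult 4 (U * D 1) - smult 2 (V * D 0)"
    have D: "poly (D m) t = (deriv ^^ m) (\<lambda>w. poly (\<Phi> w) t) z" for m t
      using elim by (simp add: D_def poly_sum poly_monom)
    have U: "poly U t = q t z" for t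
      using elim by (simp add: U_def poly_sum poly_monom q_eq)
    have V: "poly V t = deriv (q t) z" for t
      using elim by (simp add: V_def poly_sum poly_monom deriv_q)
    have R: "poly R t = sym_square_op (q t) (\<lambda>w. poly (\<Phi> w) t) z" for t
      using D[of 0] D[of 1] by (simp add: R_def sym_square_op_def D U V)
    have degD: "degree (D m) \<le> d" for m
      unfolding D_def by (intro degree_sum_le) (auto intro: order_trans[OF degree_monom_le])
    have degU: "degree U \<le> e"
      unfolding U_def by (intro degree_add_le degree_monom_le degree_sum_le) (auto intro: order_trans[OF degree_monom_le])
    have degV: "degree V < e"
    proof -
      have "degree V \<le> e - 1"
        unfolding V_def by (intro degree_sum_le) (auto intro: order_trans[OF degree_monom_le])
      thus ?thesis using e_pos by simp
    qed
    have degR: "degree R \<le> d + e"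
      unfolding R_def using degD[of 0] degD[of 1] degD[of 3] degU degV
      by (intro degree_diff_le order_trans[OF degree_smult_le] order_trans[OF degree_mult_le]) auto
    have "R = 0"
    proof (rule ccontr)
      assume "R \<noteq> 0"
      have "of_nat ` {..d + e} \<subseteq> {t. poly R t = 0}" using elim by (auto simp: R)
      hence "card (of_nat ` {..d + e} :: complex set) \<le> card {t. poly R t = 0}"
        using poly_roots_finite[OF \<open>R \<noteq> 0\<close>] by (intro card_mono)
      also have "\<dots> \<le> degree R" using \<open>R \<noteq> 0\<close> by (rule card_poly_roots_bound)
      also have "card (of_nat ` {..d + e} :: complex set) = Suc (d + e)"
        by (subst card_image) (auto simp: inj_on_def)
      finally show False using degR by simp
    qed
    \<comment> \<open>In degree d + e the third derivative is too short and V has degree below e, so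
      only this product contributes.\<close>
    have "coeff (U * D 1) (e + d) = coeff U e * coeff (D 1) d"
      by (rule coeff_mult_degree_le[OF degU degD])
    moreover have "coeff U e = 1" by (simp add: U_def coeff_sum)
    moreover have "coeff (D 1) d = deriv (\<lambda>w. coeff (\<Phi> w) d) z" by (simp add: D_def coeff_sum)
    moreover have "coeff (D 3) (e + d) = 0" using degD[of 3] e_pos by (intro coeff_eq_0) auto
    moreover have "coeff (V * D 0) (e + d) = 0"
      using degD[of 0] degV degree_mult_le[of V "D 0"] by (intro coeff_eq_0) auto
    moreover have "coeff R (e + d) = 0" using \<open>R = 0\<close> by simp
    ultimately show ?case by (simp add: R_def)
  qed
qed

text \<open>One step of long division by F. As both top coefficients are constant, the multiplier
  depends on t alone, and the equation is linear over functions of t.\<close>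

lemma poly_solution_diff:
  assumes F: "poly_solution (Suc m) F" and P: "poly_solution (Suc d) \<Phi>" and "m \<le> d"
    and c: "\<forall>\<^sub>\<approx>z. coeff (F z) m = c" and a: "\<forall>\<^sub>\<approx>z. coeff (\<Phi> z) d = a" and "c \<noteq> 0"
  shows "poly_solution d (\<lambda>z. \<Phi> z - monom (a / c) (d - m) * F z)"
  unfolding poly_solution_def
proof (intro conjI allI)
  have 1: "\<forall>\<^sub>\<approx>z. \<forall>i\<ge>Suc d. coeff (\<Phi> z) i = 0" "\<forall>\<^sub>\<approx>z. \<forall>i\<ge>Suc m. coeff (F z) i = 0"
    using F P by (auto simp: poly_solution_def)
  show "\<forall>\<^sub>\<approx>z. \<forall>i\<ge>d. coeff (\<Phi> z - monom (a / c) (d - m) * F z) i = 0"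
    using 1 c a
  proof eventually_elim
    case (elim z)
    show ?case
    proof (intro allI impI)
      fix i assume "i \<ge> d"
      thus "coeff (\<Phi> z - monom (a / c) (d - m) * F z) i = 0"
        using elim \<open>m \<le> d\<close> \<open>c \<noteq> 0\<close> by (cases "i = d") (auto simp: coeff_monom_mult)
    qed
  qed
next
  fix i
  show "(\<lambda>z. coeff (\<Phi> z - monom (a / c) (d - m) * F z) i) meromorphic_on UNIV"
    unfolding coeff_diff coeff_monom_mult
    by (cases "i < d - m") (use F P in \<open>auto simp: poly_solution_def intro!: meromorphic_intros\<close>)
next
  fix t
  have "\<forall>\<^sub>\<approx>z. sym_square_op (q t) (\<lambda>w. poly (\<Phi> w) t) z = 0" "\<forall>\<^sub>\<approx>z. sym_square_op (q t) (\<lambda>w. poly (F w) t) z = 0"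
    using F P by (auto simp: poly_solution_def)
  with poly_solution_deriv[OF F] poly_solution_deriv[OF P]
  show "\<forall>\<^sub>\<approx>z. sym_square_op (q t) (\<lambda>w. poly (\<Phi> w - monom (a / c) (d - m) * F w) t) z = 0"
  proof eventually_elim
    case (elim z)
    define k where "k = a / c * t ^ (d - m)"
    have an: "(\<lambda>w. poly (\<Phi> w) t) analytic_on {z}" "(\<lambda>w. poly (F w) t) analytic_on {z}" using elim by auto
    have D: "(deriv ^^ j) (\<lambda>w. poly (\<Phi> w - monom (a / c) (d - m) * F w) t) z =
      (deriv ^^ j) (\<lambda>w. poly (\<Phi> w) t) z - k * (deriv ^^ j) (\<lambda>w. poly (F w) t) z" for j
    proof -
      have "(\<lambda>w. poly (\<Phi> w - monom (a / c) (d - m) * F w) t) = (\<lambda>w. poly (\<Phi> w) t - k * poly (F w) t)"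
        by (simp add: poly_monom k_def)
      moreover have "(\<lambda>w. k * poly (F w) t) analytic_on {z}" using an by (intro analytic_intros)
      ultimately show ?thesis using an by (simp add: higher_deriv_diff_at higher_deriv_cmult')
    qed
    have "sym_square_op (q t) (\<lambda>w. poly (\<Phi> w - monom (a / c) (d - m) * F w) t) z =
        sym_square_op (q t) (\<lambda>w. poly (\<Phi> w) t) z - k * sym_square_op (q t) (\<lambda>w. poly (F w) t) z"
      unfolding sym_square_op_def D[of 3] D[of "Suc 0", unfolded funpow.simps comp_id] D[of 0, unfolded funpow_0]
      by (simp only: algebra_simps)
    thus ?case using elim(3,4) by simp
  qed
qed

text \<open>Long division by a nonzero solution of least degree: the remainder is a solution of
  smaller degree and hence vanishes.\<close>

lemma poly_solution_factor:
  assumes sol: "poly_solution d0 \<Phi>0" and nz: "\<not> (\<forall>\<^sub>\<approx>z. \<Phi>0 z = 0)"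
  obtains F where "\<And>d \<Phi>. poly_solution d \<Phi> \<Longrightarrow> \<exists>P. \<forall>\<^sub>\<approx>z. \<Phi> z = P * F z"
proof -
  define m where "m = (LEAST m. \<exists>F. poly_solution m F \<and> \<not> (\<forall>\<^sub>\<approx>z. F z = 0))"
  have ex: "\<exists>F. poly_solution m F \<and> \<not> (\<forall>\<^sub>\<approx>z. F z = 0)"
    unfolding m_def by (rule LeastI_ex) (use sol nz in blast)
  then obtain F where F: "poly_solution m F" "\<not> (\<forall>\<^sub>\<approx>z. F z = 0)" by blast
  have least: "\<forall>\<^sub>\<approx>z. \<Phi> z = 0" if "poly_solution k \<Phi>" "k < m" for k \<Phi>
    using not_less_Least[of k] that unfolding m_def by blast
  have zero: "\<forall>\<^sub>\<approx>z. \<Phi> z = 0" if "poly_solution 0 \<Phi>" for \<Phi>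
  proof -
    have "\<forall>\<^sub>\<approx>z. \<forall>i\<ge>0. coeff (\<Phi> z) i = 0" using that unfolding poly_solution_def by blast
    thus ?thesis by eventually_elim (auto intro: poly_eqI)
  qed
  obtain m' where m: "m = Suc m'" using F zero by (cases m) auto
  obtain c where c: "\<forall>\<^sub>\<approx>z. coeff (F z) m' = c"
    using poly_solution_top_const F(1) m by blast
  \<comment> \<open>Otherwise F would already satisfy the smaller bound m', against
    minimality.\<close>
  have "c \<noteq> 0"
  proof
    assume "c = 0"
    have "\<forall>\<^sub>\<approx>z. \<forall>i\<ge>m. coeff (F z) i = 0" using F(1) by (simp add: poly_solution_def)
    with c have "\<forall>\<^sub>\<approx>z. \<forall>i\<ge>m'. coeff (F z) i = 0"
    proof eventually_elim
      case (elim z)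
      thus ?case using \<open>c = 0\<close> m by (metis Suc_leI le_neq_implies_less)
    qed
    hence "poly_solution m' F" using F(1) by (simp add: poly_solution_def)
    from least[OF this] F(2) m show False by simp
  qed
  have "\<exists>P. \<forall>\<^sub>\<approx>z. \<Phi> z = P * F z" if "poly_solution d \<Phi>" for d \<Phi>
    using that
  proof (induction d arbitrary: \<Phi>)
    case 0
    thus ?case using zero[of \<Phi>] by (intro exI[of _ 0]) simp
  next
    case (Suc d)
    show ?case
    proof (cases "d < m'")
      case True
      thus ?thesis using least[OF Suc.prems] m by (intro exI[of _ 0]) simp
    next
      case False
      obtain a where a: "\<forall>\<^sub>\<approx>z. coeff (\<Phi> z) d = a"
        using poly_solution_top_const Suc.prems by blast
      have "poly_solution d (\<lambda>z. \<Phi> z - monom (a / c) (d - m') * F z)"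
        using False F(1) m Suc.prems c a \<open>c \<noteq> 0\<close> by (intro poly_solution_diff) auto
      then obtain P where "\<forall>\<^sub>\<approx>z. \<Phi> z - monom (a / c) (d - m') * F z = P * F z"
        using Suc.IH by blast
      hence "\<forall>\<^sub>\<approx>z. \<Phi> z = (P + monom (a / c) (d - m')) * F z"
        by eventually_elim (simp add: algebra_simps)
      thus ?thesis by blast
    qed
  qed
  thus ?thesis by (rule that)
qed

lemma monic_elliptic_solution_imp_poly_solution:
  assumes "monic_elliptic_solution \<tau> q d \<Phi>"
  shows "poly_solution (Suc d) \<Phi>"
proof -
  have "coeff (\<Phi> z) i = 0" if "i > d" for z i
    using assms that coeff_eq_0[of "\<Phi> z" i] by (simp add: monic_elliptic_solution_def)
  thus ?thesis
    using assms unfolding poly_solution_def monic_elliptic_solution_def elliptic_def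
      nicely_meromorphic_on_def sym_square_op_def by (auto simp: Suc_le_eq)
qed

lemma monic_elliptic_solution_unique:
  assumes "monic_elliptic_solution \<tau> q d \<Phi>" "monic_elliptic_solution \<tau> q d \<Psi>"
  shows "\<Phi> = \<Psi>"
proof -
  have nz: "\<not> (\<forall>\<^sub>\<approx>z. poly (\<Theta> z) t = 0)" and lc: "degree (\<Theta> z) = d" "lead_coeff (\<Theta> z) = 1"
    and nice: "(\<lambda>z. coeff (\<Theta> z) i) nicely_meromorphic_on UNIV"
    if "monic_elliptic_solution \<tau> q d \<Theta>" for \<Theta> t z i
    using that unfolding monic_elliptic_solution_def elliptic_def by auto
  have "\<not> (\<forall>\<^sub>\<approx>z. \<Phi> z = 0)"
  proof
    assume "\<forall>\<^sub>\<approx>z. \<Phi> z = 0"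
    hence "\<forall>\<^sub>\<approx>z. poly (\<Phi> z) 0 = 0" by eventually_elim simp
    thus False using nz[OF assms(1)] by blast
  qed
  then obtain F where F: "\<And>d \<Phi>. poly_solution d \<Phi> \<Longrightarrow> \<exists>P. \<forall>\<^sub>\<approx>z. \<Phi> z = P * F z"
    using poly_solution_factor monic_elliptic_solution_imp_poly_solution[OF assms(1)] by blast
  have const: "\<exists>a. \<forall>\<^sub>\<approx>z. \<Theta> z = smult a (F z)" if \<Theta>: "monic_elliptic_solution \<tau> q d \<Theta>" for \<Theta>
  proof -
    obtain P where P: "\<forall>\<^sub>\<approx>z. \<Theta> z = P * F z"
      using F monic_elliptic_solution_imp_poly_solution[OF \<Theta>] by blast
    have "poly P t \<noteq> 0" for t
    proof
      assume "poly P t = 0"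
      from P have "\<forall>\<^sub>\<approx>z. poly (\<Theta> z) t = 0"
        by eventually_elim (simp add: \<open>poly P t = 0\<close>)
      thus False using nz[OF \<Theta>] by blast
    qed
    hence "\<exists>a. P = [:a:]"
      using fundamental_theorem_of_algebra_alt[of P] by auto
    then obtain a where "P = [:a:]" by blast
    with P show ?thesis by auto
  qed
  obtain a b where ab: "\<forall>\<^sub>\<approx>z. \<Phi> z = smult a (F z)" "\<forall>\<^sub>\<approx>z. \<Psi> z = smult b (F z)"
    using const assms by blast
  have "\<exists>z. \<Phi> z = smult a (F z) \<and> \<Psi> z = smult b (F z)"
    by (rule cosparse_imp_ex) (use ab in eventually_elim, simp)
  then obtain z where z: "\<Phi> z = smult a (F z)" "\<Psi> z = smult b (F z)" by blast
  \<comment> \<open>Comparing leading coefficients at one common point fixes the scalars.\<close>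
  have "a * coeff (F z) d = 1" "b * coeff (F z) d = 1"
    using lc[OF assms(1), of z] lc[OF assms(2), of z] z by (metis coeff_smult)+
  hence "a = b" by (metis mult.commute mult.left_commute mult.right_neutral)
  from ab have "\<forall>\<^sub>\<approx>z. \<Phi> z = \<Psi> z" by eventually_elim (simp add: \<open>a = b\<close>)
  hence "(\<lambda>z. coeff (\<Phi> z) i) = (\<lambda>z. coeff (\<Psi> z) i)" for i
    using nice assms by (intro nicely_meromorphic_eqI) (auto elim: eventually_mono)
  hence "coeff (\<Phi> z) i = coeff (\<Psi> z) i" for z i by metis
  thus ?thesis by (intro ext poly_eqI) auto
qed

text \<open>Explicit formulas are valid only on S. Removing singularities coefficient by coefficient
  gives the representative that \<open>elliptic\<close> demands on the whole plane, and uniqueness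
  then evaluates both definite descriptions.\<close>

lemma spectral_poly_eqI:
  assumes deg: "\<And>z. z \<in> S \<Longrightarrow> degree (\<Phi> z) = d" "\<And>z. z \<in> S \<Longrightarrow> lead_coeff (\<Phi> z) = 1"
    and mero: "\<And>i. (\<lambda>z. coeff (\<Phi> z) i) meromorphic_on UNIV"
    and per: "\<And>w z. w \<in> period_lattice \<tau> \<Longrightarrow> z \<in> S \<Longrightarrow> \<Phi> (z + w) = \<Phi> z"
    and nz: "\<And>t. \<not> (\<forall>\<^sub>\<approx>z. poly (\<Phi> z) t = 0)"
    and ode: "\<And>t z. z \<in> S \<Longrightarrow> sym_square_op (q t) (\<lambda>w. poly (\<Phi> w) t) z = 0"
    and Q: "\<And>t. \<forall>\<^sub>\<approx>z. poly Q t = first_integral (q t) (\<lambda>w. poly (\<Phi> w) t) z"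
  shows "spectral_poly \<tau> q d = Q"
proof -
  define r where "r = (\<lambda>i. remove_sings (\<lambda>z. coeff (\<Phi> z) i))"
  define \<Psi> where "\<Psi> = (\<lambda>z. \<Sum>i\<le>d. monom (r i z) i)"
  have coeff: "coeff (\<Psi> z) i = (if i \<le> d then r i z else 0)" for z i
    by (simp add: \<Psi>_def coeff_sum)
  \<comment> \<open>The top coefficient 1 is recovered as a limit, so the corrected polynomial is
    monic of degree d also where other coefficients have poles.\<close>
  have rd: "r d z = 1" for z
  proof -
    have "eventually (\<lambda>z. z \<in> S) (at z)"
      by (rule eventually_cosparse_imp_eventually_at[OF cosparse_S]) auto
    hence "eventually (\<lambda>z. coeff (\<Phi> z) d = 1) (at z)"
      by eventually_elim (use deg in metis)
    hence "remove_sings (\<lambda>z. coeff (\<Phi> z) d) z = remove_sings (\<lambda>_. 1) z"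
      by (intro remove_sings_cong) auto
    thus ?thesis by (simp add: r_def)
  qed
  have degP: "degree (\<Psi> z) = d \<and> lead_coeff (\<Psi> z) = 1" for z
  proof -
    have "degree (\<Psi> z) \<le> d" by (rule degree_le) (simp add: coeff)
    moreover have "d \<le> degree (\<Psi> z)" by (rule le_degree) (simp add: coeff rd)
    ultimately show ?thesis by (simp add: coeff rd)
  qed
  have "\<forall>\<^sub>\<approx>z. \<forall>i\<in>{..d}. r i z = coeff (\<Phi> z) i"
    unfolding r_def by (intro eventually_ball_finite ballI eventually_remove_sings_eq mero) auto
  with cosparse_S have eq: "\<forall>\<^sub>\<approx>z. \<Psi> z = \<Phi> z"
  proof eventually_elim
    case (elim z)
    show ?case
      by (rule poly_eqI) (use elim deg(1)[of z] in \<open>auto simp: coeff coeff_eq_0\<close>)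
  qed
  have eqt: "\<forall>\<^sub>\<approx>z. poly (\<Psi> z) t = poly (\<Phi> z) t" for t
    using eq by eventually_elim simp
  have ell: "elliptic \<tau> (r i)" for i
    unfolding elliptic_def
  proof (intro conjI ballI allI)
    show "r i nicely_meromorphic_on UNIV"
      unfolding r_def by (intro remove_sings_nicely_meromorphic mero)
    fix w z assume w: "w \<in> period_lattice \<tau>"
    have "eventually (\<lambda>z. z \<in> S) (at z)"
      by (rule eventually_cosparse_imp_eventually_at[OF cosparse_S]) auto
    hence "eventually (\<lambda>x. coeff (\<Phi> (x + w)) i = coeff (\<Phi> x) i) (at z)"
      by eventually_elim (use per w in auto)
    hence "eventually (\<lambda>x. coeff (\<Phi> (z + w + x)) i = coeff (\<Phi> (z + x)) i) (at 0)"
      unfolding at_to_0[of z] eventually_filtermap by (simp add: add_ac)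
    thus "r i (z + w) = r i z"
      unfolding r_def remove_sings_shift_0[of _ "z + w"] remove_sings_shift_0[of _ z]
      by (intro remove_sings_cong) auto
  qed
  have sol: "monic_elliptic_solution \<tau> q d \<Psi>"
    unfolding monic_elliptic_solution_def
  proof (intro conjI allI)
    show "elliptic \<tau> (\<lambda>z. coeff (\<Psi> z) i)" for i
      using ell[of i] unfolding coeff by (cases "i \<le> d") (auto simp: elliptic_def)
    show "\<not> (\<forall>\<^sub>\<approx>z. poly (\<Psi> z) t = 0)" for t
    proof
      assume "\<forall>\<^sub>\<approx>z. poly (\<Psi> z) t = 0"
      with eq have "\<forall>\<^sub>\<approx>z. poly (\<Phi> z) t = 0" by eventually_elim simp
      thus False using nz by blast
    qed
    show "\<forall>\<^sub>\<approx>z. (deriv ^^ 3) (\<lambda>w. poly (\<Psi> w) t) z - 4 * q t z * deriv (\<lambda>w. poly (\<Psi> w) t) z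
      - 2 * deriv (q t) z * poly (\<Psi> z) t = 0" for t
      using sym_square_op_cong[OF eqt[of t], where Q = "q t"] cosparse_S
      by eventually_elim (use ode[of _ t] in \<open>auto simp: sym_square_op_def\<close>)
  qed (use degP in blast)+
  have "spectral_solution \<tau> q d = \<Psi>"
    unfolding spectral_solution_def
    by (rule the_equality) (use sol monic_elliptic_solution_unique in blast)+
  moreover have "(THE Q. \<forall>t. \<forall>\<^sub>\<approx>z. poly Q t = first_integral (q t) (\<lambda>w. poly (\<Psi> w) t) z) = Q"
  proof (rule the_equality)
    show Q': "\<forall>t. \<forall>\<^sub>\<approx>z. poly Q t = first_integral (q t) (\<lambda>w. poly (\<Psi> w) t) z"
    proof
      fix t
      show "\<forall>\<^sub>\<approx>z. poly Q t = first_integral (q t) (\<lambda>w. poly (\<Psi> w) t) z"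
        using Q[of t] sym_square_op_cong[OF eqt[of t], where Q = "q t"] by eventually_elim simp
    qed
    fix R assume R: "\<forall>t. \<forall>\<^sub>\<approx>z. poly R t = first_integral (q t) (\<lambda>w. poly (\<Psi> w) t) z"
    have "poly R t = poly Q t" for t
    proof -
      have "\<forall>\<^sub>\<approx>z::complex. poly R t = poly Q t"
        using R[rule_format, of t] Q'[rule_format, of t] by eventually_elim simp
      thus ?thesis using cosparse_imp_ex by blast
    qed
    thus "R = Q" by (simp add: poly_eq_poly_eq_iff[symmetric] fun_eq_iff)
  qed
  ultimately show ?thesis
    unfolding spectral_poly_def Let_def first_integral_def by simp
qed

end

lemma higher_derivs_on_open:
  assumes "open S"
    and "\<And>z. z \<in> S \<Longrightarrow> (f has_field_derivative f1 z) (at z)"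
    and "\<And>z. z \<in> S \<Longrightarrow> (f1 has_field_derivative f2 z) (at z)"
    and "\<And>z. z \<in> S \<Longrightarrow> (f2 has_field_derivative f3 z) (at z)"
    and "z \<in> S"
  shows "deriv f z = f1 z" "(deriv ^^ 2) f z = f2 z" "(deriv ^^ 3) f z = f3 z"
proof -
  have 1: "deriv f z = f1 z" if "z \<in> S" for z using assms that DERIV_imp_deriv by blast
  have "eventually (\<lambda>z. z \<in> S) (nhds z)" if "z \<in> S" for z
    using assms(1) that by (intro eventually_nhds_in_open)
  hence ev: "eventually (\<lambda>z. deriv f z = f1 z) (nhds z)" if "z \<in> S" for z
    using that by (metis (mono_tags, lifting) 1 eventually_mono)
  have 2: "(deriv ^^ 2) f z = f2 z" if "z \<in> S" for z
    using deriv_cong_ev[OF ev[OF that] refl] DERIV_imp_deriv[OF assms(3)[OF that]]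
    by (simp add: numeral_2_eq_2)
  have ev2: "eventually (\<lambda>z. (deriv ^^ 2) f z = f2 z) (nhds z)"
    using eventually_nhds_in_open[OF assms(1,5)] by eventually_elim (rule 2)
  show "deriv f z = f1 z" "(deriv ^^ 2) f z = f2 z" using 1 2 assms(5) by auto
  show "(deriv ^^ 3) f z = f3 z"
    using deriv_cong_ev[OF ev2 refl] DERIV_imp_deriv[OF assms(4)[OF assms(5)]]
    by (simp add: numeral_3_eq_3 numeral_2_eq_2)
qed

section \<open>The Lame equation\<close>

context
  fixes n :: nat and a b :: complex
begin

text \<open>
  With \<open>wp'' = 6 wp\<^sup>2 - a\<close> and \<open>wp'\<^sup>2 = 4 wp\<^sup>3 - 2 a wp - b\<close>, the sum \<open>\<Sum>k. f\<^sub>k wp\<^sup>k\<close> solves the third-order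
  Lame equation with parameter \<open>t\<close> iff
  \<open>lame_alpha k f\<^sub>k = 4 (k + 1) t f\<^sub>k\<^sub>+\<^sub>1 + lame_beta k f\<^sub>k\<^sub>+\<^sub>2 + lame_gamma k f\<^sub>k\<^sub>+\<^sub>3\<close>. Since
  \<open>lame_alpha n = 0\<close>, the recursion can be run downwards from \<open>k = n\<close>; \<open>lame_desc m\<close> is the
  unnormalised \<open>f\<^sub>n\<^sub>-\<^sub>m\<close> as a polynomial in \<open>t\<close>.
\<close>

definition lame_alpha :: "nat \<Rightarrow> complex" where
  "lame_alpha k = 2 * (2 * of_nat k + 1) * (of_nat (k * (k + 1)) - of_nat (n * (n + 1)))"

definition lame_beta :: "nat \<Rightarrow> complex" where
  "lame_beta k = a * of_nat ((k + 1) * (k + 2) * (2 * k + 3))"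

definition lame_gamma :: "nat \<Rightarrow> complex" where
  "lame_gamma k = b * of_nat ((k + 1) * (k + 2) * (k + 3))"

fun lame_desc :: "nat \<Rightarrow> complex poly" where
  "lame_desc 0 = 1"
| "lame_desc (Suc m) = smult (1 / lame_alpha (n - Suc m))
     (smult (4 * of_nat (n - m)) (pCons 0 (lame_desc m))
      + (if m \<ge> 1 then smult (lame_beta (n - Suc m)) (lame_desc (m - 1)) else 0)
      + (if m \<ge> 2 then smult (lame_gamma (n - Suc m)) (lame_desc (m - 2)) else 0))"

lemma lame_alpha_nonzero: "k < n \<Longrightarrow> lame_alpha k \<noteq> 0"
proof -
  assume "k < n"
  hence "k * (k + 1) < n * (n + 1)" by (intro mult_strict_mono) auto
  hence "of_nat (k * (k + 1)) \<noteq> (of_nat (n * (n + 1)) :: complex)"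
    unfolding of_nat_eq_iff by linarith
  moreover have "(2 * of_nat k + 1 :: complex) \<noteq> 0"
    by (metis of_nat_0_neq of_nat_1 of_nat_add of_nat_mult of_nat_numeral add.commute plus_1_eq_Suc)
  ultimately show ?thesis unfolding lame_alpha_def by (intro no_zero_divisors) auto
qed

text \<open>Each downward step multiplies the previous term by t with the nonzero factor 4 (n - m) /
  \<open>lame_alpha\<close>, and the other two terms have lower degree. So the last one,
  \<open>lame_desc n\<close>, has degree exactly n and can be made monic.\<close>

lemma lame_desc_degree:
  "m \<le> n \<Longrightarrow> degree (lame_desc m) \<le> m \<and> coeff (lame_desc m) m \<noteq> 0"
proof (induction m rule: less_induct)
  case (less m)
  show ?case
  proof (cases m)
    case 0
    thus ?thesis by simp
  next
    case (Suc k)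
    have k: "degree (lame_desc k) \<le> k" "coeff (lame_desc k) k \<noteq> 0" using less Suc by auto
    have k1: "degree (lame_desc (k - 1)) \<le> k - 1" and k2: "degree (lame_desc (k - 2)) \<le> k - 2"
      using less.IH[of "k - 1"] less.IH[of "k - 2"] less.prems Suc by auto
    have "degree (lame_desc (Suc k)) \<le> Suc k"
      using k k1 k2 by (auto intro!: order_trans[OF degree_smult_le] degree_add_le order_trans[OF degree_pCons_le])
    moreover have "coeff (lame_desc (k - 1)) (Suc k) = 0" "coeff (lame_desc (k - 2)) (Suc k) = 0"
      using k1 k2 by (auto intro!: coeff_eq_0)
    hence "coeff (lame_desc (Suc k)) (Suc k) = 1 / lame_alpha (n - Suc k) * (4 * of_nat (n - k) * coeff (lame_desc k) k)"
      by simp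
    moreover have "lame_alpha (n - Suc k) \<noteq> 0"
      using less.prems Suc lame_alpha_nonzero[of "n - Suc k"] by auto
    moreover have "(of_nat (n - k) :: complex) \<noteq> 0"
      using less.prems Suc unfolding of_nat_eq_0_iff by simp
    ultimately show ?thesis using k unfolding Suc by (simp del: lame_desc.simps of_nat_diff)
  qed
qed

text \<open>Besides the monic c 0, the nonzero constant c n matters: it prevents the solution from
  vanishing identically for any t.\<close>

lemma lame_coeffs_exist:
  obtains c :: "nat \<Rightarrow> complex poly" and \<gamma> where
    "\<And>k. k > n \<Longrightarrow> c k = 0" "\<And>k. k \<le> n \<Longrightarrow> degree (c k) \<le> n - k" "coeff (c 0) n = 1"
    "c n = [:\<gamma>:]" "\<gamma> \<noteq> 0"
    "\<And>k. smult (lame_alpha k) (c k) = smult (4 * of_nat (k + 1)) (pCons 0 (c (k + 1)))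
        + smult (lame_beta k) (c (k + 2)) + smult (lame_gamma k) (c (k + 3))"
proof -
  define g where "g = 1 / coeff (lame_desc n) n"
  \<comment> \<open>Extension by 0 above n corresponds to the guards on m in
    \<open>lame_desc\<close>, where truncated subtraction would otherwise repeat
    \<open>lame_desc 0\<close>.\<close>
  define c where "c = (\<lambda>k. if k \<le> n then smult g (lame_desc (n - k)) else 0)"
  have g: "g \<noteq> 0" using lame_desc_degree[of n] by (simp add: g_def)
  have rec: "smult (lame_alpha k) (c k) = smult (4 * of_nat (k + 1)) (pCons 0 (c (k + 1)))
        + smult (lame_beta k) (c (k + 2)) + smult (lame_gamma k) (c (k + 3))" for k
  proof (cases "k < n")
    case False
    thus ?thesis by (auto simp: c_def lame_alpha_def)
  next
    case True
    define m where "m = n - Suc k"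
    have m: "n - k = Suc m" "n - Suc m = k" "n - m = Suc k" using True by (auto simp: m_def)
    have "smult (lame_alpha k) (lame_desc (n - k)) = smult (4 * of_nat (k + 1)) (pCons 0 (lame_desc m))
      + (if m \<ge> 1 then smult (lame_beta k) (lame_desc (m - 1)) else 0)
      + (if m \<ge> 2 then smult (lame_gamma k) (lame_desc (m - 2)) else 0)"
      unfolding m(1) lame_desc.simps m(2,3) using lame_alpha_nonzero[OF True] by simp
    hence "smult g (smult (lame_alpha k) (lame_desc (n - k))) = smult g (smult (4 * of_nat (k + 1)) (pCons 0 (lame_desc m))
      + (if m \<ge> 1 then smult (lame_beta k) (lame_desc (m - 1)) else 0)
      + (if m \<ge> 2 then smult (lame_gamma k) (lame_desc (m - 2)) else 0))" by simp
    moreover have "c (k + 1) = smult g (lame_desc m)" using True by (auto simp: c_def m_def)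
    moreover have "c (k + 2) = (if m \<ge> 1 then smult g (lame_desc (m - 1)) else 0)"
      using True by (auto simp: c_def m_def)
    moreover have "c (k + 3) = (if m \<ge> 2 then smult g (lame_desc (m - 2)) else 0)"
      using True by (auto simp: c_def m_def numeral_2_eq_2 numeral_3_eq_3)
    moreover have "c k = smult g (lame_desc (n - k))" using True by (simp add: c_def)
    ultimately show ?thesis by (simp add: smult_add_right mult.commute)
  qed
  show ?thesis
  proof (rule that[of c g])
    show "coeff (c 0) n = 1" using g by (simp add: c_def g_def)
    show "c n = [:g:]" by (simp add: c_def one_pCons)
    show "degree (c k) \<le> n - k" if "k \<le> n" for k
      using lame_desc_degree[of "n - k"] that by (auto simp: c_def)
  qed (use g rec in \<open>auto simp: c_def\<close>)
qed

end

text \<open>The third-order Lame equation for A(wp), divided by wp' and written in x = wp: the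
  leading coefficient is wp'^2, the next one is 3 wp'', and 12 x comes from wp''' = 12 wp wp'. The
  recursion is its coefficient at x^k.\<close>

lemma lame_poly_ode:
  fixes f :: "nat \<Rightarrow> complex" and n :: nat and t :: complex
  assumes rec: "\<And>k. lame_alpha n k * f k = 4 * of_nat (k + 1) * t * f (k + 1)
        + lame_beta a k * f (k + 2) + lame_gamma b k * f (k + 3)"
    and f: "\<And>k. coeff A k = f k"
  defines "N \<equiv> of_nat (n * (n + 1))"
  shows "[:- b, - 2 * a, 0, 4:] * pderiv (pderiv (pderiv A)) + [:- 3 * a, 0, 18:] * pderiv (pderiv A)
    + [:- 4 * t, 12 - 4 * N:] * pderiv A - smult (2 * N) A = 0"
proof (rule poly_eqI)
  fix k
  have k: "(4 * of_nat k * (of_nat k - 1) * (of_nat k - 2) + 18 * of_nat k * (of_nat k - 1) + (12 - 4 * N) * of_nat k - 2 * N) * f k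
     - 4 * t * of_nat (k + 1) * f (k + 1) - a * of_nat (k + 1) * of_nat (k + 2) * (2 * of_nat k + 3) * f (k + 2)
     - b * of_nat (k + 1) * of_nat (k + 2) * of_nat (k + 3) * f (k + 3) = 0"
    using rec[of k] unfolding lame_alpha_def lame_beta_def lame_gamma_def N_def[symmetric]
    by (simp add: algebra_simps)
  \<comment> \<open>Multiplication by a cubic shifts indices by up to three, so small k are
    separated to make all coefficients explicit.\<close>
  consider "k = 0" | "k = 1" | "k = 2" | j where "k = Suc (Suc (Suc j))"
    by (metis One_nat_def Suc_1 not0_implies_Suc)
  thus "coeff ([:- b, - 2 * a, 0, 4:] * pderiv (pderiv (pderiv A)) + [:- 3 * a, 0, 18:] * pderiv (pderiv A)
    + [:- 4 * t, 12 - 4 * N:] * pderiv A - smult (2 * N) A) k = coeff 0 k"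
    by cases (use k in \<open>simp_all add: coeff_pderiv f coeff_pCons numeral_2_eq_2 numeral_3_eq_3 algebra_simps\<close>)
qed

section \<open>Polynomials in \<open>wp\<close> with coefficients polynomial in the
  parameter\<close>

context complex_lattice begin

lemma pderiv_sum_atMost: "pderiv (\<Sum>k\<le>n. p k) = (\<Sum>k\<le>n. pderiv (p k))" for n :: nat
  by (induction n) (simp_all add: pderiv_add)

definition lin_comb :: "(nat \<Rightarrow> complex poly) \<Rightarrow> nat \<Rightarrow> (nat \<Rightarrow> complex) \<Rightarrow> complex poly" where
  "lin_comb c n a = (\<Sum>k\<le>n. smult (a k) (c k))"

text \<open>\<open>wp_poly1\<close> and \<open>wp_poly2\<close> are its first two z-derivatives,
  given by formulas rather than by \<open>deriv\<close>, so that degree, meromorphy and periodicity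
  are visible.\<close>

definition wp_poly :: "(nat \<Rightarrow> complex poly) \<Rightarrow> nat \<Rightarrow> complex \<Rightarrow> complex poly" where
  "wp_poly c n z = lin_comb c n (\<lambda>k. wp z ^ k)"

definition wp_poly1 :: "(nat \<Rightarrow> complex poly) \<Rightarrow> nat \<Rightarrow> complex \<Rightarrow> complex poly" where
  "wp_poly1 c n z = lin_comb c n (\<lambda>k. of_nat k * wp z ^ (k - 1) * deriv wp z)"

definition wp_poly2 :: "(nat \<Rightarrow> complex poly) \<Rightarrow> nat \<Rightarrow> complex \<Rightarrow> complex poly" where
  "wp_poly2 c n z = lin_comb c n (\<lambda>k. of_nat k * of_nat (k - 1) * wp z ^ (k - 2) * (deriv wp z)\<^sup>2
      + of_nat k * wp z ^ (k - 1) * (6 * (wp z)\<^sup>2 - wp_a))"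

text \<open>The transposed view: for fixed t, the polynomial in x that becomes the solution at x =
  \<open>wp z\<close>. The chain rule is applied in this form.\<close>

definition eval_coeffs :: "(nat \<Rightarrow> complex poly) \<Rightarrow> nat \<Rightarrow> complex \<Rightarrow> complex poly" where
  "eval_coeffs c n t = (\<Sum>k\<le>n. monom (poly (c k) t) k)"

lemma poly_lin_comb: "poly (lin_comb c n a) t = (\<Sum>k\<le>n. a k * poly (c k) t)"
  by (simp add: lin_comb_def poly_sum)

lemma coeff_lin_comb: "coeff (lin_comb c n a) i = (\<Sum>k\<le>n. a k * coeff (c k) i)"
  by (simp add: lin_comb_def coeff_sum)

lemma coeff_eval_coeffs: "coeff (eval_coeffs c n t) k = (if k \<le> n then poly (c k) t else 0)"
  by (simp add: eval_coeffs_def coeff_sum)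

lemma poly_wp_poly: "poly (wp_poly c n z) t = poly (eval_coeffs c n t) (wp z)"
  unfolding wp_poly_def poly_lin_comb eval_coeffs_def
  by (simp add: poly_sum poly_monom mult.commute)

lemma poly_wp_poly1: "poly (wp_poly1 c n z) t = poly (pderiv (eval_coeffs c n t)) (wp z) * deriv wp z"
  unfolding wp_poly1_def poly_lin_comb eval_coeffs_def pderiv_sum_atMost pderiv_monom poly_sum poly_monom sum_distrib_right
  by (intro sum.cong) (simp_all add: algebra_simps)

lemma poly_wp_poly2:
  "poly (wp_poly2 c n z) t = poly (pderiv (pderiv (eval_coeffs c n t))) (wp z) * (deriv wp z)\<^sup>2
     + poly (pderiv (eval_coeffs c n t)) (wp z) * (6 * (wp z)\<^sup>2 - wp_a)"
  unfolding wp_poly2_def poly_lin_comb eval_coeffs_def pderiv_sum_atMost pderiv_monom poly_sum poly_monom sum_distrib_right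
    sum.distrib[symmetric]
  by (intro sum.cong) (simp_all add: algebra_simps numeral_2_eq_2)

lemma wp_poly_has_field_derivative:
  assumes "z \<notin> \<Lambda>"
  shows "((\<lambda>z. poly (wp_poly c n z) t) has_field_derivative poly (wp_poly1 c n z) t) (at z)"
  unfolding poly_wp_poly poly_wp_poly1
  by (rule DERIV_chain2[OF poly_DERIV wp_has_field_derivative[OF assms]])

lemma poly_comp_wp_has_field_derivative:
  assumes "z \<notin> \<Lambda>"
  shows "((\<lambda>z. poly A (wp z)) has_field_derivative poly (pderiv A) (wp z) * deriv wp z) (at z)"
  by (rule DERIV_chain2[OF poly_DERIV wp_has_field_derivative[OF assms]])

lemma wp_poly1_has_field_derivative:
  assumes "z \<notin> \<Lambda>"
  shows "((\<lambda>z. poly (wp_poly1 c n z) t) has_field_derivative poly (wp_poly2 c n z) t) (at z)"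
  unfolding poly_wp_poly1 poly_wp_poly2 deriv2_wp[OF assms, symmetric]
  by (rule DERIV_cong[OF DERIV_mult[OF poly_comp_wp_has_field_derivative deriv_wp_has_field_derivative]])
     (use assms in \<open>auto simp: power2_eq_square\<close>)

text \<open>The third derivative appears in the form dictated by the Lame equation, so this is the
  statement that the recursion produces a solution.\<close>

lemma wp_poly2_has_field_derivative:
  assumes z: "z \<notin> \<Lambda>"
    and rec: "\<And>k. smult (lame_alpha n k) (c k) = smult (4 * of_nat (k + 1)) (pCons 0 (c (k + 1)))
        + smult (lame_beta wp_a k) (c (k + 2)) + smult (lame_gamma wp_b k) (c (k + 3))"
    and c0: "\<And>k. k > n \<Longrightarrow> c k = 0"
  defines "N \<equiv> of_nat (n * (n + 1))"
  shows "((\<lambda>z. poly (wp_poly2 c n z) t) has_field_derivative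
    4 * (N * wp z + t) * poly (wp_poly1 c n z) t + 2 * (N * deriv wp z) * poly (wp_poly c n z) t) (at z)"
proof -
  define A where "A = eval_coeffs c n t"
  define X X1 where "X = wp z" and "X1 = deriv wp z"
  have A: "coeff A k = poly (c k) t" for k
    using c0 by (auto simp: A_def coeff_eval_coeffs)
  have "[:- wp_b, - 2 * wp_a, 0, 4:] * pderiv (pderiv (pderiv A)) + [:- 3 * wp_a, 0, 18:] * pderiv (pderiv A)
    + [:- 4 * t, 12 - 4 * N:] * pderiv A - smult (2 * N) A = 0"
    unfolding N_def
  proof (rule lame_poly_ode[OF _ A])
    fix k
    have "poly (smult (lame_alpha n k) (c k)) t = poly (smult (4 * of_nat (k + 1)) (pCons 0 (c (k + 1)))
        + smult (lame_beta wp_a k) (c (k + 2)) + smult (lame_gamma wp_b k) (c (k + 3))) t"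
      by (simp only: rec)
    thus "lame_alpha n k * poly (c k) t = 4 * of_nat (k + 1) * t * poly (c (k + 1)) t
        + lame_beta wp_a k * poly (c (k + 2)) t + lame_gamma wp_b k * poly (c (k + 3)) t"
      by (simp add: algebra_simps)
  qed
  hence "poly ([:- wp_b, - 2 * wp_a, 0, 4:] * pderiv (pderiv (pderiv A)) + [:- 3 * wp_a, 0, 18:] * pderiv (pderiv A)
    + [:- 4 * t, 12 - 4 * N:] * pderiv A - smult (2 * N) A) X = 0" by simp
  hence ode: "(4 * X ^ 3 - 2 * wp_a * X - wp_b) * poly (pderiv (pderiv (pderiv A))) X
      + (18 * X\<^sup>2 - 3 * wp_a) * poly (pderiv (pderiv A)) X + (12 * X) * poly (pderiv A) X
      = 4 * (N * X + t) * poly (pderiv A) X + 2 * N * poly A X"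
    by (simp add: algebra_simps power2_eq_square power3_eq_cube)
  have X1: "4 * X ^ 3 - 2 * wp_a * X - wp_b = X1\<^sup>2" using deriv_wp_squared[OF z] by (simp add: X_def X1_def)
  have "((\<lambda>z. poly (wp_poly2 c n z) t) has_field_derivative
     (poly (pderiv (pderiv (pderiv A))) X * X1 * X1\<^sup>2 + (2 * X1 * (6 * X\<^sup>2 - wp_a)) * poly (pderiv (pderiv A)) X)
     + (poly (pderiv (pderiv A)) X * X1 * (6 * X\<^sup>2 - wp_a) + (12 * X * X1) * poly (pderiv A) X)) (at z)"
    unfolding poly_wp_poly2 A_def[symmetric] X_def X1_def
  proof (intro DERIV_add DERIV_mult poly_comp_wp_has_field_derivative z)
    show "((\<lambda>z. (deriv wp z)\<^sup>2) has_field_derivative 2 * deriv wp z * (6 * (wp z)\<^sup>2 - wp_a)) (at z)"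
      unfolding deriv2_wp[OF z, symmetric]
      by (rule derivative_eq_intros deriv_wp_has_field_derivative z refl | simp)+
    show "((\<lambda>z. 6 * (wp z)\<^sup>2 - wp_a) has_field_derivative 12 * wp z * deriv wp z) (at z)"
      by (rule derivative_eq_intros wp_has_field_derivative z refl | simp)+
  qed
  also have "(poly (pderiv (pderiv (pderiv A))) X * X1 * X1\<^sup>2 + (2 * X1 * (6 * X\<^sup>2 - wp_a)) * poly (pderiv (pderiv A)) X)
     + (poly (pderiv (pderiv A)) X * X1 * (6 * X\<^sup>2 - wp_a) + (12 * X * X1) * poly (pderiv A) X)
     = X1 * (X1\<^sup>2 * poly (pderiv (pderiv (pderiv A))) X
      + (18 * X\<^sup>2 - 3 * wp_a) * poly (pderiv (pderiv A)) X + (12 * X) * poly (pderiv A) X)"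
    by (simp add: algebra_simps)
  also have "\<dots> = 4 * (N * wp z + t) * poly (wp_poly1 c n z) t + 2 * (N * deriv wp z) * poly (wp_poly c n z) t"
    unfolding X1[symmetric] ode unfolding poly_wp_poly poly_wp_poly1 A_def[symmetric] X_def X1_def
    by (simp add: algebra_simps)
  finally show ?thesis .
qed

end

section \<open>The Darboux transformation\<close>

lemma DERIV_eq_on_open:
  assumes "open S" "z \<in> S" "\<And>w. w \<in> S \<Longrightarrow> f w = g w" "(g has_field_derivative D) (at z)"
  shows "(f has_field_derivative D) (at z)"
  using has_field_derivative_transform_within_open[OF assms(4,1,2)] assms(3) by metis

text \<open>
  Here \<open>\<phi> = w\<^sub>1 w\<^sub>2\<close> for two solutions of \<open>w'' = (g + T\<^sup>2) w\<close>, and \<open>F = y\<^sub>1 y\<^sub>2\<close> with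
  \<open>y = (w' - T w) / sqrt g\<close>, up to the sign of \<open>F\<close>.
\<close>

context
  fixes S :: "complex set" and T :: complex and \<phi> \<phi>1 \<phi>2 g h h1 h2 F q :: "complex \<Rightarrow> complex"
  assumes S: "open S"
    and \<phi>: "\<And>z. z \<in> S \<Longrightarrow> (\<phi> has_field_derivative \<phi>1 z) (at z)"
    and \<phi>1: "\<And>z. z \<in> S \<Longrightarrow> (\<phi>1 has_field_derivative \<phi>2 z) (at z)"
    and \<phi>2: "\<And>z. z \<in> S \<Longrightarrow> (\<phi>2 has_field_derivative 4 * (g z + T\<^sup>2) * \<phi>1 z + 2 * (g z * h z) * \<phi> z) (at z)"
    and g: "\<And>z. z \<in> S \<Longrightarrow> (g has_field_derivative g z * h z) (at z)"
    and h: "\<And>z. z \<in> S \<Longrightarrow> (h has_field_derivative h1 z) (at z)"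
    and h1: "\<And>z. z \<in> S \<Longrightarrow> (h1 has_field_derivative h2 z) (at z)"
    and g_nz: "\<And>z. z \<in> S \<Longrightarrow> g z \<noteq> 0"
    and F_eq: "\<And>z. z \<in> S \<Longrightarrow> F z = \<phi> z - (\<phi>2 z / 2 - T * \<phi>1 z) / g z"
    and q_eq: "\<And>z. z \<in> S \<Longrightarrow> q z = g z + (T + h z / 2)\<^sup>2 - h1 z / 2"
begin

text \<open>With u = w' - T w, k is -(w1 u2 + w2 u1). The three products obey the closed system phi'
  = 2 T phi - k, k' = -2 g (phi - F), F' = k - s F, which makes all derivatives of F
  explicit.\<close>

private definition "k z = 2 * T * \<phi> z - \<phi>1 z"
private definition "s z = 2 * T + h z"

private lemma \<phi>2_eq: "z \<in> S \<Longrightarrow> \<phi>2 z = 2 * g z * (\<phi> z - F z) + 2 * T * \<phi>1 z"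
  using F_eq[of z] g_nz[of z] by (simp add: field_simps)

private lemma F': "z \<in> S \<Longrightarrow> (F has_field_derivative k z - s z * F z) (at z)"
proof -
  assume z: "z \<in> S"
  have "((\<lambda>z. \<phi> z - (\<phi>2 z / 2 - T * \<phi>1 z) / g z) has_field_derivative
     \<phi>1 z - (((4 * (g z + T\<^sup>2) * \<phi>1 z + 2 * (g z * h z) * \<phi> z) / 2 - T * \<phi>2 z) * g z
       - (\<phi>2 z / 2 - T * \<phi>1 z) * (g z * h z)) / (g z * g z)) (at z)"
    using g_nz[OF z]
    by (intro DERIV_diff DERIV_divide DERIV_cdivide DERIV_cmult \<phi>[OF z] \<phi>1[OF z] \<phi>2[OF z] g[OF z])
  also have "\<phi>1 z - (((4 * (g z + T\<^sup>2) * \<phi>1 z + 2 * (g z * h z) * \<phi> z) / 2 - T * \<phi>2 z) * g z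
       - (\<phi>2 z / 2 - T * \<phi>1 z) * (g z * h z)) / (g z * g z) = k z - s z * F z"
    unfolding \<phi>2_eq[OF z] k_def s_def using g_nz[OF z]
    by (simp add: field_simps power2_eq_square)
  finally have D: "((\<lambda>z. \<phi> z - (\<phi>2 z / 2 - T * \<phi>1 z) / g z) has_field_derivative k z - s z * F z) (at z)" .
  show ?thesis by (rule DERIV_eq_on_open[OF S z _ D]) (rule F_eq)
qed

private lemma k': "z \<in> S \<Longrightarrow> (k has_field_derivative - 2 * g z * (\<phi> z - F z)) (at z)"
proof -
  assume z: "z \<in> S"
  have "((\<lambda>z. 2 * T * \<phi> z - \<phi>1 z) has_field_derivative 2 * T * \<phi>1 z - \<phi>2 z) (at z)"
    by (intro DERIV_diff DERIV_cmult \<phi>[OF z] \<phi>1[OF z])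
  thus ?thesis unfolding \<phi>2_eq[OF z] k_def[abs_def] by simp
qed

private lemma s': "z \<in> S \<Longrightarrow> (s has_field_derivative h1 z) (at z)"
  unfolding s_def[abs_def] using DERIV_add[OF DERIV_const h] by force

private definition "F2 z = - 2 * g z * (\<phi> z - F z) - (h1 z * F z + (k z - s z * F z) * s z)"

private definition "F3 z = - 2 * (g z * h z * (\<phi> z - F z) + (\<phi>1 z - (k z - s z * F z)) * g z)
  - (h2 z * F z + (k z - s z * F z) * h1 z + (F2 z * s z + h1 z * (k z - s z * F z)))"

private lemma F'': "z \<in> S \<Longrightarrow> ((\<lambda>z. k z - s z * F z) has_field_derivative F2 z) (at z)"
  unfolding F2_def by (intro DERIV_diff DERIV_mult k' s' F')

private lemma F''': "z \<in> S \<Longrightarrow> (F2 has_field_derivative F3 z) (at z)"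
proof -
  assume z: "z \<in> S"
  have "((\<lambda>z. - 2 * (g z * (\<phi> z - F z)) - (h1 z * F z + (k z - s z * F z) * s z)) has_field_derivative F3 z) (at z)"
    unfolding F3_def by (intro DERIV_diff DERIV_add DERIV_mult DERIV_cmult g h1 F'' F' s' \<phi> z)
  thus ?thesis by (simp add: F2_def[abs_def] mult.assoc)
qed

private lemma q': "z \<in> S \<Longrightarrow> deriv q z = g z * h z + s z * h1 z / 2 - h2 z / 2"
proof -
  assume z: "z \<in> S"
  have D: "((\<lambda>z. g z + (T + h z / 2)\<^sup>2 - h1 z / 2) has_field_derivative g z * h z + s z * h1 z / 2 - h2 z / 2) (at z)"
    by (rule derivative_eq_intros g h h1 z refl | simp add: s_def field_simps)+
  show ?thesis by (rule DERIV_imp_deriv, rule DERIV_eq_on_open[OF S z _ D]) (rule q_eq)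
qed

lemma darboux_sym_square_op:
  assumes z: "z \<in> S"
  shows "sym_square_op q F z = 0"
proof -
  have D: "deriv F z = k z - s z * F z" "(deriv ^^ 2) F z = F2 z" "(deriv ^^ 3) F z = F3 z"
    using higher_derivs_on_open[OF S, of F "\<lambda>z. k z - s z * F z" F2 F3 z] F' F'' F''' z by auto
  have q: "q z = g z + (s z)\<^sup>2 / 4 - h1 z / 2"
    unfolding q_eq[OF z] s_def by (simp add: field_simps power2_eq_square)
  \<comment> \<open>Eliminating h and phi' in favour of s and k leaves a polynomial
    identity.\<close>
  have h: "h z = s z - 2 * T" and \<phi>1: "\<phi>1 z = 2 * T * \<phi> z - k z" by (simp_all add: s_def k_def)
  show ?thesis
    unfolding sym_square_op_def D q'[OF z] q F3_def F2_def h \<phi>1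
    by (simp add: field_simps power2_eq_square)
qed

text \<open>The right-hand side is the first integral of phi for the potential g + T^2: this is the
  invariance of the squared Wronskian, in terms of products.\<close>

lemma darboux_first_integral:
  assumes z: "z \<in> S"
  shows "first_integral q F z = (g z + T\<^sup>2) * (\<phi> z)\<^sup>2 - 1 / 2 * \<phi> z * \<phi>2 z + 1 / 4 * (\<phi>1 z)\<^sup>2"
proof -
  have D: "deriv F z = k z - s z * F z" "(deriv ^^ 2) F z = F2 z" "(deriv ^^ 3) F z = F3 z"
    using higher_derivs_on_open[OF S, of F "\<lambda>z. k z - s z * F z" F2 F3 z] F' F'' F''' z by auto
  have q: "q z = g z + (s z)\<^sup>2 / 4 - h1 z / 2"
    unfolding q_eq[OF z] s_def by (simp add: field_simps power2_eq_square)
  have \<phi>1: "\<phi>1 z = 2 * T * \<phi> z - k z" by (simp_all add: k_def)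
  show ?thesis
    unfolding first_integral_def D q F2_def \<phi>2_eq[OF z] \<phi>1
    by (simp add: field_simps power2_eq_square)
qed

text \<open>F = 0 forces k = F' + s F = 0, and then 0 = k' = -2 g phi. Hence the transformed
  solution vanishes identically only if the original one does.\<close>

lemma darboux_eq_0_imp:
  assumes F: "\<And>z. z \<in> S \<Longrightarrow> F z = 0" and z: "z \<in> S"
  shows "\<phi> z = 0"
proof -
  have k: "k z = 0" if z: "z \<in> S" for z
  proof -
    have "(F has_field_derivative 0) (at z)"
      by (rule DERIV_eq_on_open[OF S z _ DERIV_const[of 0]]) (rule F)
    thus ?thesis using DERIV_unique[OF F'[OF z]] F[OF z] by force
  qed
  have "(k has_field_derivative 0) (at z)"
    by (rule DERIV_eq_on_open[OF S z _ DERIV_const[of 0]]) (rule k)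
  thus ?thesis using DERIV_unique[OF k'[OF z]] F[OF z] g_nz[OF z] by force
qed

end

section \<open>Evaluation of the two spectral polynomials\<close>

context complex_lattice begin

lemma first_integral_eq:
  assumes "open S" "z \<in> S" "\<And>z. z \<in> S \<Longrightarrow> (f has_field_derivative f1 z) (at z)"
    "\<And>z. z \<in> S \<Longrightarrow> (f1 has_field_derivative f2 z) (at z)"
  shows "first_integral Q f z = Q z * (f z)\<^sup>2 - 1 / 2 * f z * f2 z + 1 / 4 * (f1 z)\<^sup>2"
proof -
  have 1: "deriv f z = f1 z" using assms DERIV_imp_deriv by blast
  have "eventually (\<lambda>z. z \<in> S) (nhds z)" using assms(1,2) by (rule eventually_nhds_in_open)
  hence "eventually (\<lambda>z. deriv f z = f1 z) (nhds z)"
    by eventually_elim (use assms DERIV_imp_deriv in blast)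
  hence "deriv (deriv f) z = deriv f1 z" by (intro deriv_cong_ev) auto
  also have "\<dots> = f2 z" using assms DERIV_imp_deriv by blast
  finally show ?thesis by (simp add: first_integral_def 1 numeral_2_eq_2)
qed

text \<open>Only indices with nonzero weight are constrained: in the z-derivatives the term k = 0,
  whose coefficient has the largest degree, has weight 0.\<close>

lemma degree_lin_comb:
  assumes "\<And>k. k \<le> n \<Longrightarrow> a k \<noteq> 0 \<Longrightarrow> degree (c k) \<le> d"
  shows "degree (lin_comb c n a) \<le> d"
  unfolding lin_comb_def
proof (rule degree_sum_le)
  fix k assume "k \<in> {..n}"
  thus "degree (smult (a k) (c k)) \<le> d"
    using assms[of k] by (cases "a k = 0") auto
qed auto

lemma lin_comb_meromorphic:
  assumes "\<And>k. (\<lambda>z. a z k) meromorphic_on A"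
  shows "(\<lambda>z. coeff (lin_comb c n (a z)) i) meromorphic_on A"
  unfolding coeff_lin_comb by (intro meromorphic_intros assms)

lemma deriv_wp_meromorphic: "deriv wp meromorphic_on UNIV"
  using meromorphic_on_higher_deriv[OF wp_meromorphic, of 1] by simp

lemma wp_coeffs_meromorphic:
  "(\<lambda>z. wp z ^ k) meromorphic_on UNIV"
  "(\<lambda>z. of_nat k * wp z ^ (k - 1) * deriv wp z) meromorphic_on UNIV"
  "(\<lambda>z. of_nat k * of_nat (k - 1) * wp z ^ (k - 2) * (deriv wp z)\<^sup>2
      + of_nat k * wp z ^ (k - 1) * (6 * (wp z)\<^sup>2 - wp_a)) meromorphic_on UNIV"
  by (intro meromorphic_intros wp_meromorphic deriv_wp_meromorphic)+

text \<open>The coefficients c are exported along with the spectral polynomial because the Darboux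
  transformation acts on the solution. Working on \<open>regular_set p\<close> gives both equations
  a common domain.\<close>

lemma lame_solution:
  assumes n: "n > 0" and p: "2 * p \<notin> \<Lambda>"
  obtains c :: "nat \<Rightarrow> complex poly" and Q where
    "\<And>k. k \<le> n \<Longrightarrow> degree (c k) \<le> n - k" "coeff (c 0) n = 1"
    "\<And>t. \<not> (\<forall>\<^sub>\<approx>z. poly (wp_poly c n z) t = 0)"
    "\<And>z t. z \<in> regular_set p \<Longrightarrow> ((\<lambda>z. poly (wp_poly2 c n z) t) has_field_derivative
      4 * (of_nat (n * (n + 1)) * wp z + t) * poly (wp_poly1 c n z) t
      + 2 * (of_nat (n * (n + 1)) * deriv wp z) * poly (wp_poly c n z) t) (at z)"
    "\<And>z t. z \<in> regular_set p \<Longrightarrow> poly Q t = (of_nat (n * (n + 1)) * wp z + t) * (poly (wp_poly c n z) t)\<^sup>2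
      - 1 / 2 * poly (wp_poly c n z) t * poly (wp_poly2 c n z) t + 1 / 4 * (poly (wp_poly1 c n z) t)\<^sup>2"
    "lame_spectral_poly n \<tau> = Q"
proof -
  define S where "S = regular_set p"
  define N :: complex where "N = of_nat (n * (n + 1))"
  note S_notin = regular_set_notin[OF p, folded S_def]
  have open_S: "open S" and cosparse_S: "\<forall>\<^sub>\<approx>z. z \<in> S"
    unfolding S_def by (rule open_regular_set regular_set_cosparse)+
  obtain c :: "nat \<Rightarrow> complex poly" and \<gamma> where
    c: "\<And>k. k > n \<Longrightarrow> c k = 0" "\<And>k. k \<le> n \<Longrightarrow> degree (c k) \<le> n - k" "coeff (c 0) n = 1"
    "c n = [:\<gamma>:]" "\<gamma> \<noteq> 0"
    "\<And>k. smult (lame_alpha n k) (c k) = smult (4 * of_nat (k + 1)) (pCons 0 (c (k + 1)))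
        + smult (lame_beta wp_a k) (c (k + 2)) + smult (lame_gamma wp_b k) (c (k + 3))"
    using lame_coeffs_exist by blast
  have D0: "((\<lambda>z. poly (wp_poly c n z) t) has_field_derivative poly (wp_poly1 c n z) t) (at z)"
    and D1: "((\<lambda>z. poly (wp_poly1 c n z) t) has_field_derivative poly (wp_poly2 c n z) t) (at z)"
    and D2: "((\<lambda>z. poly (wp_poly2 c n z) t) has_field_derivative
      4 * (N * wp z + t) * poly (wp_poly1 c n z) t + 2 * (N * deriv wp z) * poly (wp_poly c n z) t) (at z)"
    if "z \<in> S" for z t
    using S_notin(1)[OF that] wp_poly2_has_field_derivative[OF _ c(6,1)] unfolding N_def
    by (auto intro: wp_poly_has_field_derivative wp_poly1_has_field_derivative)
  have nz: "\<not> (\<forall>\<^sub>\<approx>z. poly (wp_poly c n z) t = 0)" for t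
  proof
    assume 0: "\<forall>\<^sub>\<approx>z. poly (wp_poly c n z) t = 0"
    \<comment> \<open>For each t this polynomial is nonzero, so it has finitely many roots, each of
      which is avoided by \<open>wp\<close> off a sparse set.\<close>
    let ?A = "eval_coeffs c n t"
    have "coeff ?A n \<noteq> 0" using c by (simp add: coeff_eval_coeffs)
    hence "?A \<noteq> 0" by auto
    hence "\<forall>\<^sub>\<approx>z. \<forall>r\<in>{r. poly ?A r = 0}. wp z \<noteq> r"
      by (intro eventually_ball_finite ballI wp_avoid poly_roots_finite)
    with 0 have "\<forall>\<^sub>\<approx>z::complex. False"
      by eventually_elim (auto simp: poly_wp_poly)
    thus False by simp
  qed
  define E where "E = (\<lambda>z t. (N * wp z + t) * (poly (wp_poly c n z) t)\<^sup>2
      - 1 / 2 * poly (wp_poly c n z) t * poly (wp_poly2 c n z) t + 1 / 4 * (poly (wp_poly1 c n z) t)\<^sup>2)"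
  obtain z0 where z0: "z0 \<in> S" using cosparse_imp_ex[OF cosparse_S] by blast
  \<comment> \<open>Evaluation at one point z0 makes the first integral a polynomial in t; constancy
    in z then transfers it to all of S.\<close>
  define Q where "Q = [:N * wp z0, 1:] * (wp_poly c n z0)\<^sup>2 - smult (1 / 2) (wp_poly c n z0 * wp_poly2 c n z0)
     + smult (1 / 4) ((wp_poly1 c n z0)\<^sup>2)"
  have Q: "poly Q t = E z t" if z: "z \<in> S" for z t
  proof -
    have "(\<lambda>z. E z t) constant_on S"
    proof (rule has_field_derivative_0_imp_constant_on)
      show "connected S" "open S" unfolding S_def by (rule connected_regular_set open_regular_set)+
      fix z assume z: "z \<in> S"
      show "((\<lambda>z. E z t) has_field_derivative 0) (at z)"
        unfolding E_def
        by (rule derivative_eq_intros D0 D1 D2 wp_has_field_derivative S_notin z refl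
             | simp add: algebra_simps power2_eq_square)+
    qed
    hence "E z t = E z0 t" using z z0 unfolding constant_on_def by auto
    also have "\<dots> = poly Q t" by (simp add: Q_def E_def algebra_simps)
    finally show ?thesis by simp
  qed
  interpret monic_potential S 1 "\<lambda>_ z. N * wp z" "lame_potential n \<tau>"
  proof
    show "(\<lambda>z. N * wp z) holomorphic_on S"
      using S_notin by (intro holomorphic_intros holomorphic_on_subset[OF wp_holomorphic]) auto
  qed (use open_S cosparse_S in \<open>auto simp: lame_potential_def N_def\<close>)
  have "lame_spectral_poly n \<tau> = Q"
    unfolding lame_spectral_poly_def
  proof (rule spectral_poly_eqI)
    fix z assume z: "z \<in> S"
    have "degree (wp_poly c n z) \<le> n"
      unfolding wp_poly_def using c(2) by (intro degree_lin_comb) (meson diff_le_self order_trans)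
    moreover have cn: "coeff (wp_poly c n z) n = 1"
    proof -
      \<comment> \<open>For k > 0 the degree of c k is at most n - k < n, so only c 0 reaches degree
        n.\<close>
      have "wp z ^ k * coeff (c k) n = (if k = 0 then 1 else 0)" if "k \<le> n" for k
        using c(2)[OF that] c(3) n that by (auto intro!: coeff_eq_0)
      hence "coeff (wp_poly c n z) n = (\<Sum>k\<le>n. if k = 0 then 1 else 0)"
        unfolding wp_poly_def coeff_lin_comb by (intro sum.cong) auto
      thus ?thesis by simp
    qed
    hence "n \<le> degree (wp_poly c n z)" by (intro le_degree) simp
    ultimately show "degree (wp_poly c n z) = n" "lead_coeff (wp_poly c n z) = 1"
      using cn by (auto simp: order_antisym)
  next
    fix i show "(\<lambda>z. coeff (wp_poly c n z) i) meromorphic_on UNIV"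
      unfolding wp_poly_def by (intro lin_comb_meromorphic wp_coeffs_meromorphic)
  next
    fix w z assume "w \<in> \<Lambda>" "z \<in> S"
    thus "wp_poly c n (z + w) = wp_poly c n z"
      using S_notin by (simp add: wp_poly_def wp_periodic)
  next
    fix t z assume z: "z \<in> S"
    let ?f = "\<lambda>w. poly (wp_poly c n w) t"
    have D: "deriv ?f z = poly (wp_poly1 c n z) t"
      "(deriv ^^ 3) ?f z = 4 * (N * wp z + t) * poly (wp_poly1 c n z) t + 2 * (N * deriv wp z) * poly (wp_poly c n z) t"
      using higher_derivs_on_open[OF open_S, where f = ?f and ?f1.0 = "\<lambda>z. poly (wp_poly1 c n z) t"
          and ?f2.0 = "\<lambda>z. poly (wp_poly2 c n z) t" and ?f3.0 = "\<lambda>z. 4 * (N * wp z + t) * poly (wp_poly1 c n z) t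
             + 2 * (N * deriv wp z) * poly (wp_poly c n z) t"] D0 D1 D2 z by auto
    have "deriv (lame_potential n \<tau> t) z = N * deriv wp z"
      using deriv_q[OF z, of t] S_notin(1)[OF z]
        DERIV_imp_deriv[OF DERIV_cmult[OF wp_has_field_derivative]] by simp
    thus "sym_square_op (lame_potential n \<tau> t) (\<lambda>w. poly (wp_poly c n w) t) z = 0"
      unfolding sym_square_op_def D by (simp add: lame_potential_def N_def algebra_simps)
  next
    fix t
    show "\<forall>\<^sub>\<approx>z. poly Q t = first_integral (lame_potential n \<tau> t) (\<lambda>w. poly (wp_poly c n w) t) z"
      using cosparse_S
    proof eventually_elim
      case (elim z)
      show ?case
        using first_integral_eq[OF open_S elim, where f = "\<lambda>w. poly (wp_poly c n w) t"
            and ?f1.0 = "\<lambda>z. poly (wp_poly1 c n z) t" and ?f2.0 = "\<lambda>z. poly (wp_poly2 c n z) t"] D0 D1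
        by (simp add: Q[OF elim] E_def lame_potential_def N_def)
    qed
  qed (rule nz)
  thus ?thesis
    using that[of c Q] c(2,3) nz D2 Q unfolding E_def N_def S_def by blast
qed

lemma sym_square_op_eq_on_open:
  assumes "open S" "z \<in> S" "\<And>w. w \<in> S \<Longrightarrow> Q w = R w"
  shows "sym_square_op Q f z = sym_square_op R f z" "first_integral Q f z = first_integral R f z"
proof -
  have "eventually (\<lambda>w. w \<in> S) (nhds z)" using assms(1,2) by (rule eventually_nhds_in_open)
  hence "eventually (\<lambda>w. Q w = R w) (nhds z)" by eventually_elim (rule assms(3))
  hence "deriv Q z = deriv R z" by (intro deriv_cong_ev) auto
  thus "sym_square_op Q f z = sym_square_op R f z" "first_integral Q f z = first_integral R f z"
    using assms(2,3) by (simp_all add: sym_square_op_def first_integral_def)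
qed

lemma gle_spectral_poly_eq:
  assumes n: "n > 0" and p: "2 * p \<notin> \<Lambda>"
  shows "gle_spectral_poly n p \<tau> =
    pcompose (lame_spectral_poly n \<tau>) [:- (of_nat (n * (n + 1)) * wp p), 0, 1:]"
proof -
  define S where "S = regular_set p"
  define N :: complex where "N = of_nat (n * (n + 1))"
  define r :: "complex poly" where "r = [:- (N * wp p), 0, 1:]"
  note S_notin = regular_set_notin[OF p, folded S_def]
  have open_S: "open S" and cosparse_S: "\<forall>\<^sub>\<approx>z. z \<in> S"
    unfolding S_def by (rule open_regular_set regular_set_cosparse)+
  obtain c :: "nat \<Rightarrow> complex poly" and Q where c: "\<And>k. k \<le> n \<Longrightarrow> degree (c k) \<le> n - k" "coeff (c 0) n = 1"
    and nz: "\<And>t. \<not> (\<forall>\<^sub>\<approx>z. poly (wp_poly c n z) t = 0)"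
    and D2: "\<And>z t. z \<in> S \<Longrightarrow> ((\<lambda>z. poly (wp_poly2 c n z) t) has_field_derivative
      4 * (N * wp z + t) * poly (wp_poly1 c n z) t + 2 * (N * deriv wp z) * poly (wp_poly c n z) t) (at z)"
    and Q: "\<And>z t. z \<in> S \<Longrightarrow> poly Q t = (N * wp z + t) * (poly (wp_poly c n z) t)\<^sup>2
      - 1 / 2 * poly (wp_poly c n z) t * poly (wp_poly2 c n z) t + 1 / 4 * (poly (wp_poly1 c n z) t)\<^sup>2"
    and lame: "lame_spectral_poly n \<tau> = Q"
    by (rule lame_solution[OF n p, folded S_def N_def]) (rule that; blast)
  \<comment> \<open>The Lame coefficients at the parameter T^2 - N wp p; composition with r doubles
    their degrees.\<close>
  define c' where "c' = (\<lambda>k. pcompose (c k) r)"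
  define g where "g = (\<lambda>z. N * (wp z - wp p))"
  define h where "h = (\<lambda>z. deriv wp z / (wp z - wp p))"
  define h1 where "h1 = (\<lambda>z. deriv (deriv wp) z / (wp z - wp p) - (h z)\<^sup>2)"
  define \<Phi> where "\<Phi> = (\<lambda>z. wp_poly c' n z - smult (1 / (2 * g z)) (wp_poly2 c' n z)
      + smult (1 / g z) (pCons 0 (wp_poly1 c' n z)))"
  have "N \<noteq> 0" using n unfolding N_def of_nat_eq_0_iff by simp
  hence g_nz: "g z \<noteq> 0" if "z \<in> S" for z using S_notin(4)[OF that] by (simp add: g_def)
  have h_holo: "h holomorphic_on S" and h1_holo: "h1 holomorphic_on S" and wp_holo: "wp holomorphic_on S"
  proof -
    have "wp holomorphic_on S" "deriv wp holomorphic_on S" "deriv (deriv wp) holomorphic_on S"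
      using S_notin(1)
      by (auto intro!: holomorphic_on_subset[OF wp_holomorphic] holomorphic_on_subset[OF deriv_wp_holomorphic]
          holomorphic_on_subset[OF deriv2_wp_holomorphic])
    thus "h holomorphic_on S" "h1 holomorphic_on S" "wp holomorphic_on S"
      unfolding h1_def h_def using S_notin by (auto intro!: holomorphic_intros)
  qed
  have comp: "poly (wp_poly c' n z) T = poly (wp_poly c n z) (T\<^sup>2 - N * wp p)"
    "poly (wp_poly1 c' n z) T = poly (wp_poly1 c n z) (T\<^sup>2 - N * wp p)"
    "poly (wp_poly2 c' n z) T = poly (wp_poly2 c n z) (T\<^sup>2 - N * wp p)" for z T
    unfolding wp_poly_def wp_poly1_def wp_poly2_def poly_lin_comb c'_def poly_pcompose
    by (simp_all add: r_def power2_eq_square)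
  have \<Phi>: "poly (\<Phi> z) T = poly (wp_poly c' n z) T - (poly (wp_poly2 c' n z) T / 2 - T * poly (wp_poly1 c' n z) T) / g z"
    if "z \<in> S" for z T
    using g_nz[OF that] by (simp add: \<Phi>_def field_simps)
  have pot: "gle_potential n p \<tau> T z = g z + (T + h z / 2)\<^sup>2 - h1 z / 2" if "z \<in> S" for z T
    using gle_potential_eq[OF p] that unfolding S_def g_def h_def h1_def N_def by simp
  \<comment> \<open>The coefficients come from expanding the square: q = T^2 + h T + (g + h^2/4 -
    h1/2).\<close>
  interpret monic_potential S 2 "\<lambda>j z. if j = 0 then g z + (h z)\<^sup>2 / 4 - h1 z / 2 else h z" "gle_potential n p \<tau>"
  proof
    show "(\<lambda>z. if j = 0 then g z + (h z)\<^sup>2 / 4 - h1 z / 2 else h z) holomorphic_on S" for j :: nat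
      unfolding g_def by (cases "j = 0") (auto intro!: holomorphic_intros h_holo h1_holo wp_holo)
    show "gle_potential n p \<tau> T z = T ^ 2 + (\<Sum>j<2. (if j = 0 then g z + (h z)\<^sup>2 / 4 - h1 z / 2 else h z) * T ^ j)"
      if "z \<in> S" for z T
      unfolding pot[OF that] by (simp add: numeral_2_eq_2 field_simps power2_eq_square)
  qed (use open_S cosparse_S in auto)
  have hyps:
    "((\<lambda>z. poly (wp_poly c' n z) T) has_field_derivative poly (wp_poly1 c' n z) T) (at z)"
    "((\<lambda>z. poly (wp_poly1 c' n z) T) has_field_derivative poly (wp_poly2 c' n z) T) (at z)"
    "((\<lambda>z. poly (wp_poly2 c' n z) T) has_field_derivative 4 * (g z + T\<^sup>2) * poly (wp_poly1 c' n z) T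
      + 2 * (g z * h z) * poly (wp_poly c' n z) T) (at z)"
    "(g has_field_derivative g z * h z) (at z)"
    "(h has_field_derivative h1 z) (at z)"
    "(h1 has_field_derivative deriv h1 z) (at z)" if z: "z \<in> S" for z T
  proof -
    note zn = S_notin[OF z]
    have gh: "g z * h z = N * deriv wp z" using zn by (simp add: g_def h_def)
    show "((\<lambda>z. poly (wp_poly c' n z) T) has_field_derivative poly (wp_poly1 c' n z) T) (at z)"
      "((\<lambda>z. poly (wp_poly1 c' n z) T) has_field_derivative poly (wp_poly2 c' n z) T) (at z)"
      using zn by (auto intro: wp_poly_has_field_derivative wp_poly1_has_field_derivative)
    have eq: "N * wp z + (T\<^sup>2 - N * wp p) = g z + T\<^sup>2" by (simp add: g_def algebra_simps)
    show "((\<lambda>z. poly (wp_poly2 c' n z) T) has_field_derivative 4 * (g z + T\<^sup>2) * poly (wp_poly1 c' n z) T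
      + 2 * (g z * h z) * poly (wp_poly c' n z) T) (at z)"
      using D2[OF z, of "T\<^sup>2 - N * wp p"] unfolding comp gh eq .
    show "(g has_field_derivative g z * h z) (at z)"
      unfolding gh unfolding g_def
      by (rule derivative_eq_intros wp_has_field_derivative zn refl | simp)+
    show "(h has_field_derivative h1 z) (at z)"
    proof -
      have "(h has_field_derivative (deriv (deriv wp) z * (wp z - wp p) - deriv wp z * (deriv wp z - 0))
          / ((wp z - wp p) * (wp z - wp p))) (at z)"
        unfolding h_def using zn
        by (intro DERIV_divide DERIV_diff DERIV_const wp_has_field_derivative deriv_wp_has_field_derivative) auto
      also have "(deriv (deriv wp) z * (wp z - wp p) - deriv wp z * (deriv wp z - 0)) / ((wp z - wp p) * (wp z - wp p)) = h1 z"
        unfolding h1_def h_def using zn by (simp add: diff_divide_distrib power2_eq_square)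
      finally show ?thesis .
    qed
    show "(h1 has_field_derivative deriv h1 z) (at z)"
      by (rule holomorphic_derivI[OF h1_holo open_S z])
  qed
  have "spectral_poly \<tau> (gle_potential n p \<tau>) (2 * n) = pcompose Q r"
  proof (rule spectral_poly_eqI)
    fix z assume z: "z \<in> S"
    have deg_r: "degree r = 2" by (simp add: r_def)
    have deg_c': "degree (c' k) \<le> 2 * (n - k)" if "k \<le> n" for k
      using c(1)[OF that] by (simp add: c'_def degree_pcompose deg_r)
    \<comment> \<open>Since the term k = 0 drops out, even T times the first derivative has degree
      below 2 n; the top coefficient of \<Phi> is that of the untransformed solution.\<close>
    have deg1: "degree (wp_poly1 c' n z) \<le> 2 * (n - 1)" and deg2: "degree (wp_poly2 c' n z) \<le> 2 * (n - 1)"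
      unfolding wp_poly1_def wp_poly2_def
    proof (safe intro!: degree_lin_comb)
      fix k assume "k \<le> n" "of_nat k * wp z ^ (k - 1) * deriv wp z \<noteq> 0"
      hence "k \<noteq> 0" by (intro notI) simp
      with deg_c'[OF \<open>k \<le> n\<close>] show "degree (c' k) \<le> 2 * (n - 1)" by linarith
    next
      fix k assume "k \<le> n" "of_nat k * of_nat (k - 1) * wp z ^ (k - 2) * (deriv wp z)\<^sup>2
        + of_nat k * wp z ^ (k - 1) * (6 * (wp z)\<^sup>2 - wp_a) \<noteq> 0"
      hence "k \<noteq> 0" by (intro notI) simp
      with deg_c'[OF \<open>k \<le> n\<close>] show "degree (c' k) \<le> 2 * (n - 1)" by linarith
    qed
    have deg0: "degree (wp_poly c' n z) \<le> 2 * n"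
      unfolding wp_poly_def by (intro degree_lin_comb order_trans[OF deg_c']) auto
    have "coeff (c' 0) (2 * n) = 1"
    proof -
      have d: "degree (c 0) = n" using c by (metis diff_zero le_antisym le_degree zero_le one_neq_zero)
      have "lead_coeff (c' 0) = 1"
        unfolding c'_def by (subst lead_coeff_comp) (use c(2) d in \<open>simp_all add: deg_r r_def\<close>)
      moreover have "degree (c' 0) = 2 * n" by (simp add: c'_def degree_pcompose deg_r d)
      ultimately show ?thesis by simp
    qed
    hence "wp z ^ k * coeff (c' k) (2 * n) = (if k = 0 then 1 else 0)" if "k \<le> n" for k
      using deg_c'[OF that] n that by (auto intro!: coeff_eq_0)
    hence "coeff (wp_poly c' n z) (2 * n) = (\<Sum>k\<le>n. if k = 0 then 1 else 0)"
      unfolding wp_poly_def coeff_lin_comb by (intro sum.cong) auto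
    moreover have "coeff (wp_poly2 c' n z) (2 * n) = 0" "coeff (pCons 0 (wp_poly1 c' n z)) (2 * n) = 0"
      using deg1 deg2 n degree_pCons_le[of 0 "wp_poly1 c' n z"] by (auto intro!: coeff_eq_0)
    ultimately have lc: "coeff (\<Phi> z) (2 * n) = 1"
      unfolding \<Phi>_def coeff_add coeff_diff coeff_smult by simp
    have "degree (\<Phi> z) \<le> 2 * n"
      unfolding \<Phi>_def using deg0 deg1 deg2 n
      by (intro degree_add_le degree_diff_le order_trans[OF degree_smult_le] order_trans[OF degree_pCons_le]) auto
    moreover have "2 * n \<le> degree (\<Phi> z)" using lc by (intro le_degree) simp
    ultimately show "degree (\<Phi> z) = 2 * n" "lead_coeff (\<Phi> z) = 1" using lc by (auto simp: order_antisym)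
  next
    fix i
    have m: "(\<lambda>z. coeff (wp_poly c' n z) j) meromorphic_on UNIV" "(\<lambda>z. coeff (wp_poly1 c' n z) j) meromorphic_on UNIV"
      "(\<lambda>z. coeff (wp_poly2 c' n z) j) meromorphic_on UNIV" for j
      unfolding wp_poly_def wp_poly1_def wp_poly2_def by (intro lin_comb_meromorphic wp_coeffs_meromorphic)+
    have "(\<lambda>z. coeff (pCons 0 (wp_poly1 c' n z)) i) meromorphic_on UNIV"
      unfolding coeff_pCons by (cases i) (auto intro: m)
    thus "(\<lambda>z. coeff (\<Phi> z) i) meromorphic_on UNIV"
      unfolding \<Phi>_def g_def coeff_add coeff_diff coeff_smult by (intro meromorphic_intros m wp_meromorphic)
  next
    fix w z assume "w \<in> \<Lambda>" "z \<in> S"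
    thus "\<Phi> (z + w) = \<Phi> z"
      using S_notin by (simp add: \<Phi>_def g_def wp_poly_def wp_poly1_def wp_poly2_def wp_periodic deriv_wp_periodic)
  next
    fix T
    show "\<not> (\<forall>\<^sub>\<approx>z. poly (\<Phi> z) T = 0)"
    proof
      assume "\<forall>\<^sub>\<approx>z. poly (\<Phi> z) T = 0"
      with cosparse_S have ev: "\<forall>\<^sub>\<approx>z. z \<in> S \<and> poly (\<Phi> z) T = 0" by eventually_elim simp
      \<comment> \<open>\<open>darboux_eq_0_imp\<close> needs an open set on which F vanishes
        throughout, so the data are restricted to the cosparse set where it does.\<close>
      define S' where "S' = {z. z \<in> S \<and> poly (\<Phi> z) T = 0}"
      have "closed {z. \<not> (z \<in> S \<and> poly (\<Phi> z) T = 0)}"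
        using ev sparse_in_UNIV_imp_closed unfolding eventually_cosparse by blast
      moreover have "S' = - {z. \<not> (z \<in> S \<and> poly (\<Phi> z) T = 0)}" by (auto simp: S'_def)
      ultimately have S': "open S'" by (simp only: open_Compl)
      have "poly (wp_poly c' n z) T = 0" if "z \<in> S'" for z
        by (rule darboux_eq_0_imp[OF S', where \<phi> = "\<lambda>z. poly (wp_poly c' n z) T" and T = T
              and ?\<phi>1.0 = "\<lambda>z. poly (wp_poly1 c' n z) T" and ?\<phi>2.0 = "\<lambda>z. poly (wp_poly2 c' n z) T"
              and g = g and h = h and ?h1.0 = h1 and ?h2.0 = "deriv h1" and F = "\<lambda>z. poly (\<Phi> z) T"
              and q = "\<lambda>z. g z + (T + h z / 2)\<^sup>2 - h1 z / 2"])
           (use hyps g_nz \<Phi> that in \<open>auto simp: S'_def\<close>)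
      hence "\<forall>\<^sub>\<approx>z. poly (wp_poly c n z) (T\<^sup>2 - N * wp p) = 0"
        using ev by (auto simp: S'_def comp elim: eventually_mono)
      thus False using nz by blast
    qed
  next
    fix T z assume z: "z \<in> S"
    have "sym_square_op (\<lambda>z. g z + (T + h z / 2)\<^sup>2 - h1 z / 2) (\<lambda>w. poly (\<Phi> w) T) z = 0"
      by (rule darboux_sym_square_op[OF open_S, where \<phi> = "\<lambda>z. poly (wp_poly c' n z) T" and T = T
              and ?\<phi>1.0 = "\<lambda>z. poly (wp_poly1 c' n z) T" and ?\<phi>2.0 = "\<lambda>z. poly (wp_poly2 c' n z) T"
              and g = g and h = h and ?h1.0 = h1 and ?h2.0 = "deriv h1"])
         (use hyps g_nz \<Phi> z in auto)
    thus "sym_square_op (gle_potential n p \<tau> T) (\<lambda>w. poly (\<Phi> w) T) z = 0"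
      using sym_square_op_eq_on_open(1)[OF open_S z pot] by simp
  next
    fix T
    show "\<forall>\<^sub>\<approx>z. poly (pcompose Q r) T = first_integral (gle_potential n p \<tau> T) (\<lambda>w. poly (\<Phi> w) T) z"
      using cosparse_S
    proof eventually_elim
      case (elim z)
      have "first_integral (\<lambda>z. g z + (T + h z / 2)\<^sup>2 - h1 z / 2) (\<lambda>w. poly (\<Phi> w) T) z
        = (g z + T\<^sup>2) * (poly (wp_poly c' n z) T)\<^sup>2 - 1 / 2 * poly (wp_poly c' n z) T * poly (wp_poly2 c' n z) T
          + 1 / 4 * (poly (wp_poly1 c' n z) T)\<^sup>2"
        by (rule darboux_first_integral[OF open_S, where \<phi> = "\<lambda>z. poly (wp_poly c' n z) T" and T = T
              and ?\<phi>1.0 = "\<lambda>z. poly (wp_poly1 c' n z) T" and ?\<phi>2.0 = "\<lambda>z. poly (wp_poly2 c' n z) T"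
              and g = g and h = h and ?h1.0 = h1 and ?h2.0 = "deriv h1"])
           (use hyps g_nz \<Phi> elim in auto)
      moreover have "N * wp z + (T\<^sup>2 - N * wp p) = g z + T\<^sup>2" by (simp add: g_def algebra_simps)
      moreover have "poly (pcompose Q r) T = poly Q (T\<^sup>2 - N * wp p)"
        by (simp add: poly_pcompose r_def power2_eq_square)
      ultimately show ?case
        using Q[OF elim, of "T\<^sup>2 - N * wp p"] sym_square_op_eq_on_open(2)[OF open_S elim pot]
        by (simp add: comp)
    qed
  qed
  thus ?thesis unfolding gle_spectral_poly_def lame r_def N_def .
qed

end

theorem corollary1p9:
  fixes n :: nat and \<tau> p T :: complex
  assumes "n > 0" and "Im \<tau> > 0" and "2 * p \<notin> period_lattice \<tau>"
  shows "poly (gle_spectral_poly n p \<tau>) T =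
         poly (lame_spectral_poly n \<tau>) (T\<^sup>2 - of_nat (n * (n + 1)) * weierstrass_wp \<tau> p)"
proof -
  interpret complex_lattice \<tau> by standard (rule assms)
  show ?thesis
    unfolding gle_spectral_poly_eq[OF assms(1,3)] by (simp add: poly_pcompose power2_eq_square)
qed

end
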